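(* Consider the module $\mathbf W$ for the universal double affine Hecke algebra $\hat H_q$ on which, for $n\in\{0,1,2,3\}$, the generator $t_n$ is represented by the matrix $\mathcal T_n$ relative to the basis $\mathcal C$ (all defined in the context). Put $$\mathbf A=t_0t_1+(t_0t_1)^{-1},\qquad \mathbf B=t_3t_0+(t_3t_0)^{-1},\qquad \mathbf B^{\dagger}=t_1t_2+(t_1t_2)^{-1}.$$ Then the following equalities of linear maps on $\mathbf W$ hold: (1) $\mathbf A=\dfrac{1}{h\sqrt{sq}}\bigl(A-(\theta_0-h-hsq)I\bigr)$; (2) $\mathbf B=\dfrac{1}{\tilde h^*\sqrt{\tilde s^*q}}\bigl(\tilde A^*-(\tilde\theta^*_0-\tilde h^*-\tilde h^*\tilde s^*q)I\bigr)$; (3) $\mathbf B^{\dagger}=\dfrac{1}{h^*\sqrt{s^*q}}\bigl(A^*-(\theta^*_0-h^*-h^*s^*q)I\bigr)$; (4) $\dfrac{t_0-k_0^{-1}}{k_0-k_0^{-1}}=\tilde{\mathfrak p}$; (5) $\dfrac{t_1-k_1^{-1}}{k_1-k_1^{-1}}=\mathfrak p$.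
   Context: **Graph.** $\Gamma$ is a finite undirected connected graph without loops or multiple edges, with vertex set $X$, path-length distance $\partial$ and diameter $d\ge 3$; $\Gamma_i(y)=\{z\in X:\partial(y,z)=i\}$, $\Gamma(y)=\Gamma_1(y)$. $\Gamma$ is distance-regular: $p^h_{ij}=|\Gamma_i(y)\cap\Gamma_j(z)|$ depends only on $i,j$ and $h=\partial(y,z)$. Put $a_i=p^i_{1,i}$, $b_i=p^i_{1,i+1}$, $c_i=p^i_{1,i-1}$ ($b_d=c_0=0$), $k=b_0$. Complex matrices indexed by $X$ act on $\mathbf V=\mathbb C^X$ with inner product $\langle u,v\rangle=u^t\overline v$; $\hat y$ is the standard basis vector at $y$, $\hat Y=\sum_{y\in Y}\hat y$, $\mathbf j=\hat X$. $A_i$ is the $i$-th distance matrix, $A=A_1$, $\mathcal M$ is the algebra generated by $A$ (Bose–Mesner algebra), with primitive idempotents $E_0=|X|^{-1}J,E_1,\dots,E_d$ ($J$ all-ones) and $A=\sum_i\theta_iE_i$; $m_i=\operatorname{rank}E_i$. $\Gamma$ is $Q$-polynomial with respect to $E_0,\dots,E_d$: writing $E_i\circ E_j=|X|^{-1}\sum_h q^h_{ij}E_h$ (entrywise product), $q^h_{ij}=0$ (resp. $\ne0$) if one of $h,i,j$ is greater than (resp. equal to) the sum of the other two. It is assumed that $\theta_0>\theta_1>\dots>\theta_d$. **Clique and Terwilliger algebras.** $C\subseteq X$ is a Delsarte clique: a nonempty set of mutually adjacent vertices with $|C|=1-k/\theta_d$. Fix $x\in C$. For $y\in X$, $A^*(y)$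 is the diagonal matrix with $(z,z)$-entry $|X|(E_1)_{yz}$; $A^*=A^*(x)$. $E^*_i$ ($0\le i\le d$) is the diagonal projection onto $\mathrm{Span}\{\hat z:\partial(x,z)=i\}$, and $A^*=\sum_i\theta^*_iE^*_i$. $T$ is the algebra generated by $A,A^*$. For $0\le i\le d-1$, $C_i=\{y\in X:\partial(y,C)=i\}$ (these partition $X$), and $\tilde E^*_i$ is the diagonal projection onto $\mathrm{Span}\{\hat z:z\in C_i\}$. $\tilde A^*=|C|^{-1}\sum_{y\in C}A^*(y)$; $\tilde A^*=\sum_{i=0}^{d-1}\tilde\theta^*_i\tilde E^*_i$ with $\tilde\theta_i^*$ mutually distinct. $\tilde T$ is the algebra generated by $A,\tilde A^*$. **Leonard systems.** On a complex vector space $V$ of dimension $n+1$, a Leonard system of diameter $n$ is a sequence $(B;B^*;\{F_i\}_{i=0}^n;\{F^*_i\}_{i=0}^n)$ where $B,B^*\in\mathrm{End}(V)$ each have $n+1$ distinct eigenvalues, $\{F_i\}$ (resp. $\{F_i^*\}$) is an ordering of the primitive idempotents (spectral projections) of $B$ (resp. $B^*$), and $F_iB^*F_j$, $F^*_iBF^*_j$ are $0$ if $|i-j|>1$ and nonzero if $|i-j|=1$. Eigenvalues $\vartheta_i$, dual eigenvalues $\vartheta^*_i$ are defined by $BF_i=\vartheta_iF_i$, $B^*F_i^*=\vartheta_i^*F_i^*$. The first split sequence is the sequence of nonzero scalars $\varphi_1,\dots,\varphi_n$ such that in some basis $B$ is lower bidiagonal with diagonal $\vartheta_0,\dots,\vartheta_n$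 and subdiagonal entries $1$, and $B^*$ is upper bidiagonal with diagonal $\vartheta^*_0,\dots,\vartheta_n^*$ and superdiagonal $\varphi_1,\dots,\varphi_n$. The second split sequence $\{\phi_i\}$ is the first split sequence of $(B;B^*;\{F_{n-i}\};\{F^*_i\})$. The parameter array is $(\{\vartheta_i\},\{\vartheta_i^*\},\{\varphi_i\},\{\phi_i\})$. **$q$-Racah assumption.** $q\in\mathbb C$ is nonzero, $q^2\neq1$. $(A;A^*;\{E_i\}_{i=0}^d;\{E_i^*\}_{i=0}^d)$ acts on $\mathcal M\hat x$ (the primary $T$-module, of dimension $d+1$) as a Leonard system $\Phi$ with parameter array $(\{\theta_i\},\{\theta^*_i\},\{\varphi_i\},\{\phi_i\})$. $\Gamma$ is assumed to have $q$-Racah type: there are nonzero $h,h^*,s,s^*,r_1,r_2\in\mathbb C$ (fixed) with $r_1r_2=ss^*q^{d+1}$, none of $q^i,r_1q^i,r_2q^i,s^*q^i/r_1,s^*q^i/r_2$ equal to $1$ for $1\le i\le d$, neither of $sq^i,s^*q^i$ equal to $1$ for $2\le i\le 2d$, and $\theta_i=\theta_0+h(1-q^i)(1-sq^{i+1})q^{-i}$, $\theta^*_i=\theta^*_0+h^*(1-q^i)(1-s^*q^{i+1})q^{-i}$ ($0\le i\le d$), $\varphi_i=hh^*q^{1-2i}(1-q^i)(1-q^{i-d-1})(1-r_1q^i)(1-r_2q^i)$, $\phi_i=hh^*q^{1-2i}(1-q^i)(1-q^{i-d-1})(r_1-s^*q^i)(r_2-s^*q^i)/s^*$ ($1\le i\le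 d$). **The space $\mathbf W$.** For $0\le i\le d-1$, $C_i^-=C_i\cap\Gamma_i(x)$, $C_i^+=C_i\cap\Gamma_{i+1}(x)$; $\mathbf W=\mathrm{Span}\{\hat C_i^{\pm}\}_{i=0}^{d-1}$, which has basis $\mathcal C=\{\hat C_0^-,\hat C_0^+,\hat C_1^-,\hat C_1^+,\dots,\hat C_{d-1}^-,\hat C_{d-1}^+\}$ (in this order) and is invariant under $A,A^*,\tilde A^*$. $\mathfrak p:\mathbf W\to\mathbf W$ is the orthogonal projection onto $\mathcal M\hat x\subseteq\mathbf W$; $\tilde{\mathfrak p}:\mathbf W\to\mathbf W$ is the orthogonal projection onto $\mathcal M\hat C\subseteq\mathbf W$. Also $\tilde s^*=s^*q$, $\tilde h^*=\frac{s^*q^{-1}-r_1r_2}{s^*-r_1r_2}h^*$ (nonzero). **The algebra and its action.** Fix a square root $q^{1/2}$ of $q$ and square roots $s^{1/2},s^{*1/2},r_1^{1/2},r_2^{1/2}$ with $r_1^{1/2}r_2^{1/2}=s^{1/2}s^{*1/2}q^{(d+1)/2}$; all square roots of monomials are the corresponding monomials in these, e.g. $\sqrt{sq}=s^{1/2}q^{1/2}$, $\sqrt{s^*q}=s^{*1/2}q^{1/2}$, $\sqrt{\tilde s^*q}=s^{*1/2}q$. $\hat H_q$ is the $\mathbb C$-algebra with generators $t_n^{\pm1}$ ($n=0,1,2,3$) and relations $t_nt_n^{-1}=t_n^{-1}t_n=1$; $t_n+t_n^{-1}$ central; $t_0t_1t_2t_3=q^{-1/2}$. Put $\sigma=s^{*1/2}$,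 $\rho=r_1^{1/2}r_2^{1/2}$, $\kappa=s^{*1/2}q^{(d+1)/2}$, $k_0=\rho/\sigma$, $k_1=q^{-d/2}$ (neither equals $\pm1$). For $0\le i\le d-1$ let $P_i=\frac{(r_1-s^*q^{i+1})(r_2-s^*q^{i+1})}{1-s^*q^{2i+2}}$, $R_i=\frac{(1-r_1q^{i+1})(1-r_2q^{i+1})}{1-s^*q^{2i+2}}$, and for $1\le i\le d-1$ let $U_i=\frac{(1-q^{i-d})(1-s^*q^{i+1})}{1-s^*q^{2i+1}}$, $V_i=\frac{(1-q^i)(1-s^*q^{d+i+1})}{1-s^*q^{2i+1}}$, $Z_i=\frac{(1-q^i)(1-q^{i-d})}{1-s^*q^{2i+1}}$. Define $$\mathfrak t_0(i)=\begin{bmatrix}\frac{P_i+s^*}{\sigma\rho}&-\frac{\sigma}{\rho}R_i\\ \frac{P_i}{\sigma\rho}&\frac{\sigma}{\rho}(1-R_i)\end{bmatrix},\quad \mathfrak t_3(i)=\begin{bmatrix}\frac{1-R_i}{q^{i+1}\rho}&\frac{R_i}{q^{i+1}\rho}\\ -\frac{q^{i+1}}{\rho}P_i&\frac{q^{i+1}}{\rho}(P_i+s^* )\end{bmatrix}\quad(0\le i\le d-1),$$ $$\mathfrak t_1(i)=\begin{bmatrix}q^{d/2}U_i+q^{-d/2}&-q^{d/2}U_i\\ q^{-d/2}V_i&q^{-d/2}(1-V_i)\end{bmatrix},\quad \mathfrak t_2(i)=\begin{bmatrix}\frac{\kappa^2Z_i+1}{\kappa}&q^i\kappa U_i\\ -\frac{V_i}{q^i\kappa}&\kappa(1-Z_i)\end{bmatrix}\quad(1\le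 i\le d-1),$$ and $1\times1$ matrices $\mathfrak t_1(0)=\mathfrak t_1(d)=[q^{-d/2}]$, $\mathfrak t_2(0)=[\kappa]$, $\mathfrak t_2(d)=[\kappa^{-1}]$. For $n\in\{0,3\}$, $\mathcal T_n=\mathrm{blockdiag}[\mathfrak t_n(0),\dots,\mathfrak t_n(d-1)]$; for $n\in\{1,2\}$, $\mathcal T_n=\mathrm{blockdiag}[\mathfrak t_n(0),\mathfrak t_n(1),\dots,\mathfrak t_n(d)]$. A matrix $N$ represents a map $f$ relative to an ordered basis $w_1,\dots,w_{2d}$ when $f(w_j)=\sum_iN_{ij}w_i$. There is an $\hat H_q$-module structure on $\mathbf W$ in which $t_n$ is represented by $\mathcal T_n$ relative to $\mathcal C$. *)

theory Defs
  imports
    "HOL-Analysis.Analysis"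
    "HOL-Algebra.QuotRing"
    "HOL-Library.Poly_Mapping"
    "Jordan_Normal_Form.Matrix"
begin

text \<open>Vectors and matrices indexed by the vertex set (a finite type \<open>'v\<close>) are those of HOL-Analysis.
  Matrices that represent maps relative to an ordered basis are those of Jordan_Normal_Form;
  its infix notation for vector entries is not used.\<close>

no_notation vec_index (infixl "$" 100)

section \<open>Distance-regular graphs\<close>

text \<open>A graph is given by its adjacency relation; the vertex set is the whole type.\<close>

definition simple_connected_graph :: "('v \<Rightarrow> 'v \<Rightarrow> bool) \<Rightarrow> bool" where
  "simple_connected_graph adj \<longleftrightarrow>
     (\<forall>y z. adj y z \<longrightarrow> adj z y) \<and> (\<forall>y. \<not> adj y y) \<and> (\<forall>y z. \<exists>n. (adj ^^ n) y z)"

definition gdist :: "('v \<Rightarrow> 'v \<Rightarrow> bool) \<Rightarrow> 'v \<Rightarrow> 'v \<Rightarrow> nat" where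
  "gdist adj y z = (LEAST n. (adj ^^ n) y z)"

definition diameter :: "('v::finite \<Rightarrow> 'v \<Rightarrow> bool) \<Rightarrow> nat" where
  "diameter adj = Max (range (\<lambda>(y, z). gdist adj y z))"

definition gsphere :: "('v \<Rightarrow> 'v \<Rightarrow> bool) \<Rightarrow> nat \<Rightarrow> 'v \<Rightarrow> 'v set" where
  "gsphere adj i y = {z. gdist adj y z = i}"

definition distance_regular :: "('v::finite \<Rightarrow> 'v \<Rightarrow> bool) \<Rightarrow> bool" where
  "distance_regular adj \<longleftrightarrow> simple_connected_graph adj \<and>
     (\<forall>i j y z y' z'. gdist adj y z = gdist adj y' z' \<longrightarrow>
        card (gsphere adj i y \<inter> gsphere adj j z) = card (gsphere adj i y' \<inter> gsphere adj j z'))"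

text \<open>\<open>intersection_number adj h i j\<close> is $p^h_{ij}$; it is meaningful for distance-regular graphs and
  $h$ at most the diameter.\<close>

definition intersection_number :: "('v::finite \<Rightarrow> 'v \<Rightarrow> bool) \<Rightarrow> nat \<Rightarrow> nat \<Rightarrow> nat \<Rightarrow> nat" where
  "intersection_number adj h i j =
     (THE p. \<forall>y z. gdist adj y z = h \<longrightarrow> card (gsphere adj i y \<inter> gsphere adj j z) = p)"

definition b_number :: "('v::finite \<Rightarrow> 'v \<Rightarrow> bool) \<Rightarrow> nat \<Rightarrow> nat" where
  "b_number adj i = intersection_number adj i 1 (i + 1)"

section \<open>Bose-Mesner algebra and the Q-polynomial property\<close>

definition mscale :: "complex \<Rightarrow> complex^'n^'m \<Rightarrow> complex^'n^'m" where
  "mscale c M = (\<chi> i j. c * M $ i $ j)"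

definition hadamard :: "complex^'n^'m \<Rightarrow> complex^'n^'m \<Rightarrow> complex^'n^'m" where
  "hadamard M N = (\<chi> i j. M $ i $ j * N $ i $ j)"

definition all_ones :: "complex^'n^'m" where
  "all_ones = (\<chi> i j. 1)"

definition diag_matrix :: "('v \<Rightarrow> complex) \<Rightarrow> complex^'v^'v" where
  "diag_matrix f = (\<chi> y z. if y = z then f z else 0)"

definition distance_matrix :: "('v::finite \<Rightarrow> 'v \<Rightarrow> bool) \<Rightarrow> nat \<Rightarrow> complex^'v^'v" where
  "distance_matrix adj i = (\<chi> y z. if gdist adj y z = i then 1 else 0)"

definition matrix_subalgebra :: "(complex^'v^'v) set \<Rightarrow> bool" where
  "matrix_subalgebra S \<longleftrightarrow> Finite_Cartesian_Product.mat 1 \<in> S \<and>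
     (\<forall>M\<in>S. \<forall>N\<in>S. M + N \<in> S \<and> M ** N \<in> S) \<and> (\<forall>c. \<forall>M\<in>S. mscale c M \<in> S)"

definition bose_mesner :: "('v::finite \<Rightarrow> 'v \<Rightarrow> bool) \<Rightarrow> (complex^'v^'v) set" where
  "bose_mesner adj = matrix_subalgebra hull {distance_matrix adj 1}"

definition primitive_idempotent :: "(complex^'v^'v) set \<Rightarrow> complex^'v^'v \<Rightarrow> bool" where
  "primitive_idempotent S e \<longleftrightarrow> e \<in> S \<and> e \<noteq> 0 \<and> e ** e = e \<and>
     \<not> (\<exists>f\<in>S. \<exists>g\<in>S. f \<noteq> 0 \<and> g \<noteq> 0 \<and> f ** f = f \<and> g ** g = g \<and>
          f ** g = 0 \<and> g ** f = 0 \<and> e = f + g)"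

definition primitive_idempotent_ordering ::
    "('v::finite \<Rightarrow> 'v \<Rightarrow> bool) \<Rightarrow> (nat \<Rightarrow> complex^'v^'v) \<Rightarrow> bool" where
  "primitive_idempotent_ordering adj E \<longleftrightarrow>
     bij_betw E {..diameter adj} {e. primitive_idempotent (bose_mesner adj) e} \<and>
     E 0 = mscale (1 / of_nat CARD('v)) all_ones"

text \<open>\<open>kr h i j\<close> is the Krein parameter $q^h_{ij}$. Since the primitive idempotents are
  linearly independent, the first condition determines it.\<close>

definition Q_polynomial ::
    "('v::finite \<Rightarrow> 'v \<Rightarrow> bool) \<Rightarrow> (nat \<Rightarrow> complex^'v^'v) \<Rightarrow> bool" where
  "Q_polynomial adj E \<longleftrightarrow> primitive_idempotent_ordering adj E \<and>
     (\<exists>kr :: nat \<Rightarrow> nat \<Rightarrow> nat \<Rightarrow> complex.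
        (\<forall>i\<le>diameter adj. \<forall>j\<le>diameter adj.
           hadamard (E i) (E j) =
             mscale (1 / of_nat CARD('v)) (\<Sum>h\<le>diameter adj. mscale (kr h i j) (E h))) \<and>
        (\<forall>h\<le>diameter adj. \<forall>i\<le>diameter adj. \<forall>j\<le>diameter adj.
           (h > i + j \<or> i > h + j \<or> j > h + i \<longrightarrow> kr h i j = 0) \<and>
           (h = i + j \<or> i = h + j \<or> j = h + i \<longrightarrow> kr h i j \<noteq> 0)))"

text \<open>The matrix $A^*(y)$; the argument \<open>E1\<close> is the idempotent $E_1$.\<close>

definition dual_adjacency :: "complex^'v^'v \<Rightarrow> 'v \<Rightarrow> complex^'v^'v" where
  "dual_adjacency E1 y = diag_matrix (\<lambda>z. of_nat CARD('v) * E1 $ y $ z)"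

definition dual_idempotent ::
    "('v::finite \<Rightarrow> 'v \<Rightarrow> bool) \<Rightarrow> 'v \<Rightarrow> nat \<Rightarrow> complex^'v^'v" where
  "dual_idempotent adj x i = diag_matrix (\<lambda>z. if gdist adj x z = i then 1 else 0)"

section \<open>Delsarte cliques\<close>

text \<open>\<open>theta_min\<close> is the smallest eigenvalue $\theta_d$ of the graph.\<close>

definition delsarte_clique :: "('v::finite \<Rightarrow> 'v \<Rightarrow> bool) \<Rightarrow> real \<Rightarrow> 'v set \<Rightarrow> bool" where
  "delsarte_clique adj theta_min C \<longleftrightarrow> C \<noteq> {} \<and> (\<forall>y\<in>C. \<forall>z\<in>C. y \<noteq> z \<longrightarrow> adj y z) \<and>
     real (card C) = 1 - real (b_number adj 0) / theta_min"

definition clique_dist :: "('v::finite \<Rightarrow> 'v \<Rightarrow> bool) \<Rightarrow> 'v set \<Rightarrow> 'v \<Rightarrow> nat" where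
  "clique_dist adj C y = Min (gdist adj y ` C)"

definition clique_part :: "('v::finite \<Rightarrow> 'v \<Rightarrow> bool) \<Rightarrow> 'v set \<Rightarrow> nat \<Rightarrow> 'v set" where
  "clique_part adj C i = {y. clique_dist adj C y = i}"

definition clique_dual_idempotent ::
    "('v::finite \<Rightarrow> 'v \<Rightarrow> bool) \<Rightarrow> 'v set \<Rightarrow> nat \<Rightarrow> complex^'v^'v" where
  "clique_dual_idempotent adj C i = diag_matrix (\<lambda>z. if z \<in> clique_part adj C i then 1 else 0)"

definition clique_dual_adjacency :: "complex^'v^'v \<Rightarrow> 'v set \<Rightarrow> complex^'v^'v" where
  "clique_dual_adjacency E1 C = mscale (1 / of_nat (card C)) (\<Sum>y\<in>C. dual_adjacency E1 y)"

section \<open>The space W and its subspaces\<close>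

definition char_vec :: "'v set \<Rightarrow> complex^'v" where
  "char_vec Y = (\<chi> z. if z \<in> Y then 1 else 0)"

definition C_minus :: "('v::finite \<Rightarrow> 'v \<Rightarrow> bool) \<Rightarrow> 'v set \<Rightarrow> 'v \<Rightarrow> nat \<Rightarrow> 'v set" where
  "C_minus adj C x i = clique_part adj C i \<inter> gsphere adj i x"

definition C_plus :: "('v::finite \<Rightarrow> 'v \<Rightarrow> bool) \<Rightarrow> 'v set \<Rightarrow> 'v \<Rightarrow> nat \<Rightarrow> 'v set" where
  "C_plus adj C x i = clique_part adj C i \<inter> gsphere adj (i + 1) x"

definition W_basis :: "('v::finite \<Rightarrow> 'v \<Rightarrow> bool) \<Rightarrow> 'v set \<Rightarrow> 'v \<Rightarrow> (complex^'v) list" where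
  "W_basis adj C x =
     concat (map (\<lambda>i. [char_vec (C_minus adj C x i), char_vec (C_plus adj C x i)])
       [0..<diameter adj])"

definition W_space :: "('v::finite \<Rightarrow> 'v \<Rightarrow> bool) \<Rightarrow> 'v set \<Rightarrow> 'v \<Rightarrow> (complex^'v) set" where
  "W_space adj C x = vec.span (set (W_basis adj C x))"

definition bm_orbit :: "('v::finite \<Rightarrow> 'v \<Rightarrow> bool) \<Rightarrow> complex^'v \<Rightarrow> (complex^'v) set" where
  "bm_orbit adj u = {M *v u |M. M \<in> bose_mesner adj}"

definition hermitian_inner :: "complex^'v \<Rightarrow> complex^'v \<Rightarrow> complex" where
  "hermitian_inner u v = (\<Sum>z\<in>UNIV. u $ z * cnj (v $ z))"

text \<open>For a subspace \<open>U\<close> the description below has exactly one solution for every \<open>v\<close>.\<close>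

definition orth_proj :: "(complex^'v) set \<Rightarrow> complex^'v \<Rightarrow> complex^'v" where
  "orth_proj U v = (THE u. u \<in> U \<and> (\<forall>u'\<in>U. hermitian_inner (v - u) u' = 0))"

section \<open>Leonard systems\<close>

text \<open>The underlying vector space is a subspace \<open>V\<close> of \<open>complex^'v\<close>; maps are only relevant on \<open>V\<close>.\<close>

definition endo_on :: "(complex^'v) set \<Rightarrow> (complex^'v \<Rightarrow> complex^'v) \<Rightarrow> bool" where
  "endo_on V f \<longleftrightarrow> (\<forall>v\<in>V. f v \<in> V) \<and> (\<forall>u\<in>V. \<forall>v\<in>V. f (u + v) = f u + f v) \<and>
     (\<forall>c. \<forall>v\<in>V. f (c *s v) = c *s f v)"

definition represents :: "complex mat \<Rightarrow> (complex^'v \<Rightarrow> complex^'v) \<Rightarrow> (complex^'v) list \<Rightarrow> bool" where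
  "represents N f ws \<longleftrightarrow> N \<in> carrier_mat (length ws) (length ws) \<and>
     (\<forall>j<length ws. f (ws ! j) = (\<Sum>i<length ws. (N $$ (i, j)) *s (ws ! i)))"

definition ordered_basis :: "(complex^'v) set \<Rightarrow> (complex^'v) list \<Rightarrow> bool" where
  "ordered_basis V ws \<longleftrightarrow> distinct ws \<and> vec.independent (set ws) \<and> vec.span (set ws) = V"

text \<open>\<open>B\<close> has the $n+1$ distinct eigenvalues \<open>th 0, \<dots>, th n\<close> on \<open>V\<close>, and \<open>F i\<close> is the projection onto
  the eigenspace of \<open>th i\<close> along the sum of the other eigenspaces.\<close>

definition spectral_ordering ::
    "(complex^'v) set \<Rightarrow> nat \<Rightarrow> (complex^'v \<Rightarrow> complex^'v) \<Rightarrow>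
     (nat \<Rightarrow> complex^'v \<Rightarrow> complex^'v) \<Rightarrow> (nat \<Rightarrow> complex) \<Rightarrow> bool" where
  "spectral_ordering V n B F th \<longleftrightarrow> endo_on V B \<and> inj_on th {..n} \<and>
     (\<forall>i\<le>n. endo_on V (F i) \<and> (\<exists>v\<in>V. F i v \<noteq> 0) \<and> (\<forall>v\<in>V. B (F i v) = th i *s F i v)) \<and>
     (\<forall>i\<le>n. \<forall>j\<le>n. i \<noteq> j \<longrightarrow> (\<forall>v\<in>V. F i (F j v) = 0)) \<and>
     (\<forall>v\<in>V. (\<Sum>i\<le>n. F i v) = v)"

definition tridiagonal_on ::
    "(complex^'v) set \<Rightarrow> nat \<Rightarrow> (complex^'v \<Rightarrow> complex^'v) \<Rightarrow>
     (nat \<Rightarrow> complex^'v \<Rightarrow> complex^'v) \<Rightarrow> bool" where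
  "tridiagonal_on V n B F \<longleftrightarrow> (\<forall>i\<le>n. \<forall>j\<le>n.
     (\<bar>int i - int j\<bar> > 1 \<longrightarrow> (\<forall>v\<in>V. F i (B (F j v)) = 0)) \<and>
     (\<bar>int i - int j\<bar> = 1 \<longrightarrow> (\<exists>v\<in>V. F i (B (F j v)) \<noteq> 0)))"

text \<open>The Leonard system $(B;B^*;\{F_i\};\{F^*_i\})$ of diameter \<open>n\<close>, together with its eigenvalue
  sequence \<open>th\<close> and its dual eigenvalue sequence \<open>ths\<close>, which it determines.\<close>

definition leonard_system ::
    "(complex^'v) set \<Rightarrow> nat \<Rightarrow> (complex^'v \<Rightarrow> complex^'v) \<Rightarrow> (complex^'v \<Rightarrow> complex^'v) \<Rightarrow>
     (nat \<Rightarrow> complex^'v \<Rightarrow> complex^'v) \<Rightarrow> (nat \<Rightarrow> complex^'v \<Rightarrow> complex^'v) \<Rightarrow>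
     (nat \<Rightarrow> complex) \<Rightarrow> (nat \<Rightarrow> complex) \<Rightarrow> bool" where
  "leonard_system V n B Bs F Fs th ths \<longleftrightarrow>
     vec.subspace V \<and> vec.dim V = n + 1 \<and>
     spectral_ordering V n B F th \<and> spectral_ordering V n Bs Fs ths \<and>
     tridiagonal_on V n Bs F \<and> tridiagonal_on V n B Fs"

definition first_split_sequence ::
    "(complex^'v) set \<Rightarrow> nat \<Rightarrow> (complex^'v \<Rightarrow> complex^'v) \<Rightarrow> (complex^'v \<Rightarrow> complex^'v) \<Rightarrow>
     (nat \<Rightarrow> complex) \<Rightarrow> (nat \<Rightarrow> complex) \<Rightarrow> (nat \<Rightarrow> complex) \<Rightarrow> bool" where
  "first_split_sequence V n B Bs th ths vphi \<longleftrightarrow> (\<forall>i\<in>{1..n}. vphi i \<noteq> 0) \<and>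
     (\<exists>ws. length ws = n + 1 \<and> ordered_basis V ws \<and>
        represents (Matrix.mat (n + 1) (n + 1)
          (\<lambda>(i, j). if i = j then th i else if i = j + 1 then 1 else 0)) B ws \<and>
        represents (Matrix.mat (n + 1) (n + 1)
          (\<lambda>(i, j). if i = j then ths i else if j = i + 1 then vphi j else 0)) Bs ws)"

text \<open>Reversing $\{F_i\}$ reverses the eigenvalue sequence, hence the second split sequence is
  the first split sequence for the eigenvalues \<open>th n, \<dots>, th 0\<close>.\<close>

definition parameter_array ::
    "(complex^'v) set \<Rightarrow> nat \<Rightarrow> (complex^'v \<Rightarrow> complex^'v) \<Rightarrow> (complex^'v \<Rightarrow> complex^'v) \<Rightarrow>
     (nat \<Rightarrow> complex^'v \<Rightarrow> complex^'v) \<Rightarrow> (nat \<Rightarrow> complex^'v \<Rightarrow> complex^'v) \<Rightarrow>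
     (nat \<Rightarrow> complex) \<Rightarrow> (nat \<Rightarrow> complex) \<Rightarrow> (nat \<Rightarrow> complex) \<Rightarrow> (nat \<Rightarrow> complex) \<Rightarrow> bool" where
  "parameter_array V n B Bs F Fs th ths vphi phi \<longleftrightarrow>
     leonard_system V n B Bs F Fs th ths \<and>
     first_split_sequence V n B Bs th ths vphi \<and>
     first_split_sequence V n B Bs (\<lambda>i. th (n - i)) ths phi"

text \<open>The $q$-Racah conditions on the parameters and on a parameter array of diameter \<open>d\<close>; the names
  \<open>hs\<close> and \<open>ss\<close> stand for $h^*$ and $s^*$.\<close>

definition q_racah_type ::
    "nat \<Rightarrow> complex \<Rightarrow> complex \<Rightarrow> complex \<Rightarrow> complex \<Rightarrow> complex \<Rightarrow> complex \<Rightarrow> complex \<Rightarrow>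
     (nat \<Rightarrow> complex) \<Rightarrow> (nat \<Rightarrow> complex) \<Rightarrow> (nat \<Rightarrow> complex) \<Rightarrow> (nat \<Rightarrow> complex) \<Rightarrow> bool" where
  "q_racah_type d q h hs s ss r1 r2 th ths vphi phi \<longleftrightarrow>
     q \<noteq> 0 \<and> q\<^sup>2 \<noteq> 1 \<and>
     h \<noteq> 0 \<and> hs \<noteq> 0 \<and> s \<noteq> 0 \<and> ss \<noteq> 0 \<and> r1 \<noteq> 0 \<and> r2 \<noteq> 0 \<and>
     r1 * r2 = s * ss * q ^ (d + 1) \<and>
     (\<forall>i\<in>{1..d}. q ^ i \<noteq> 1 \<and> r1 * q ^ i \<noteq> 1 \<and> r2 * q ^ i \<noteq> 1 \<and>
        ss * q ^ i / r1 \<noteq> 1 \<and> ss * q ^ i / r2 \<noteq> 1) \<and>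
     (\<forall>i\<in>{2..2 * d}. s * q ^ i \<noteq> 1 \<and> ss * q ^ i \<noteq> 1) \<and>
     (\<forall>i\<le>d. th i = th 0 + h * (1 - q ^ i) * (1 - s * q ^ (i + 1)) * q powi (- int i)) \<and>
     (\<forall>i\<le>d. ths i = ths 0 + hs * (1 - q ^ i) * (1 - ss * q ^ (i + 1)) * q powi (- int i)) \<and>
     (\<forall>i\<in>{1..d}. vphi i = h * hs * q powi (1 - 2 * int i) * (1 - q ^ i) *
        (1 - q powi (int i - int d - 1)) * (1 - r1 * q ^ i) * (1 - r2 * q ^ i)) \<and>
     (\<forall>i\<in>{1..d}. phi i = h * hs * q powi (1 - 2 * int i) * (1 - q ^ i) *
        (1 - q powi (int i - int d - 1)) * (r1 - ss * q ^ i) * (r2 - ss * q ^ i) / ss)"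

section \<open>The universal double affine Hecke algebra\<close>

text \<open>The free algebra on the eight letters $t_n$, $t_n^{-1}$ is the monoid algebra of the free monoid:
  finitely supported functions with convolution, as provided by Poly_Mapping.\<close>

datatype 'a free_monoid = FM "'a list"

instantiation free_monoid :: (type) monoid_add
begin

definition "0 = FM []"

fun plus_free_monoid where
  "FM xs + FM ys = FM (xs @ ys)"

instance
proof
  fix a b c :: "'a free_monoid"
  show "a + b + c = a + (b + c)"
    by (cases a; cases b; cases c) simp
  show "0 + a = a" "a + 0 = a"
    by (cases a; simp add: zero_free_monoid_def)+
qed

end

datatype daha_gen = T0 | T1 | T2 | T3

datatype daha_letter = Pos daha_gen | Neg daha_gen

type_synonym daha_free = "daha_letter free_monoid \<Rightarrow>\<^sub>0 complex"

definition daha_free_ring :: "daha_free ring" where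
  "daha_free_ring = \<lparr>carrier = UNIV, monoid.mult = (*), one = 1, ring.zero = 0, add = (+)\<rparr>"

definition letter :: "daha_letter \<Rightarrow> daha_free" where
  "letter l = Poly_Mapping.single (FM [l]) 1"

definition free_const :: "complex \<Rightarrow> daha_free" where
  "free_const c = Poly_Mapping.single 0 c"

text \<open>The parameter \<open>qh\<close> is the chosen square root $q^{1/2}$.\<close>

definition daha_relators :: "complex \<Rightarrow> daha_free set" where
  "daha_relators qh =
     (\<Union>n. {letter (Pos n) * letter (Neg n) - 1, letter (Neg n) * letter (Pos n) - 1}) \<union>
     (\<Union>n. \<Union>f. {(letter (Pos n) + letter (Neg n)) * f - f * (letter (Pos n) + letter (Neg n))}) \<union>
     {letter (Pos T0) * letter (Pos T1) * letter (Pos T2) * letter (Pos T3) - free_const (1 / qh)}"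

definition daha_ideal :: "complex \<Rightarrow> daha_free set" where
  "daha_ideal qh = genideal daha_free_ring (daha_relators qh)"

definition daha :: "complex \<Rightarrow> daha_free set ring" where
  "daha qh = daha_free_ring Quot daha_ideal qh"

definition daha_class :: "complex \<Rightarrow> daha_free \<Rightarrow> daha_free set" where
  "daha_class qh f = daha_ideal qh +>\<^bsub>daha_free_ring\<^esub> f"

definition daha_t :: "complex \<Rightarrow> daha_gen \<Rightarrow> daha_free set" where
  "daha_t qh n = daha_class qh (letter (Pos n))"

definition daha_module ::
    "complex \<Rightarrow> (complex^'v) set \<Rightarrow> (daha_free set \<Rightarrow> complex^'v \<Rightarrow> complex^'v) \<Rightarrow> bool" where
  "daha_module qh W act \<longleftrightarrow>
     vec.subspace W \<and>
     (\<forall>a\<in>carrier (daha qh). endo_on W (act a)) \<and>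
     (\<forall>a\<in>carrier (daha qh). \<forall>b\<in>carrier (daha qh). \<forall>w\<in>W.
        act (a \<oplus>\<^bsub>daha qh\<^esub> b) w = act a w + act b w \<and>
        act (a \<otimes>\<^bsub>daha qh\<^esub> b) w = act a (act b w)) \<and>
     (\<forall>c. \<forall>w\<in>W. act (daha_class qh (free_const c)) w = c *s w)"

definition plus_inverse :: "complex \<Rightarrow> daha_free set \<Rightarrow> daha_free set" where
  "plus_inverse qh a = a \<oplus>\<^bsub>daha qh\<^esub> inv\<^bsub>daha qh\<^esub> a"

definition daha_A :: "complex \<Rightarrow> daha_free set" where
  "daha_A qh = plus_inverse qh (daha_t qh T0 \<otimes>\<^bsub>daha qh\<^esub> daha_t qh T1)"

definition daha_B :: "complex \<Rightarrow> daha_free set" where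
  "daha_B qh = plus_inverse qh (daha_t qh T3 \<otimes>\<^bsub>daha qh\<^esub> daha_t qh T0)"

definition daha_B_dagger :: "complex \<Rightarrow> daha_free set" where
  "daha_B_dagger qh = plus_inverse qh (daha_t qh T1 \<otimes>\<^bsub>daha qh\<^esub> daha_t qh T2)"

section \<open>The representing matrices\<close>

text \<open>Arguments: \<open>qh\<close> is $q^{1/2}$, \<open>q\<close> its square, \<open>sig\<close> is $\sigma = s^{*1/2}$ (so $s^*$ is \<open>sig\<^sup>2\<close>),
  \<open>rho\<close> is $\rho = r_1^{1/2} r_2^{1/2}$, and \<open>ss\<close> is $s^*$.\<close>

definition P_coeff :: "complex \<Rightarrow> complex \<Rightarrow> complex \<Rightarrow> complex \<Rightarrow> nat \<Rightarrow> complex" where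
  "P_coeff q ss r1 r2 i =
     (r1 - ss * q ^ (i + 1)) * (r2 - ss * q ^ (i + 1)) / (1 - ss * q ^ (2 * i + 2))"

definition R_coeff :: "complex \<Rightarrow> complex \<Rightarrow> complex \<Rightarrow> complex \<Rightarrow> nat \<Rightarrow> complex" where
  "R_coeff q ss r1 r2 i =
     (1 - r1 * q ^ (i + 1)) * (1 - r2 * q ^ (i + 1)) / (1 - ss * q ^ (2 * i + 2))"

definition U_coeff :: "nat \<Rightarrow> complex \<Rightarrow> complex \<Rightarrow> nat \<Rightarrow> complex" where
  "U_coeff d q ss i =
     (1 - q powi (int i - int d)) * (1 - ss * q ^ (i + 1)) / (1 - ss * q ^ (2 * i + 1))"

definition V_coeff :: "nat \<Rightarrow> complex \<Rightarrow> complex \<Rightarrow> nat \<Rightarrow> complex" where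
  "V_coeff d q ss i =
     (1 - q ^ i) * (1 - ss * q ^ (d + i + 1)) / (1 - ss * q ^ (2 * i + 1))"

definition Z_coeff :: "nat \<Rightarrow> complex \<Rightarrow> complex \<Rightarrow> nat \<Rightarrow> complex" where
  "Z_coeff d q ss i =
     (1 - q ^ i) * (1 - q powi (int i - int d)) / (1 - ss * q ^ (2 * i + 1))"

definition t0_block :: "complex \<Rightarrow> complex \<Rightarrow> complex \<Rightarrow> complex \<Rightarrow> complex \<Rightarrow> nat \<Rightarrow> complex mat" where
  "t0_block q sig rho r1 r2 i =
     (let ss = sig\<^sup>2; P = P_coeff q ss r1 r2 i; R = R_coeff q ss r1 r2 i in
      mat_of_rows_list 2
        [[(P + ss) / (sig * rho), - (sig / rho) * R],
         [P / (sig * rho), (sig / rho) * (1 - R)]])"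

definition t3_block :: "complex \<Rightarrow> complex \<Rightarrow> complex \<Rightarrow> complex \<Rightarrow> complex \<Rightarrow> nat \<Rightarrow> complex mat" where
  "t3_block q sig rho r1 r2 i =
     (let ss = sig\<^sup>2; P = P_coeff q ss r1 r2 i; R = R_coeff q ss r1 r2 i in
      mat_of_rows_list 2
        [[(1 - R) / (q ^ (i + 1) * rho), R / (q ^ (i + 1) * rho)],
         [- (q ^ (i + 1) / rho) * P, (q ^ (i + 1) / rho) * (P + ss)]])"

definition t1_block :: "nat \<Rightarrow> complex \<Rightarrow> complex \<Rightarrow> nat \<Rightarrow> complex mat" where
  "t1_block d qh sig i =
     (if i = 0 \<or> i = d then mat_of_rows_list 1 [[1 / qh ^ d]]
      else let q = qh\<^sup>2; U = U_coeff d q (sig\<^sup>2) i; V = V_coeff d q (sig\<^sup>2) i in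
        mat_of_rows_list 2
          [[qh ^ d * U + 1 / qh ^ d, - (qh ^ d) * U],
           [1 / qh ^ d * V, 1 / qh ^ d * (1 - V)]])"

definition t2_block :: "nat \<Rightarrow> complex \<Rightarrow> complex \<Rightarrow> nat \<Rightarrow> complex mat" where
  "t2_block d qh sig i =
     (let kap = sig * qh ^ (d + 1) in
      if i = 0 then mat_of_rows_list 1 [[kap]]
      else if i = d then mat_of_rows_list 1 [[1 / kap]]
      else let q = qh\<^sup>2; U = U_coeff d q (sig\<^sup>2) i; V = V_coeff d q (sig\<^sup>2) i;
               Z = Z_coeff d q (sig\<^sup>2) i in
        mat_of_rows_list 2
          [[(kap\<^sup>2 * Z + 1) / kap, q ^ i * kap * U],
           [- (V / (q ^ i * kap)), kap * (1 - Z)]])"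

text \<open>The arguments \<open>r1h\<close>, \<open>r2h\<close> are the square roots $r_1^{1/2}$, $r_2^{1/2}$.\<close>

fun daha_matrix ::
    "nat \<Rightarrow> complex \<Rightarrow> complex \<Rightarrow> complex \<Rightarrow> complex \<Rightarrow> daha_gen \<Rightarrow> complex mat" where
  "daha_matrix d qh sig r1h r2h T0 =
     diag_block_mat (map (t0_block (qh\<^sup>2) sig (r1h * r2h) (r1h\<^sup>2) (r2h\<^sup>2)) [0..<d])"
| "daha_matrix d qh sig r1h r2h T1 = diag_block_mat (map (t1_block d qh sig) [0..<d + 1])"
| "daha_matrix d qh sig r1h r2h T2 = diag_block_mat (map (t2_block d qh sig) [0..<d + 1])"
| "daha_matrix d qh sig r1h r2h T3 =
     diag_block_mat (map (t3_block (qh\<^sup>2) sig (r1h * r2h) (r1h\<^sup>2) (r2h\<^sup>2)) [0..<d])"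

end

theory Submission
  imports Defs
begin

text \<open>
  Let \<open>P\<close> and \<open>Q\<close> be the orthogonal projections onto the primary module \<open>M x\<close> and onto the module \<open>M C\<close> of
  the clique, where \<open>M\<close> is the Bose-Mesner algebra and a vertex or a set of vertices stands for its
  characteristic vector. The argument rests on the identities
    \<open>P Q = (A - \<theta>\<^sub>d) / (\<theta>\<^sub>0 - \<theta>\<^sub>d)\<close> on \<open>M x\<close> and \<open>Q P = (A - \<theta>\<^sub>d) / (\<theta>\<^sub>0 - \<theta>\<^sub>d)\<close> on \<open>M C\<close>.
  Both projections commute with \<open>M\<close>, so each identity need only be checked at
  a generator, where it follows from \<open>Q x = C / |C|\<close>, from \<open>P C = x - A x / \<theta>\<^sub>d\<close> and from the size of a
  Delsarte clique (\<open>PQ_radial\<close>, \<open>QP_clique_radial\<close>).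

  The projections are averages over the two partitions of the vertex set by the distance from \<open>x\<close> and
  by the distance from \<open>C\<close>, so in the basis of the sets \<open>C\<^sub>i\<^sup>-\<close>, \<open>C\<^sub>i\<^sup>+\<close> they are given by two families of
  ratios. First, \<open>|C\<^sub>i\<^sup>-| / |C\<^sub>i| = \<alpha>\<^sub>i\<close> is the proportion of the members of \<open>C\<close> that are nearest to a vertex
  of \<open>C\<^sub>i\<close>. Since \<open>E\<^sub>d\<close> annihilates \<open>C\<close> (\<open>E_d_clique\<close>), it is determined by two consecutive entries of
  \<open>E\<^sub>d\<close>, whose quotient is a quotient of entries of the two split sequences (\<open>\<epsilon>_step\<close>). Second,
  \<open>\<beta>\<^sub>i\<^sub>+\<^sub>1 = |C\<^sub>i\<^sup>+| / k\<^sub>i\<^sub>+\<^sub>1\<close>, with \<open>k\<^sub>i\<^sub>+\<^sub>1\<close> the size of the sphere of radius \<open>i + 1\<close>, equals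
  \<open>c\<^sub>i\<^sub>+\<^sub>1 / ((\<theta>\<^sub>0 - \<theta>\<^sub>d) \<alpha>\<^sub>i)\<close>, as one sees by evaluating the first identity at the sphere of radius \<open>i\<close>
  (\<open>P_Cp\<close>); and the second split sequence determines the intersection numbers \<open>c\<^sub>j\<close>, because the
  eigenvectors for \<open>\<theta>\<^sub>0\<close> in \<open>M x\<close> are constant (\<open>c_num_eq\<close>).

  In the \<open>q\<close>-Racah case these ratios are those that occur in the blocks of \<open>t\<^sub>0\<close> and \<open>t\<^sub>1\<close>, which gives the
  formulas for the two projections in the form \<open>t\<^sub>0 = k\<^sub>0\<^bsup>-1\<^esup> + (k\<^sub>0 - k\<^sub>0\<^bsup>-1\<^esup>) Q\<close> and \<open>t\<^sub>1 = k\<^sub>1\<^bsup>-1\<^esup> + (k\<^sub>1 - k\<^sub>1\<^bsup>-1\<^esup>) P\<close> (\<open>t0_Q\<close>, \<open>t1_P\<close>).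
  Consequently \<open>t\<^sub>0 t\<^sub>1 + (t\<^sub>0 t\<^sub>1)\<^bsup>-1\<^esup>\<close> is \<open>k\<^sub>1 / k\<^sub>0 + k\<^sub>0 / k\<^sub>1 + (k\<^sub>0 - k\<^sub>0\<^bsup>-1\<^esup>) (k\<^sub>1 - k\<^sub>1\<^bsup>-1\<^esup>) P Q\<close> on \<open>M x\<close>, and the
  same with \<open>Q P\<close> on \<open>M C\<close>. Since the space is contained in the sum of the two modules, the formula for \<open>A\<close>
  follows.
  Finally, \<open>t\<^sub>3 t\<^sub>0\<close> and \<open>t\<^sub>1 t\<^sub>2\<close> are block diagonal, and their \<open>2 \<times> 2\<close> blocks have determinant one, so that
  adding the inverse gives the trace on each block; these traces are compared with the dual
  eigenvalues of the clique and of the graph.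
\<close>

section \<open>Vectors that are constant on the fibres of a function\<close>

text \<open>The vectors that depend only on the value of \<open>c\<close>.\<close>

definition fibre_constant :: "('v \<Rightarrow> nat) \<Rightarrow> (complex^'v) set" where
  "fibre_constant c = {v. \<forall>y z. c y = c z \<longrightarrow> v $ y = v $ z}"

text \<open>The average of a vector over the fibres of \<open>c\<close>. No fibre through a point is empty, so there is no
  division by zero. This is the orthogonal projection onto the fibre-constant vectors.\<close>

definition fibre_avg :: "('v::finite \<Rightarrow> nat) \<Rightarrow> complex^'v \<Rightarrow> complex^'v" where
  "fibre_avg c v = (\<chi> z. (\<Sum>y | c y = c z. v $ y) / of_nat (card {y. c y = c z}))"

lemma fibre_constantD: "v \<in> fibre_constant c \<Longrightarrow> c y = c z \<Longrightarrow> v $ y = v $ z"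
  unfolding fibre_constant_def by blast

lemma fibre_constantI: "(\<And>y z. c y = c z \<Longrightarrow> v $ y = v $ z) \<Longrightarrow> v \<in> fibre_constant c"
  unfolding fibre_constant_def by blast

lemma fibre_constant_subspace: "vec.subspace (fibre_constant c)"
  unfolding vec.subspace_def
  by (auto intro!: fibre_constantI) (metis fibre_constantD)+

lemma fibre_constant_representation:
  assumes "v \<in> fibre_constant c"
  obtains f where "\<And>z. v $ z = f (c z)"
proof
  show "v $ z = v $ (SOME y. c y = c z)" for z
    by (rule fibre_constantD[OF assms], rule sym, rule someI[of "\<lambda>y. c y = c z" z], rule refl)
qed

lemma fibre_avg_in: "fibre_avg c v \<in> fibre_constant c"
  by (rule fibre_constantI) (simp add: fibre_avg_def)

lemma fibre_avg_add: "fibre_avg c (u + v) = fibre_avg c u + fibre_avg c v"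
  by (simp add: fibre_avg_def Finite_Cartesian_Product.vec_eq_iff sum.distrib add_divide_distrib)

lemma fibre_avg_scale: "fibre_avg c (a *s v) = a *s fibre_avg c v"
  by (simp add: fibre_avg_def Finite_Cartesian_Product.vec_eq_iff sum_distrib_left)

lemma fibre_avg_diff: "fibre_avg c (u - v) = fibre_avg c u - fibre_avg c v"
  by (simp add: fibre_avg_def Finite_Cartesian_Product.vec_eq_iff sum_subtractf diff_divide_distrib)

lemma fibre_avg_cong:
  "(\<And>y. c y = c z \<Longrightarrow> u $ y = v $ y) \<Longrightarrow> fibre_avg c u $ z = fibre_avg c v $ z"
  unfolding fibre_avg_def by (auto intro!: arg_cong2[where f="(/)"] sum.cong)

lemma card_fibre_neq_0: "card {y::'v::finite. c y = c z} \<noteq> 0"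
  by (auto simp: card_eq_0_iff)

lemma fibre_avg_id:
  assumes "v \<in> fibre_constant c" shows "fibre_avg c v = v"
proof -
  have "(\<Sum>y | c y = c z. v $ y) = (\<Sum>y | c y = c z. v $ z)" for z
    by (intro sum.cong refl) (auto intro: fibre_constantD[OF assms])
  then show ?thesis
    using card_fibre_neq_0[of c] by (simp add: fibre_avg_def Finite_Cartesian_Product.vec_eq_iff)
qed

text \<open>Averaging over the fibres is characterized by a bilinear orthogonality relation.\<close>

lemma fibre_avg_eqI:
  fixes u v :: "complex^'v::finite"
  assumes u: "u \<in> fibre_constant c"
    and orth: "\<And>w. w \<in> fibre_constant c \<Longrightarrow> (\<Sum>z\<in>UNIV. (v $ z - u $ z) * w $ z) = 0"
  shows "u = fibre_avg c v"
proof -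
  have "fibre_avg c v $ z = u $ z" for z
  proof -
    let ?w = "(\<chi> y. if c y = c z then 1 else 0) :: complex^'v"
    have "?w \<in> fibre_constant c" by (rule fibre_constantI) simp
    then have "(\<Sum>y\<in>UNIV. (v $ y - u $ y) * ?w $ y) = 0" by (rule orth)
    moreover have "(\<Sum>y\<in>UNIV. (v $ y - u $ y) * ?w $ y) = (\<Sum>y | c y = c z. v $ y - u $ y)"
      by (simp add: sum.If_cases if_distrib[of "\<lambda>t. _ * t"] cong: if_cong)
    ultimately have "(\<Sum>y | c y = c z. v $ y) = (\<Sum>y | c y = c z. u $ y)"
      by (simp add: sum_subtractf)
    also have "\<dots> = (\<Sum>y | c y = c z. u $ z)"
      by (intro sum.cong refl) (auto intro: fibre_constantD[OF u])
    finally show ?thesis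
      using card_fibre_neq_0[of c z] by (simp add: fibre_avg_def)
  qed
  then show ?thesis by (simp add: Finite_Cartesian_Product.vec_eq_iff)
qed

lemma fibre_avg_orthogonal:
  assumes w: "w \<in> fibre_constant c"
  shows "(\<Sum>z\<in>UNIV. (v $ z - fibre_avg c v $ z) * w $ z) = 0"
proof -
  have fibre: "(\<Sum>z | c z = i. (v $ z - fibre_avg c v $ z) * w $ z) = 0" for i
  proof (cases "\<exists>z. c z = i")
    case True
    then obtain z where z: "c z = i" by blast
    have "(\<Sum>y | c y = i. fibre_avg c v $ y) = (\<Sum>y | c y = i. fibre_avg c v $ z)"
      by (intro sum.cong refl) (auto intro: fibre_constantD[OF fibre_avg_in] simp: z)
    also have "\<dots> = (\<Sum>y | c y = i. v $ y)"
      using card_fibre_neq_0[of c z] by (simp add: fibre_avg_def z)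
    finally have "(\<Sum>y | c y = i. v $ y - fibre_avg c v $ y) = 0"
      by (simp add: sum_subtractf)
    moreover have "(\<Sum>y | c y = i. (v $ y - fibre_avg c v $ y) * w $ y)
        = (\<Sum>y | c y = i. (v $ y - fibre_avg c v $ y) * w $ z)"
      by (intro sum.cong refl) (auto intro: fibre_constantD[OF w] simp: z)
    ultimately show ?thesis by (simp flip: sum_distrib_right)
  qed simp
  have "(\<Sum>z\<in>UNIV. (v $ z - fibre_avg c v $ z) * w $ z)
      = (\<Sum>i\<in>range c. \<Sum>z | c z = i. (v $ z - fibre_avg c v $ z) * w $ z)"
    by (subst sum.group[symmetric, of UNIV "range c" c]) auto
  then show ?thesis by (simp add: fibre)
qed

lemma orth_proj_fibre_constant:
  "orth_proj (fibre_constant c) v = fibre_avg c (v :: complex^'v::finite)"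
  unfolding orth_proj_def
proof (rule the_equality)
  have "hermitian_inner (v - fibre_avg c v) u = 0" if "u \<in> fibre_constant c" for u
  proof -
    have "(\<chi> z. cnj (u $ z)) \<in> fibre_constant c"
      by (rule fibre_constantI, simp) (erule fibre_constantD[OF that])
    from fibre_avg_orthogonal[OF this, of v] show ?thesis
      by (simp add: hermitian_inner_def)
  qed
  then show "fibre_avg c v \<in> fibre_constant c \<and>
      (\<forall>u'\<in>fibre_constant c. hermitian_inner (v - fibre_avg c v) u' = 0)"
    by (simp add: fibre_avg_in)
next
  fix u
  assume u: "u \<in> fibre_constant c \<and> (\<forall>u'\<in>fibre_constant c. hermitian_inner (v - u) u' = 0)"
  show "u = fibre_avg c v"
  proof (rule fibre_avg_eqI)
    fix w :: "complex^'v" assume w: "w \<in> fibre_constant c"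
    have "(\<chi> z. cnj (w $ z)) \<in> fibre_constant c"
      by (rule fibre_constantI, simp) (erule fibre_constantD[OF w])
    with u have "hermitian_inner (v - u) (\<chi> z. cnj (w $ z)) = 0" by blast
    then show "(\<Sum>z\<in>UNIV. (v $ z - u $ z) * w $ z) = 0"
      by (simp add: hermitian_inner_def)
  qed (use u in blast)
qed

text \<open>A symmetric matrix that leaves the space of fibre-constant vectors invariant also leaves its
  orthogonal complement invariant.\<close>

lemma fibre_avg_commute:
  fixes M :: "complex^'v^'v::finite"
  assumes sym: "\<And>y z. M $ y $ z = M $ z $ y"
    and inv: "\<And>u. u \<in> fibre_constant c \<Longrightarrow> M *v u \<in> fibre_constant c"
  shows "fibre_avg c (M *v v) = M *v fibre_avg c v"
proof (rule fibre_avg_eqI[symmetric])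
  show "M *v fibre_avg c v \<in> fibre_constant c" by (intro inv fibre_avg_in)
  fix w :: "complex^'v" assume w: "w \<in> fibre_constant c"
  have "(\<Sum>z\<in>UNIV. ((M *v v) $ z - (M *v fibre_avg c v) $ z) * w $ z)
      = (\<Sum>z\<in>UNIV. \<Sum>y\<in>UNIV. (v $ y - fibre_avg c v $ y) * (M $ z $ y * w $ z))"
    by (simp add: matrix_vector_mult_def sum_subtractf[symmetric] sum_distrib_left sum_distrib_right algebra_simps)
  also have "\<dots> = (\<Sum>y\<in>UNIV. (v $ y - fibre_avg c v $ y) * (M *v w) $ y)"
    by (subst sum.swap) (simp add: matrix_vector_mult_def sum_distrib_left sym)
  also have "\<dots> = 0"
    by (rule fibre_avg_orthogonal[OF inv[OF w]])
  finally show "(\<Sum>z\<in>UNIV. ((M *v v) $ z - (M *v fibre_avg c v) $ z) * w $ z) = 0" .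
qed

section \<open>Distances in a connected graph\<close>

locale connected_graph =
  fixes adj :: "'v::finite \<Rightarrow> 'v \<Rightarrow> bool"
  assumes graph: "simple_connected_graph adj"
begin

abbreviation dist :: "'v \<Rightarrow> 'v \<Rightarrow> nat" (\<open>\<partial>\<close>) where "\<partial> \<equiv> gdist adj"

lemma adj_sym: "adj y z \<longleftrightarrow> adj z y" and adj_irrefl: "\<not> adj y y"
  using graph by (auto simp: simple_connected_graph_def)

lemma walk: "(adj ^^ \<partial> y z) y z"
  using graph unfolding simple_connected_graph_def gdist_def by (metis LeastI)

lemma dist_le: "(adj ^^ n) y z \<Longrightarrow> \<partial> y z \<le> n"
  unfolding gdist_def by (rule Least_le)

lemma walk_sym: "(adj ^^ n) y z \<Longrightarrow> (adj ^^ n) z y"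
proof (induction n arbitrary: z)
  case (Suc n)
  then obtain w where "(adj ^^ n) y w" "adj w z" by auto
  with Suc.IH[of w] adj_sym show ?case by (metis relpowp_Suc_I2)
qed auto

lemma dist_sym: "\<partial> y z = \<partial> z y"
  by (rule antisym; rule dist_le, rule walk_sym, rule walk)

lemma dist_triangle: "\<partial> y z \<le> \<partial> y w + \<partial> w z"
proof (rule dist_le)
  show "(adj ^^ (\<partial> y w + \<partial> w z)) y z"
    unfolding relpowp_add by (rule relcomppI; rule walk)
qed

lemma dist_refl [simp]: "\<partial> y y = 0"
  using dist_le[of 0 y y] by simp

lemma dist_eq_0_iff [simp]: "\<partial> y z = 0 \<longleftrightarrow> y = z"
  using walk[of y z] by auto

lemma dist_eq_1_iff: "\<partial> y z = 1 \<longleftrightarrow> adj y z"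
proof
  assume "\<partial> y z = 1"
  then show "adj y z" using walk[of y z] by auto
next
  assume a: "adj y z"
  then have "\<partial> y z \<le> 1" using dist_le[of 1 y z] by auto
  moreover have "\<partial> y z \<noteq> 0" using a adj_irrefl by auto
  ultimately show "\<partial> y z = 1" by linarith
qed

lemma dist_adj_le: "adj y z \<Longrightarrow> \<partial> w y \<le> Suc (\<partial> w z)"
  using dist_triangle[of w y z] dist_eq_1_iff[of z y] adj_sym by simp

lemma dist_predecessor:
  assumes "\<partial> w z = Suc i"
  obtains y where "adj y z" "\<partial> w y = i"
proof -
  from walk[of w z] obtain y where y: "(adj ^^ i) w y" "adj y z"
    by (auto simp: assms)
  have "\<partial> w y \<le> i" by (rule dist_le) (rule y)
  moreover have "Suc i \<le> Suc (\<partial> w y)"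
    using dist_adj_le[of z y w] y(2) adj_sym assms by simp
  ultimately show ?thesis using that y by force
qed

lemma dist_le_diameter: "\<partial> y z \<le> diameter adj"
  unfolding diameter_def by (rule Max_ge) auto

lemma diameter_attained: obtains y z where "\<partial> y z = diameter adj"
proof -
  have "diameter adj \<in> range (\<lambda>(y, z). \<partial> y z)"
    unfolding diameter_def by (rule Max_in) auto
  then show ?thesis using that by auto
qed

abbreviation A :: "complex^'v^'v" where "A \<equiv> distance_matrix adj 1"

lemma A_mult: "(A *v v) $ z = (\<Sum>y | adj z y. v $ y)"
  by (simp add: matrix_vector_mult_def distance_matrix_def dist_eq_1_iff[unfolded One_nat_def]
      sum.If_cases if_distrib[of "\<lambda>t. t * _"] cong: if_cong)

text \<open>An eigenvector of \<open>A\<close> that is constant on the spheres about \<open>x\<close> is determined by its value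
  at \<open>x\<close>: the eigenvalue equation at distance \<open>i\<close> yields its value at distance \<open>i + 1\<close>.\<close>

lemma radial_eigenvector_eq_0:
  assumes v: "v \<in> fibre_constant (\<partial> x)" and eig: "A *v v = \<theta> *s v" and 0: "v $ x = 0"
  shows "v = 0"
proof -
  have "v $ z = 0" if "\<partial> x z = i" for i z
    using that
  proof (induction i arbitrary: z rule: less_induct)
    case (less i)
    show ?case
    proof (cases i)
      case 0
      with less.prems assms(3) show ?thesis by simp
    next
      case (Suc j)
      then obtain y where y: "adj y z" "\<partial> x y = j"
        using dist_predecessor less.prems by metis
      let ?S = "{w. adj y w \<and> \<partial> x w = i}"
      have "(A *v v) $ y = (\<Sum>w | adj y w. v $ w)" by (rule A_mult)
      also have "\<dots> = (\<Sum>w\<in>?S. v $ w)"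
      proof (rule sum.mono_neutral_right)
        show "\<forall>w\<in>{w. adj y w} - ?S. v $ w = 0"
        proof
          fix w assume w: "w \<in> {w. adj y w} - ?S"
          have "\<partial> x w \<le> Suc j" using w y(2) dist_adj_le[of w y x] adj_sym by simp
          with w Suc have "\<partial> x w < i" by auto
          with less.IH show "v $ w = 0" by blast
        qed
      qed auto
      also have "\<dots> = (\<Sum>w\<in>?S. v $ z)"
        by (intro sum.cong refl fibre_constantD[OF v]) (use less.prems in simp)
      finally have "of_nat (card ?S) * v $ z = \<theta> * v $ y" by (simp add: eig del: One_nat_def)
      also have "v $ y = 0" using less.IH[of j y] y(2) Suc by simp
      finally have "of_nat (card ?S) * v $ z = 0" by simp
      moreover have "z \<in> ?S" using y(1) less.prems by simp
      then have "card ?S \<noteq> 0" by (metis card_eq_0_iff empty_iff finite)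
      ultimately show ?thesis by simp
    qed
  qed
  then show ?thesis by (simp add: Finite_Cartesian_Product.vec_eq_iff)
qed

lemma radial_eigenvector_unique:
  assumes "u \<in> fibre_constant (\<partial> x)" "A *v u = \<theta> *s u"
    and "v \<in> fibre_constant (\<partial> x)" "A *v v = \<theta> *s v"
  shows "u $ x *s v = v $ x *s u"
proof -
  have "u $ x *s v - v $ x *s u = 0"
  proof (rule radial_eigenvector_eq_0)
    show "u $ x *s v - v $ x *s u \<in> fibre_constant (\<partial> x)"
      using assms by (intro vec.subspace_diff vec.subspace_scale fibre_constant_subspace)
    show "A *v (u $ x *s v - v $ x *s u) = \<theta> *s (u $ x *s v - v $ x *s u)"
      by (simp add: vec.diff vec.scale assms vector_ssub_ldistrib vector_smult_assoc mult.commute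
          del: One_nat_def)
  qed simp
  then show ?thesis by simp
qed

end

section \<open>The Bose-Mesner algebra of a distance-regular graph\<close>

locale distance_regular_graph =
  fixes adj :: "'v::finite \<Rightarrow> 'v \<Rightarrow> bool"
  assumes distance_regular: "distance_regular adj"
begin

sublocale connected_graph adj
  using distance_regular by unfold_locales (simp add: distance_regular_def)

lemma card_spheres:
  "\<partial> y z = \<partial> y' z' \<Longrightarrow>
    card (gsphere adj i y \<inter> gsphere adj j z) = card (gsphere adj i y' \<inter> gsphere adj j z')"
  using distance_regular unfolding distance_regular_def by blast

lemma intersection_number_eq:
  "card (gsphere adj i y \<inter> gsphere adj j z) = intersection_number adj (\<partial> y z) i j"
proof -
  have "intersection_number adj (\<partial> y z) i j = card (gsphere adj i y \<inter> gsphere adj j z)"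
    unfolding intersection_number_def by (rule the_equality) (use card_spheres in blast)+
  then show ?thesis by simp
qed

text \<open>By distance-regularity, every vertex has some vertex at distance the diameter, hence vertices at
  all smaller distances.\<close>

lemma sphere_nonempty:
  assumes "i \<le> diameter adj"
  obtains z where "\<partial> x z = i"
proof -
  obtain y w where yw: "\<partial> y w = diameter adj" by (rule diameter_attained)
  have "w \<in> gsphere adj (\<partial> y w) y \<inter> gsphere adj (\<partial> y w) y" by (simp add: gsphere_def)
  then have "card (gsphere adj (\<partial> y w) y \<inter> gsphere adj (\<partial> y w) y) \<noteq> 0"
    by (metis card_eq_0_iff empty_iff finite)
  then have "card (gsphere adj (diameter adj) x \<inter> gsphere adj (diameter adj) x) \<noteq> 0"
    using card_spheres[of y y x x "diameter adj" "diameter adj"] yw by (metis dist_refl)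
  then obtain z where z: "\<partial> x z = diameter adj"
    by (metis (mono_tags) Int_iff card.empty equals0I gsphere_def mem_Collect_eq)
  have "\<exists>z. \<partial> x z = diameter adj - n" for n
  proof (induction n)
    case (Suc n)
    then obtain z where z: "\<partial> x z = diameter adj - n" by blast
    show ?case
    proof (cases "diameter adj - n")
      case (Suc m)
      with z dist_predecessor[of x z m] show ?thesis by (metis diff_Suc_1 diff_Suc_eq_diff_pred diff_commute)
    qed (use z in auto)
  qed (use z in auto)
  from this[of "diameter adj - i"] show ?thesis using assms that by auto
qed

text \<open>The matrix whose entries are the values of \<open>m\<close> at the distance of the two vertices.\<close>

definition radial_matrix :: "(nat \<Rightarrow> complex) \<Rightarrow> complex^'v^'v" where
  "radial_matrix m = (\<chi> y z. m (\<partial> y z))"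

lemma radial_matrix_nth [simp]: "radial_matrix m $ y $ z = m (\<partial> y z)"
  by (simp add: radial_matrix_def)

text \<open>The sum over the intermediate vertex is sorted by the two distances; the numbers of terms are
  intersection numbers.\<close>

lemma radial_matrix_mult: "\<exists>p. radial_matrix m ** radial_matrix n = radial_matrix p"
proof -
  have *: "(radial_matrix m ** radial_matrix n) $ y $ z =
      (\<Sum>i\<le>diameter adj. \<Sum>j\<le>diameter adj.
        of_nat (card (gsphere adj i y \<inter> gsphere adj j z)) * (m i * n j))" for y z
  proof -
    have "(radial_matrix m ** radial_matrix n) $ y $ z = (\<Sum>w\<in>UNIV. m (\<partial> y w) * n (\<partial> w z))"
      by (simp add: matrix_matrix_mult_def)
    also have "\<dots> = (\<Sum>w\<in>UNIV. \<Sum>i\<le>diameter adj. \<Sum>j\<le>diameter adj.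
        if \<partial> y w = i \<and> \<partial> z w = j then m i * n j else 0)"
    proof (rule sum.cong[OF refl])
      fix w
      have "(\<Sum>i\<le>diameter adj. \<Sum>j\<le>diameter adj. if \<partial> y w = i \<and> \<partial> z w = j then m i * n j else 0)
          = (\<Sum>i\<le>diameter adj. if \<partial> y w = i then m i * n (\<partial> z w) else 0)"
        by (intro sum.cong refl) (simp add: dist_le_diameter)
      then show "m (\<partial> y w) * n (\<partial> w z) = (\<Sum>i\<le>diameter adj. \<Sum>j\<le>diameter adj.
          if \<partial> y w = i \<and> \<partial> z w = j then m i * n j else 0)"
        by (simp add: dist_le_diameter dist_sym[of w z])
    qed
    also have "\<dots> = (\<Sum>i\<le>diameter adj. \<Sum>j\<le>diameter adj. \<Sum>w\<in>UNIV.
        if \<partial> y w = i \<and> \<partial> z w = j then m i * n j else 0)"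
      by (subst sum.swap, rule sum.cong[OF refl], rule sum.swap)
    also have "\<dots> = (\<Sum>i\<le>diameter adj. \<Sum>j\<le>diameter adj.
        of_nat (card (gsphere adj i y \<inter> gsphere adj j z)) * (m i * n j))"
      by (simp add: sum.If_cases gsphere_def Collect_conj_eq)
    finally show ?thesis .
  qed
  define p where "p t = (let (y, z) = (SOME (y, z). \<partial> y z = t) in
      (radial_matrix m ** radial_matrix n) $ y $ z)" for t
  have "(radial_matrix m ** radial_matrix n) $ y $ z = p (\<partial> y z)" for y z
  proof -
    obtain y' z' where yz: "(SOME (y', z'). \<partial> y' z' = \<partial> y z) = (y', z')" by fastforce
    have "case (SOME (y', z'). \<partial> y' z' = \<partial> y z) of (y', z') \<Rightarrow> \<partial> y' z' = \<partial> y z"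
      by (rule someI[of _ "(y, z)"]) simp
    then have "\<partial> y' z' = \<partial> y z" by (simp add: yz)
    note same = card_spheres[OF this]
    have "(radial_matrix m ** radial_matrix n) $ y' $ z' = (radial_matrix m ** radial_matrix n) $ y $ z"
      unfolding * same by (rule refl)
    then show ?thesis by (simp add: p_def yz)
  qed
  then have "radial_matrix m ** radial_matrix n = radial_matrix p"
    by (simp add: Finite_Cartesian_Product.vec_eq_iff)
  then show ?thesis by blast
qed

lemma radial_matrix_commute:
  "radial_matrix m ** radial_matrix n = radial_matrix n ** radial_matrix m"
proof -
  obtain p where p: "radial_matrix m ** radial_matrix n = radial_matrix p"
    using radial_matrix_mult by blast
  have "(radial_matrix n ** radial_matrix m) $ y $ z = (radial_matrix m ** radial_matrix n) $ z $ y" for y z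
    by (simp add: matrix_matrix_mult_def dist_sym mult.commute)
  moreover have "(radial_matrix m ** radial_matrix n) $ z $ y = (radial_matrix m ** radial_matrix n) $ y $ z" for y z
    by (simp only: p radial_matrix_nth dist_sym[of z y])
  ultimately have "(radial_matrix n ** radial_matrix m) $ y $ z = (radial_matrix m ** radial_matrix n) $ y $ z"
    for y z by metis
  then show ?thesis by (simp add: Finite_Cartesian_Product.vec_eq_iff)
qed

lemma distance_matrix_radial: "distance_matrix adj i = radial_matrix (\<lambda>t. if t = i then 1 else 0)"
  by (simp add: radial_matrix_def distance_matrix_def)

lemma bose_mesner_subalgebra: "matrix_subalgebra (bose_mesner adj)"
  unfolding bose_mesner_def by (rule hull_in) (auto simp: matrix_subalgebra_def)

lemma A_in_bose_mesner: "A \<in> bose_mesner adj"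
  unfolding bose_mesner_def by (rule hull_inc) simp

lemma bose_mesner_add: "M \<in> bose_mesner adj \<Longrightarrow> N \<in> bose_mesner adj \<Longrightarrow> M + N \<in> bose_mesner adj"
  and bose_mesner_mult: "M \<in> bose_mesner adj \<Longrightarrow> N \<in> bose_mesner adj \<Longrightarrow> M ** N \<in> bose_mesner adj"
  and bose_mesner_scale: "M \<in> bose_mesner adj \<Longrightarrow> mscale a M \<in> bose_mesner adj"
  and bose_mesner_1: "Finite_Cartesian_Product.mat 1 \<in> bose_mesner adj"
  using bose_mesner_subalgebra unfolding matrix_subalgebra_def by blast+

lemma bose_mesner_0: "0 \<in> bose_mesner adj"
proof -
  have "0 = mscale 0 (Finite_Cartesian_Product.mat 1 :: complex^'v^'v)"
    by (simp add: mscale_def Finite_Cartesian_Product.vec_eq_iff)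
  then show ?thesis using bose_mesner_scale[OF bose_mesner_1] by metis
qed

text \<open>The product \<open>A A\<^sub>i\<close> is a combination of \<open>A\<^sub>i\<^sub>-\<^sub>1\<close>, \<open>A\<^sub>i\<close> and \<open>A\<^sub>i\<^sub>+\<^sub>1\<close>, and the last coefficient
  does not vanish unless \<open>A\<^sub>i\<^sub>+\<^sub>1\<close> does.\<close>

lemma distance_matrix_in_bose_mesner: "distance_matrix adj i \<in> bose_mesner adj"
proof (induction i rule: less_induct)
  case (less i)
  consider "i = 0" | "i = 1" | "i > diameter adj" | j where "i = Suc (Suc j)" "i \<le> diameter adj"
    by (metis One_nat_def leI not0_implies_Suc)
  then show ?case
  proof cases
    case 1
    then have "distance_matrix adj i = Finite_Cartesian_Product.mat 1"
      by (simp add: Finite_Cartesian_Product.vec_eq_iff distance_matrix_def Finite_Cartesian_Product.mat_def)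
    then show ?thesis using bose_mesner_1 by metis
  next
    case 2
    then show ?thesis using A_in_bose_mesner by metis
  next
    case 3
    then have "distance_matrix adj i = 0"
      using dist_le_diameter
      by (auto simp: Finite_Cartesian_Product.vec_eq_iff distance_matrix_def) (metis leD)
    then show ?thesis using bose_mesner_0 by metis
  next
    case (4 j)
    obtain p where p: "A ** distance_matrix adj (Suc j) = radial_matrix p"
      unfolding distance_matrix_radial using radial_matrix_mult by blast
    have p_count: "p (\<partial> y z) = of_nat (card {w. adj y w \<and> \<partial> w z = Suc j})" for y z
    proof -
      have "p (\<partial> y z) = (A ** distance_matrix adj (Suc j)) $ y $ z"
        by (simp only: p radial_matrix_nth)
      also have "\<dots> = (\<Sum>w\<in>UNIV. if adj y w \<and> \<partial> w z = Suc j then 1 else 0)"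
        unfolding matrix_matrix_mult_def
        by (auto simp: distance_matrix_def dist_eq_1_iff[unfolded One_nat_def] intro!: sum.cong)
      also have "\<dots> = of_nat (card {w. adj y w \<and> \<partial> w z = Suc j})"
        by (simp add: sum.If_cases)
      finally show ?thesis .
    qed
    obtain z y where zy: "\<partial> z y = i" using sphere_nonempty 4 by metis
    obtain w where w: "adj w y" "\<partial> z w = Suc j"
      using dist_predecessor zy 4 by metis
    then have "w \<in> {w. adj y w \<and> \<partial> w z = Suc j}" using adj_sym dist_sym by auto
    then have "p i \<noteq> 0" using p_count[of y z] zy dist_sym
      by (metis card_eq_0_iff empty_iff finite of_nat_eq_0_iff)
    have p_support: "p (\<partial> y z) = 0" if "\<partial> y z \<noteq> j" "\<partial> y z \<noteq> Suc j" "\<partial> y z \<noteq> i" for y z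
    proof -
      have "{w. adj y w \<and> \<partial> w z = Suc j} = {}"
      proof (rule equals0I)
        fix w assume "w \<in> {w. adj y w \<and> \<partial> w z = Suc j}"
        then have "\<partial> z y \<le> Suc (Suc j)" "Suc j \<le> Suc (\<partial> z y)"
          using dist_adj_le[of y w z] dist_adj_le[of w y z] adj_sym dist_sym[of w z] by auto
        then show False using that 4 dist_sym[of y z] by linarith
      qed
      then show ?thesis using p_count[of y z] by simp
    qed
    have "distance_matrix adj i = mscale (1 / p i) (A ** distance_matrix adj (Suc j) +
        (mscale (- p (Suc j)) (distance_matrix adj (Suc j)) + mscale (- p j) (distance_matrix adj j)))"
    proof -
      have "distance_matrix adj i $ y $ z = (mscale (1 / p i) (A ** distance_matrix adj (Suc j) +
        (mscale (- p (Suc j)) (distance_matrix adj (Suc j)) + mscale (- p j) (distance_matrix adj j)))) $ y $ z" for y z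
        unfolding p using p_support[of y z] \<open>p i \<noteq> 0\<close> 4(1)
        by (auto simp: mscale_def distance_matrix_def)
      then show ?thesis by (simp add: Finite_Cartesian_Product.vec_eq_iff)
    qed
    moreover have "distance_matrix adj (Suc j) \<in> bose_mesner adj" "distance_matrix adj j \<in> bose_mesner adj"
      using less 4 by auto
    ultimately show ?thesis
      using A_in_bose_mesner by (metis bose_mesner_add bose_mesner_mult bose_mesner_scale)
  qed
qed

lemma radial_matrix_in_bose_mesner: "radial_matrix m \<in> bose_mesner adj"
proof -
  have "(\<Sum>i\<in>I. mscale (m i) (distance_matrix adj i)) \<in> bose_mesner adj" if "finite I" for I
    using that
    by induction (simp_all add: bose_mesner_0 bose_mesner_add bose_mesner_scale distance_matrix_in_bose_mesner)
  moreover have "radial_matrix m = (\<Sum>i\<le>diameter adj. mscale (m i) (distance_matrix adj i))"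
    by (simp add: Finite_Cartesian_Product.vec_eq_iff mscale_def distance_matrix_def
        dist_le_diameter if_distrib[of "\<lambda>t. _ * t"] cong: if_cong)
  ultimately show ?thesis by simp
qed

text \<open>The Bose-Mesner algebra is the span of the distance matrices.\<close>

lemma bose_mesner_eq_radial: "bose_mesner adj = range radial_matrix"
proof
  have "matrix_subalgebra (range radial_matrix)"
    unfolding matrix_subalgebra_def
  proof (intro conjI ballI allI)
    show "Finite_Cartesian_Product.mat 1 \<in> range radial_matrix"
      by (rule range_eqI[of _ _ "\<lambda>t. if t = 0 then 1 else 0"])
        (simp add: Finite_Cartesian_Product.vec_eq_iff Finite_Cartesian_Product.mat_def)
  next
    fix M N assume "M \<in> range radial_matrix" "N \<in> range radial_matrix"
    then obtain m n where mn: "M = radial_matrix m" "N = radial_matrix n" by blast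
    show "M + N \<in> range radial_matrix"
      by (rule range_eqI[of _ _ "\<lambda>t. m t + n t"]) (simp add: Finite_Cartesian_Product.vec_eq_iff mn)
    show "M ** N \<in> range radial_matrix"
      using radial_matrix_mult[of m n] mn by auto
  next
    fix a M assume "M \<in> range radial_matrix"
    then obtain m where m: "M = radial_matrix m" by blast
    show "mscale a M \<in> range radial_matrix"
      by (rule range_eqI[of _ _ "\<lambda>t. a * m t"]) (simp add: Finite_Cartesian_Product.vec_eq_iff m mscale_def)
  qed
  then show "bose_mesner adj \<subseteq> range radial_matrix"
    unfolding bose_mesner_def by (rule hull_minimal[rotated]) (auto simp: distance_matrix_radial)
  show "range radial_matrix \<subseteq> bose_mesner adj"
    using radial_matrix_in_bose_mesner by blast
qed

lemma radial_matrix_vertex: "(radial_matrix m *v char_vec {x}) $ z = m (\<partial> x z)"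
  by (simp add: matrix_vector_mult_def char_vec_def dist_sym if_distrib[of "\<lambda>t. _ * t"] cong: if_cong)

text \<open>The primary module \<open>M x\<close> consists of the vectors that are constant on the spheres about \<open>x\<close>.\<close>

lemma bm_orbit_vertex: "bm_orbit adj (char_vec {x}) = fibre_constant (\<partial> x)"
proof
  show "bm_orbit adj (char_vec {x}) \<subseteq> fibre_constant (\<partial> x)"
    by (auto simp: bm_orbit_def bose_mesner_eq_radial intro!: fibre_constantI simp: radial_matrix_vertex)
  show "fibre_constant (\<partial> x) \<subseteq> bm_orbit adj (char_vec {x})"
  proof
    fix v assume "v \<in> fibre_constant (\<partial> x)"
    then obtain f where "\<And>z. v $ z = f (\<partial> x z)" by (rule fibre_constant_representation) blast
    then have "v = radial_matrix f *v char_vec {x}"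
      by (simp add: Finite_Cartesian_Product.vec_eq_iff radial_matrix_vertex)
    then show "v \<in> bm_orbit adj (char_vec {x})"
      by (auto simp: bm_orbit_def bose_mesner_eq_radial)
  qed
qed

lemma bm_orbit_invariant:
  "v \<in> bm_orbit adj u \<Longrightarrow> radial_matrix m *v v \<in> bm_orbit adj u"
  unfolding bm_orbit_def
  by (auto simp: matrix_vector_mul_assoc) (metis bose_mesner_mult radial_matrix_in_bose_mesner)

lemma fibre_avg_radial_commute:
  assumes "bm_orbit adj u = fibre_constant c"
  shows "fibre_avg c (radial_matrix m *v v) = radial_matrix m *v fibre_avg c v"
proof (rule fibre_avg_commute)
  show "radial_matrix m $ y $ z = radial_matrix m $ z $ y" for y z by (simp add: dist_sym)
  show "radial_matrix m *v w \<in> fibre_constant c" if "w \<in> fibre_constant c" for w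
    using bm_orbit_invariant[of w u m] that by (simp add: assms)
qed

end

section \<open>Split sequences and radial eigenvectors\<close>

lemma represents_lower_bidiagonal:
  assumes rep: "represents (Matrix.mat (n + 1) (n + 1)
      (\<lambda>(i, j). if i = j then th i else if i = j + 1 then 1 else 0)) B ws"
    and len: "length ws = n + 1" and j: "j \<le> n"
  shows "B (ws ! j) = th j *s (ws ! j) + (if j < n then ws ! Suc j else 0)"
proof -
  have "B (ws ! j) = (\<Sum>i<n + 1. (if i = j then th i else if i = j + 1 then 1 else 0) *s (ws ! i))"
    using rep j len by (simp add: represents_def)
  also have "\<dots> = (\<Sum>i<n + 1. (if i = j then th j *s (ws ! j) else 0)
      + (if i = Suc j then ws ! Suc j else 0))"
    by (intro sum.cong) auto
  also have "\<dots> = th j *s (ws ! j) + (if j < n then ws ! Suc j else 0)"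
    using j by (simp add: sum.distrib)
  finally show ?thesis .
qed

lemma represents_upper_bidiagonal:
  assumes rep: "represents (Matrix.mat (n + 1) (n + 1)
      (\<lambda>(i, j). if i = j then th i else if j = i + 1 then vphi j else 0)) B ws"
    and len: "length ws = n + 1" and j: "j \<le> n"
  shows "B (ws ! j) = th j *s (ws ! j) + (if j = 0 then 0 else vphi j *s (ws ! (j - 1)))"
proof -
  have "B (ws ! j) = (\<Sum>i<n + 1. (if i = j then th i else if j = i + 1 then vphi j else 0) *s (ws ! i))"
    using rep j len by (simp add: represents_def)
  also have "\<dots> = (\<Sum>i<n + 1. (if i = j then th j *s (ws ! j) else 0)
      + (if i = j - 1 then (if j = 0 then 0 else vphi j *s (ws ! (j - 1))) else 0))"
    by (intro sum.cong) auto
  also have "\<dots> = th j *s (ws ! j) + (if j = 0 then 0 else vphi j *s (ws ! (j - 1)))"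
    using j by (cases j) (simp_all add: sum.distrib)
  finally show ?thesis .
qed

text \<open>The product \<open>vphi\<^sub>j\<^sub>+\<^sub>1 \<cdots> vphi\<^sub>n / ((ths\<^sub>j - ths\<^sub>j\<^sub>+\<^sub>1) \<cdots> (ths\<^sub>j - ths\<^sub>n))\<close>.\<close>

definition split_product :: "(nat \<Rightarrow> complex) \<Rightarrow> (nat \<Rightarrow> complex) \<Rightarrow> nat \<Rightarrow> nat \<Rightarrow> complex" where
  "split_product vphi ths n j = (\<Prod>l\<in>{j<..n}. vphi l / (ths j - ths l))"

lemma split_product_neq_0:
  assumes "\<forall>i\<in>{1..n}. vphi i \<noteq> 0" "inj_on ths {..n}"
  shows "split_product vphi ths n j \<noteq> 0"
proof -
  have "vphi l / (ths j - ths l) \<noteq> 0" if "l \<in> {j<..n}" for l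
  proof -
    have "ths j \<noteq> ths l" using inj_onD[OF assms(2), of j l] that by auto
    then show ?thesis using assms(1) that by auto
  qed
  then show ?thesis unfolding split_product_def by simp
qed

context distance_regular_graph
begin

text \<open>The intersection number \<open>c\<^sub>j\<close>, as a complex number.\<close>

definition c_num :: "nat \<Rightarrow> complex" where
  "c_num j = of_nat (intersection_number adj j (j - 1) 1)"

lemma c_num_count: "\<partial> x z = Suc j \<Longrightarrow> of_nat (card {y. adj z y \<and> \<partial> x y = j}) = c_num (Suc j)"
  using intersection_number_eq[of j x 1 z]
  by (simp add: c_num_def gsphere_def Int_def dist_eq_1_iff[unfolded One_nat_def] conj_commute)

lemma c_num_neq_0:
  assumes "j < diameter adj" shows "c_num (Suc j) \<noteq> 0"
proof -
  obtain z where z: "\<partial> undefined z = Suc j" using sphere_nonempty[of "Suc j"] assms by auto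
  obtain y where "adj y z" "\<partial> undefined y = j" using dist_predecessor[OF z] by blast
  then have "y \<in> {y. adj z y \<and> \<partial> undefined y = j}" using adj_sym by simp
  then have "card {y. adj z y \<and> \<partial> undefined y = j} \<noteq> 0" by (metis card_eq_0_iff empty_iff finite)
  then show ?thesis using c_num_count[OF z] by (metis of_nat_eq_0_iff)
qed

text \<open>If \<open>w\<^sub>0, \<dots>, w\<^sub>n\<close> is a split basis, then \<open>w\<^sub>n\<close> is an eigenvector of \<open>A\<close>. Since the dual operator is
  diagonal in the basis of spheres, its upper bidiagonal form gives the ratio of the coordinates of
  \<open>w\<^sub>i\<close> and \<open>w\<^sub>i\<^sub>-\<^sub>1\<close> on each sphere; since \<open>w\<^sub>i\<close> lives on the ball of radius \<open>i\<close>, the lower bidiagonal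
  form of \<open>A\<close> gives the ratio \<open>c\<^sub>i\<^sub>+\<^sub>1\<close> of the last coordinates of \<open>w\<^sub>i\<^sub>+\<^sub>1\<close> and \<open>w\<^sub>i\<close>.\<close>

lemma split_eigenvector:
  assumes n: "n = diameter adj"
    and Bs: "\<And>u z. (Bs *v u) $ z = ths (\<partial> x z) * u $ z"
    and inj: "inj_on ths {..n}"
    and split: "first_split_sequence (fibre_constant (\<partial> x)) n ((*v) A) ((*v) Bs) th ths vphi"
  obtains v f where "v \<in> fibre_constant (\<partial> x)" "A *v v = th n *s v" "\<And>z. v $ z = f (\<partial> x z)"
    "\<And>j. j \<le> n \<Longrightarrow> f j \<noteq> 0"
    "\<And>j. j < n \<Longrightarrow> f (Suc j) * split_product vphi ths n j =
       c_num (Suc j) * split_product vphi ths n (Suc j) * f j"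
proof -
  obtain ws where len: "length ws = n + 1"
    and basis: "ordered_basis (fibre_constant (\<partial> x)) ws"
    and rep: "represents (Matrix.mat (n + 1) (n + 1)
          (\<lambda>(i, j). if i = j then th i else if i = j + 1 then 1 else 0)) ((*v) A) ws"
    and reps: "represents (Matrix.mat (n + 1) (n + 1)
          (\<lambda>(i, j). if i = j then ths i else if j = i + 1 then vphi j else 0)) ((*v) Bs) ws"
    and vphi: "\<forall>i\<in>{1..n}. vphi i \<noteq> 0"
    using split unfolding first_split_sequence_def by blast
  have ws_set: "ws ! i \<in> set ws" if "i \<le> n" for i
    using len that by simp
  have ws_in: "ws ! i \<in> fibre_constant (\<partial> x)" if "i \<le> n" for i
    using vec.span_base[OF ws_set[OF that]] basis unfolding ordered_basis_def by simp
  have ws_neq_0: "ws ! i \<noteq> 0" if "i \<le> n" for i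
    using vec.dependent_zero[of "set ws"] ws_set[OF that] basis unfolding ordered_basis_def by auto
  have "\<exists>f. \<forall>z. ws ! i $ z = f (\<partial> x z)" if "i \<le> n" for i
    using fibre_constant_representation[OF ws_in[OF that]] by metis
  then obtain f where f: "\<And>i z. i \<le> n \<Longrightarrow> ws ! i $ z = f i (\<partial> x z)" by metis
  note A_ws = represents_lower_bidiagonal[OF rep len]
  note Bs_ws = represents_upper_bidiagonal[OF reps len]
  have f_step: "(ths j - ths i) * f i j = (if i = 0 then 0 else vphi i * f (i - 1) j)"
    if "i \<le> n" "j \<le> n" for i j
  proof -
    obtain z where z: "\<partial> x z = j" using sphere_nonempty[of j x] \<open>j \<le> n\<close> n by auto
    have "(Bs *v (ws ! i)) $ z = ths i * f i j + (if i = 0 then 0 else vphi i * f (i - 1) j)"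
      using that z by (simp add: Bs_ws f)
    then show ?thesis using that z by (simp add: Bs f algebra_simps)
  qed
  have ths_neq: "ths j \<noteq> ths i" if "i \<le> n" "j \<le> n" "i \<noteq> j" for i j
    using inj_onD[OF inj, of j i] that by auto
  have f_upper: "f i j = 0" if "i < j" "j \<le> n" for i j
    using that
  proof (induction i)
    case 0
    then show ?case using f_step[of 0 j] ths_neq[of 0 j] by simp
  next
    case (Suc i)
    then show ?case using f_step[of "Suc i" j] ths_neq[of "Suc i" j] by simp
  qed
  have f_diag_step: "f (Suc i) (Suc i) = c_num (Suc i) * f i i" if "i < n" for i
  proof -
    obtain z where z: "\<partial> x z = Suc i" using sphere_nonempty[of "Suc i" x] \<open>i < n\<close> n by auto
    have "(A *v (ws ! i)) $ z = (\<Sum>y | adj z y. f i (\<partial> x y))"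
      using that by (simp add: A_mult f del: One_nat_def)
    also have "\<dots> = (\<Sum>y | adj z y \<and> \<partial> x y = i. f i (\<partial> x y))"
    proof (rule sum.mono_neutral_right)
      show "\<forall>y\<in>{y. adj z y} - {y. adj z y \<and> \<partial> x y = i}. f i (\<partial> x y) = 0"
      proof
        fix y assume y: "y \<in> {y. adj z y} - {y. adj z y \<and> \<partial> x y = i}"
        then have "Suc i \<le> Suc (\<partial> x y)" using dist_adj_le[of z y x] z by simp
        with y have "i < \<partial> x y" by auto
        then show "f i (\<partial> x y) = 0" using f_upper dist_le_diameter n by metis
      qed
    qed auto
    also have "\<dots> = c_num (Suc i) * f i i"
      by (simp add: c_num_count[OF z, symmetric])
    finally show ?thesis
      using A_ws[of i] that z f_upper[of i "Suc i"] by (simp add: f del: One_nat_def)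
  qed
  have "f 0 0 \<noteq> 0"
  proof
    assume "f 0 0 = 0"
    have "f 0 (\<partial> x z) = 0" for z
    proof (cases "\<partial> x z = 0")
      case False
      then have "0 < \<partial> x z" by (rule neq0_conv[THEN iffD1])
      then show ?thesis using f_upper dist_le_diameter n by metis
    qed (simp add: \<open>f 0 0 = 0\<close>)
    then have "ws ! 0 = 0" by (simp add: Finite_Cartesian_Product.vec_eq_iff f)
    then show False using ws_neq_0[of 0] by simp
  qed
  have f_diag: "f i i \<noteq> 0" if "i \<le> n" for i
    using that by (induction i) (use \<open>f 0 0 \<noteq> 0\<close> f_diag_step c_num_neq_0 n in auto)
  have f_lower: "f i j = (\<Prod>l\<in>{j<..i}. vphi l / (ths j - ths l)) * f j j" if "j \<le> i" "i \<le> n" for i j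
    using that
  proof (induction i rule: dec_induct)
    case (step i)
    have "f (Suc i) j = vphi (Suc i) / (ths j - ths (Suc i)) * f i j"
      using f_step[of "Suc i" j] ths_neq[of "Suc i" j] step by (simp add: field_simps)
    moreover have "{j<..Suc i} = insert (Suc i) {j<..i}" using step by auto
    ultimately show ?case using step by simp
  qed simp
  show ?thesis
  proof
    show "ws ! n \<in> fibre_constant (\<partial> x)" by (rule ws_in) simp
    show "A *v (ws ! n) = th n *s (ws ! n)" using A_ws[of n] by simp
    show "ws ! n $ z = f n (\<partial> x z)" for z by (simp add: f)
    show "f n j \<noteq> 0" if "j \<le> n" for j
      using f_lower[of j n] that f_diag split_product_neq_0[OF vphi inj, of j]
      by (simp add: split_product_def)
    show "f n (Suc j) * split_product vphi ths n j =
       c_num (Suc j) * split_product vphi ths n (Suc j) * f n j" if "j < n" for j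
      using f_lower[of j n] f_lower[of "Suc j" n] f_diag_step[of j] that
      by (simp add: split_product_def mult_ac)
  qed
qed

end

section \<open>Delsarte cliques\<close>

lemma dual_idempotent_combination_mult:
  fixes f :: "'v::finite \<Rightarrow> nat"
  assumes "\<And>z. f z \<le> n"
  shows "((\<Sum>i\<le>n. mscale (t i) (diag_matrix (\<lambda>z. if f z = i then 1 else 0))) *v u) $ z
    = t (f z) * u $ z"
proof -
  have entry: "(\<Sum>i\<le>n. mscale (t i) (diag_matrix (\<lambda>z. if f z = i then 1 else 0))) $ z $ y
      = (if z = y then t (f y) else 0)" for y
  proof -
    have "(\<Sum>i\<le>n. if f y = i then t i else 0) = t (f y)"
      using assms by (subst sum.delta') auto
    then show ?thesis
      by (simp add: mscale_def diag_matrix_def if_distrib[of "\<lambda>t. _ * t"] cong: if_cong)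
  qed
  have "((\<Sum>i\<le>n. mscale (t i) (diag_matrix (\<lambda>z. if f z = i then 1 else 0))) *v u) $ z
      = (\<Sum>y\<in>UNIV. (if z = y then t (f y) else 0) * u $ y)"
    by (simp only: matrix_vector_mult_def vec_lambda_beta entry)
  also have "\<dots> = t (f z) * u $ z"
    by (simp add: if_distrib[of "\<lambda>t. t * _"] cong: if_cong)
  finally show ?thesis .
qed

text \<open>A system of equations, each of which determines \<open>m i\<close> from \<open>m (i + 1)\<close>, has a solution.\<close>

lemma backward_recursion:
  fixes a b g :: "nat \<Rightarrow> complex"
  assumes "\<And>i. i < n \<Longrightarrow> a i \<noteq> 0"
  shows "\<exists>m. \<forall>i<n. a i * m i + b i * m (Suc i) = g i"
  using assms
proof (induction n arbitrary: a b g)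
  case (Suc n)
  obtain m where m: "\<forall>i<n. a (Suc i) * m i + b (Suc i) * m (Suc i) = g (Suc i)"
    using Suc.IH[of "\<lambda>i. a (Suc i)" "\<lambda>i. b (Suc i)" "\<lambda>i. g (Suc i)"] Suc.prems by auto
  have "a i * case_nat ((g 0 - b 0 * m 0) / a 0) m i + b i * case_nat ((g 0 - b 0 * m 0) / a 0) m (Suc i) = g i"
    if "i < Suc n" for i
    using that m Suc.prems[of 0] by (cases i) auto
  then show ?case by blast
qed simp

text \<open>A distance-regular graph with a Delsarte clique \<open>C\<close>, a base vertex \<open>x\<close> of the clique, and a
  parameter array of the Leonard system on the primary module of \<open>x\<close>. Outside the parameter array,
  only \<open>E\<^sub>0\<close>, \<open>E\<^sub>1\<close> and \<open>E\<^sub>d\<close> are constrained.\<close>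

locale delsarte_clique_graph = distance_regular_graph adj
  for adj :: "'v::finite \<Rightarrow> 'v \<Rightarrow> bool" +
  fixes d :: nat and E :: "nat \<Rightarrow> complex^'v^'v" and \<theta> :: "nat \<Rightarrow> real"
    and C :: "'v set" and x :: 'v and As :: "complex^'v^'v" and \<theta>s \<phi>v \<phi> :: "nat \<Rightarrow> complex"
  assumes d_eq: "d = diameter adj" and d_pos: "d \<ge> 1"
    and E_0: "E 0 = mscale (1 / of_nat CARD('v)) all_ones"
    and E_1_in: "E 1 \<in> bose_mesner adj"
    and E_d_in: "E d \<in> bose_mesner adj" and E_d_idem: "E d ** E d = E d"
    and delsarte: "delsarte_clique adj (\<theta> d) C" and x_in_C: "x \<in> C"
    and As_dual: "As = dual_adjacency (E 1) x"
    and As_eq: "As = (\<Sum>i\<le>d. mscale (\<theta>s i) (dual_idempotent adj x i))"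
    and parameter_array: "parameter_array (bm_orbit adj (char_vec {x})) d ((*v) A) ((*v) As)
           (\<lambda>i. (*v) (E i)) (\<lambda>i. (*v) (dual_idempotent adj x i))
           (\<lambda>i. complex_of_real (\<theta> i)) \<theta>s \<phi>v \<phi>"
begin

abbreviation radial where "radial \<equiv> fibre_constant (\<partial> x)"

lemma As_mult: "(As *v u) $ z = \<theta>s (\<partial> x z) * u $ z"
  unfolding As_eq dual_idempotent_def
  by (rule dual_idempotent_combination_mult) (simp add: d_eq dist_le_diameter)

lemma \<theta>s_inj: "inj_on \<theta>s {..d}"
  and \<phi>v_neq_0: "\<forall>i\<in>{1..d}. \<phi>v i \<noteq> 0" and \<phi>_neq_0: "\<forall>i\<in>{1..d}. \<phi> i \<noteq> 0"
  and E_d_neq_0: "E d \<noteq> 0"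
  and A_E: "i \<le> d \<Longrightarrow> v \<in> radial \<Longrightarrow> A *v (E i *v v) = complex_of_real (\<theta> i) *s (E i *v v)"
  using parameter_array
  unfolding parameter_array_def leonard_system_def spectral_ordering_def first_split_sequence_def
    bm_orbit_vertex by (auto simp del: One_nat_def)

lemma char_vec_x_radial: "char_vec {x} \<in> radial"
  by (rule fibre_constantI) (auto simp: char_vec_def dest: dist_eq_0_iff[THEN iffD1])

text \<open>The all-ones vector.\<close>

definition ones :: "complex^'v" where "ones = (\<chi> z. 1)"

lemma ones_radial: "ones \<in> radial"
  by (rule fibre_constantI) (simp add: ones_def)

lemma A_ones: "A *v ones = complex_of_real (\<theta> 0) *s ones"
proof -
  have "(1 / of_nat CARD('v)) *s ones = E 0 *v char_vec {x}"
    by (simp add: E_0 Finite_Cartesian_Product.vec_eq_iff matrix_vector_mult_def mscale_def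
        all_ones_def char_vec_def ones_def if_distrib[of "\<lambda>t. _ * t"] cong: if_cong)
  moreover have "ones = of_nat CARD('v) *s ((1 / of_nat CARD('v)) *s ones)"
    by (simp add: vector_smult_assoc)
  ultimately have ones: "ones = of_nat CARD('v) *s (E 0 *v char_vec {x})" by simp
  have "A *v (E 0 *v char_vec {x}) = complex_of_real (\<theta> 0) *s (E 0 *v char_vec {x})"
    by (rule A_E) (simp_all add: char_vec_x_radial)
  then show ?thesis
    unfolding ones by (simp add: vec.scale vector_smult_assoc mult.commute del: One_nat_def)
qed

lemma degree: "of_nat (card {y. adj z y}) = complex_of_real (\<theta> 0)"
proof -
  have "(A *v ones) $ z = of_nat (card {y. adj z y})" by (simp add: A_mult ones_def del: One_nat_def)
  then show ?thesis unfolding A_ones by (simp add: ones_def)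
qed

lemma \<theta>_0_neq_0: "\<theta> 0 \<noteq> 0"
proof -
  obtain z where "\<partial> x z = 1" using sphere_nonempty[of 1 x] d_pos d_eq by auto
  then have "z \<in> {y. adj x y}" using dist_eq_1_iff by blast
  then have "card {y. adj x y} \<noteq> 0" by (metis card_eq_0_iff empty_iff finite)
  then show ?thesis using degree[of x] by (metis of_nat_eq_0_iff of_real_0)
qed

text \<open>Since the radial eigenvectors for \<open>\<theta>\<^sub>0\<close> are constant, the second split sequence
  determines the intersection numbers \<open>c\<^sub>j\<close>.\<close>

lemma c_num_split:
  assumes "j < d"
  shows "split_product \<phi> \<theta>s d j = c_num (Suc j) * split_product \<phi> \<theta>s d (Suc j)"
proof -
  have "first_split_sequence radial d ((*v) A) ((*v) As) (\<lambda>i. complex_of_real (\<theta> (d - i))) \<theta>s \<phi>"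
    using parameter_array unfolding parameter_array_def bm_orbit_vertex by blast
  then obtain v f where v: "v \<in> radial" "A *v v = complex_of_real (\<theta> (d - d)) *s v" "\<And>z. v $ z = f (\<partial> x z)"
    and f0: "\<And>j. j \<le> d \<Longrightarrow> f j \<noteq> 0"
    and f: "\<And>j. j < d \<Longrightarrow> f (Suc j) * split_product \<phi> \<theta>s d j =
       c_num (Suc j) * split_product \<phi> \<theta>s d (Suc j) * f j"
    by (rule split_eigenvector[OF d_eq As_mult \<theta>s_inj]) blast
  have "v $ x *s ones = ones $ x *s v"
    using v A_ones by (intro radial_eigenvector_unique[OF v(1) _ ones_radial]) auto
  then have const: "v $ z = v $ x" for z
    by (simp add: Finite_Cartesian_Product.vec_eq_iff ones_def) metis
  have "f i = f 0" if "i \<le> d" for i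
  proof -
    obtain z where "\<partial> x z = i" using sphere_nonempty[of i x] \<open>i \<le> d\<close> d_eq by auto
    then show ?thesis using const[of z] v(3) by simp
  qed
  from this[of j] this[of "Suc j"] have "f (Suc j) = f j" using assms by simp
  then show ?thesis using f[OF assms] f0[of j] assms by (simp add: mult_ac)
qed

lemma c_num_eq:
  assumes "j < d"
  shows "c_num (Suc j) * (\<Prod>l\<in>{j<..d}. \<theta>s j - \<theta>s l) = \<phi> (Suc j) * (\<Prod>l\<in>{Suc j<..d}. \<theta>s (Suc j) - \<theta>s l)"
proof -
  have ins: "{j<..d} = insert (Suc j) {Suc j<..d}" using assms by auto
  let ?D = "\<lambda>j. \<Prod>l\<in>{j<..d}. \<theta>s j - \<theta>s l" and ?H = "\<lambda>j. \<Prod>l\<in>{j<..d}. \<phi> l"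
  have D: "?D i \<noteq> 0" for i
  proof -
    have "\<theta>s i - \<theta>s l \<noteq> 0" if "l \<in> {i<..d}" for l using inj_onD[OF \<theta>s_inj, of i l] that by auto
    then show ?thesis by simp
  qed
  have H: "?H i \<noteq> 0" for i using \<phi>_neq_0 by auto
  have "?H j / ?D j = c_num (Suc j) * (?H (Suc j) / ?D (Suc j))"
    using c_num_split[OF assms] unfolding split_product_def prod_dividef .
  moreover have "?H j = \<phi> (Suc j) * ?H (Suc j)" unfolding ins by simp
  ultimately show ?thesis using D[of j] D[of "Suc j"] H[of "Suc j"] by (simp add: field_simps)
qed

text \<open>The entry of \<open>E\<^sub>d\<close> at a pair of vertices, as a function of their distance; only the values at
  distances up to the diameter are determined.\<close>

definition \<epsilon> :: "nat \<Rightarrow> complex" where "\<epsilon> = (SOME m. E d = radial_matrix m)"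

lemma E_d_eq: "E d = radial_matrix \<epsilon>"
  unfolding \<epsilon>_def by (rule someI_ex[where P = "\<lambda>m. E d = radial_matrix m"]) (use E_d_in bose_mesner_eq_radial in blast)

lemma E_d_column: "(E d *v char_vec {x}) $ z = \<epsilon> (\<partial> x z)"
  by (simp add: E_d_eq radial_matrix_vertex)

lemma E_d_column_radial: "E d *v char_vec {x} \<in> radial"
  by (rule fibre_constantI) (simp add: E_d_column)

lemma A_E_d_column: "A *v (E d *v char_vec {x}) = complex_of_real (\<theta> d) *s (E d *v char_vec {x})"
  by (rule A_E) (simp_all add: char_vec_x_radial)

lemma \<epsilon>_0_neq_0: "\<epsilon> 0 \<noteq> 0"
proof
  assume "\<epsilon> 0 = 0"
  then have "E d *v char_vec {x} = 0"
    by (intro radial_eigenvector_eq_0[OF E_d_column_radial A_E_d_column]) (simp add: E_d_column)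
  then have col: "\<epsilon> (\<partial> x z) = 0" for z using E_d_column[of z] by simp
  have "\<epsilon> (\<partial> y z) = 0" for y z
  proof -
    obtain w where "\<partial> x w = \<partial> y z" using sphere_nonempty[OF dist_le_diameter] by metis
    then show ?thesis using col[of w] by simp
  qed
  then have "E d = 0" by (simp add: E_d_eq Finite_Cartesian_Product.vec_eq_iff)
  then show False using E_d_neq_0 by simp
qed

text \<open>The first split sequence describes the radial eigenvectors for \<open>\<theta>\<^sub>d\<close>; comparison with the second one
  gives the cosine sequence of \<open>E\<^sub>d\<close>.\<close>

lemma \<epsilon>_neq_0: "j \<le> d \<Longrightarrow> \<epsilon> j \<noteq> 0"
  and \<epsilon>_step: "j < d \<Longrightarrow> \<epsilon> (Suc j) * \<phi>v (Suc j) = \<phi> (Suc j) * \<epsilon> j"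
proof -
  have "first_split_sequence radial d ((*v) A) ((*v) As) (\<lambda>i. complex_of_real (\<theta> i)) \<theta>s \<phi>v"
    using parameter_array unfolding parameter_array_def bm_orbit_vertex by blast
  then obtain v f where v: "v \<in> radial" "A *v v = complex_of_real (\<theta> d) *s v" "\<And>z. v $ z = f (\<partial> x z)"
    and f0: "\<And>j. j \<le> d \<Longrightarrow> f j \<noteq> 0"
    and f: "\<And>j. j < d \<Longrightarrow> f (Suc j) * split_product \<phi>v \<theta>s d j =
       c_num (Suc j) * split_product \<phi>v \<theta>s d (Suc j) * f j"
    by (rule split_eigenvector[OF d_eq As_mult \<theta>s_inj]) blast
  have proportional: "v $ x *s (E d *v char_vec {x}) = (E d *v char_vec {x}) $ x *s v"
    using v A_E_d_column E_d_column_radial by (intro radial_eigenvector_unique[OF v(1)]) auto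
  have eq: "f 0 * \<epsilon> i = \<epsilon> 0 * f i" if "i \<le> d" for i
  proof -
    obtain z where z: "\<partial> x z = i" using sphere_nonempty[of i x] \<open>i \<le> d\<close> d_eq by auto
    have "(v $ x *s (E d *v char_vec {x})) $ z = ((E d *v char_vec {x}) $ x *s v) $ z" by (simp only: proportional)
    then show ?thesis by (simp add: E_d_column v(3) z)
  qed
  show "\<epsilon> j \<noteq> 0" if "j \<le> d" using eq[OF that] f0[OF that] \<epsilon>_0_neq_0 by auto
  show "\<epsilon> (Suc j) * \<phi>v (Suc j) = \<phi> (Suc j) * \<epsilon> j" if "j < d"
  proof -
    have ins: "{j<..d} = insert (Suc j) {Suc j<..d}" using that by auto
    let ?D = "\<lambda>j. \<Prod>l\<in>{j<..d}. \<theta>s j - \<theta>s l" and ?H = "\<lambda>j. \<Prod>l\<in>{j<..d}. \<phi>v l"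
    have D: "?D i \<noteq> 0" for i
    proof -
      have "\<theta>s i - \<theta>s l \<noteq> 0" if "l \<in> {i<..d}" for l using inj_onD[OF \<theta>s_inj, of i l] that by auto
      then show ?thesis by simp
    qed
    have H: "?H i \<noteq> 0" for i using \<phi>v_neq_0 by auto
    have Hj: "?H j = \<phi>v (Suc j) * ?H (Suc j)" unfolding ins by simp
    have "f (Suc j) * (?H j / ?D j) = c_num (Suc j) * (?H (Suc j) / ?D (Suc j)) * f j"
      using f[OF that] unfolding split_product_def prod_dividef .
    then have "?H (Suc j) * (f (Suc j) * \<phi>v (Suc j) * ?D (Suc j)) = ?H (Suc j) * (c_num (Suc j) * ?D j * f j)"
      unfolding Hj using D[of j] D[of "Suc j"] by (simp add: field_simps)
    then have "f (Suc j) * \<phi>v (Suc j) * ?D (Suc j) = \<phi> (Suc j) * ?D (Suc j) * f j"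
      using H[of "Suc j"] c_num_eq[OF that] by simp
    then have "f (Suc j) * \<phi>v (Suc j) = \<phi> (Suc j) * f j"
      using D[of "Suc j"] by simp
    then have "\<epsilon> 0 * (f (Suc j) * \<phi>v (Suc j)) = \<epsilon> 0 * (\<phi> (Suc j) * f j)"
      by (rule arg_cong)
    then have "(\<epsilon> 0 * f (Suc j)) * \<phi>v (Suc j) = \<phi> (Suc j) * (\<epsilon> 0 * f j)"
      by (simp only: mult_ac)
    moreover have "\<epsilon> 0 * f (Suc j) = f 0 * \<epsilon> (Suc j)" "\<epsilon> 0 * f j = f 0 * \<epsilon> j"
      using eq[of j] eq[of "Suc j"] that by simp_all
    ultimately have "(f 0 * \<epsilon> (Suc j)) * \<phi>v (Suc j) = \<phi> (Suc j) * (f 0 * \<epsilon> j)"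
      by metis
    then have "f 0 * (\<epsilon> (Suc j) * \<phi>v (Suc j)) = f 0 * (\<phi> (Suc j) * \<epsilon> j)"
      by (simp only: mult_ac)
    then show ?thesis using f0[of 0] by simp
  qed
qed

text \<open>The eigenvalue equation of the column of \<open>E\<^sub>d\<close> at the base vertex.\<close>

lemma \<epsilon>_1: "complex_of_real (\<theta> 0) * \<epsilon> 1 = complex_of_real (\<theta> d) * \<epsilon> 0"
proof -
  have "(A *v (E d *v char_vec {x})) $ x = (\<Sum>y | adj x y. \<epsilon> (\<partial> x y))"
    by (simp add: A_mult E_d_column del: One_nat_def)
  also have "\<dots> = (\<Sum>y | adj x y. \<epsilon> 1)" by (intro sum.cong refl) (simp add: dist_eq_1_iff[THEN iffD2])
  also have "\<dots> = complex_of_real (\<theta> 0) * \<epsilon> 1" by (simp add: degree)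
  finally show ?thesis by (simp add: A_E_d_column E_d_column del: One_nat_def)
qed

text \<open>Hence the division by \<open>\<theta>\<^sub>d\<close> in the size of a Delsarte clique is a genuine one.\<close>

lemma \<theta>_d_neq_0: "\<theta> d \<noteq> 0"
  using \<epsilon>_1 \<epsilon>_neq_0[of 1] d_pos \<theta>_0_neq_0 by auto

lemma clique_adj: "y \<in> C \<Longrightarrow> z \<in> C \<Longrightarrow> y \<noteq> z \<Longrightarrow> adj y z"
  using delsarte by (auto simp: delsarte_clique_def)

text \<open>The size of the clique, as a complex number.\<close>

abbreviation K :: complex where "K \<equiv> of_nat (card C)"

lemma K_neq_0: "K \<noteq> 0"
  using x_in_C by (metis card_eq_0_iff empty_iff finite of_nat_eq_0_iff)

lemma K_eq: "K * complex_of_real (\<theta> d) = complex_of_real (\<theta> d) - complex_of_real (\<theta> 0)"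
proof -
  have "{y. adj x y} = gsphere adj 1 x" by (simp add: gsphere_def dist_eq_1_iff[unfolded One_nat_def])
  then have "b_number adj 0 = card {y. adj x y}"
    using intersection_number_eq[of 1 x 1 x] by (simp add: b_number_def)
  then have "complex_of_real (real (b_number adj 0)) = complex_of_real (\<theta> 0)"
    using degree[of x] by simp
  then have "real (b_number adj 0) = \<theta> 0" by (simp only: of_real_eq_iff)
  then have "real (card C) * \<theta> d = \<theta> d - \<theta> 0"
    using delsarte \<theta>_d_neq_0 by (simp add: delsarte_clique_def field_simps)
  then have "complex_of_real (real (card C) * \<theta> d) = complex_of_real (\<theta> d - \<theta> 0)" by simp
  then show ?thesis by simp
qed

lemma \<theta>_0_neq_\<theta>_d: "complex_of_real (\<theta> 0) \<noteq> complex_of_real (\<theta> d)"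
  using K_eq K_neq_0 \<theta>_d_neq_0 by auto

text \<open>A Delsarte clique is annihilated by \<open>E\<^sub>d\<close>: up to a nonzero scalar, the squared norm of its image is
  \<open>|C| (\<epsilon>\<^sub>0 + (|C| - 1) \<epsilon>\<^sub>1)\<close>, which vanishes by the size of the clique.\<close>

lemma E_d_clique: "(\<Sum>y\<in>C. \<epsilon> (\<partial> z y)) = 0"
proof -
  define v where "v z = (\<Sum>y\<in>C. \<epsilon> (\<partial> z y))" for z
  have square: "(\<Sum>z\<in>UNIV. v z * v z) = 0"
  proof -
    have "(\<Sum>z\<in>UNIV. v z * v z) = (\<Sum>z\<in>UNIV. \<Sum>y\<in>C. \<Sum>w\<in>C. \<epsilon> (\<partial> y z) * \<epsilon> (\<partial> z w))"
      by (simp add: v_def sum_product dist_sym)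
    also have "\<dots> = (\<Sum>y\<in>C. \<Sum>w\<in>C. \<Sum>z\<in>UNIV. \<epsilon> (\<partial> y z) * \<epsilon> (\<partial> z w))"
      by (subst sum.swap, rule sum.cong[OF refl], rule sum.swap)
    also have "\<dots> = (\<Sum>y\<in>C. \<Sum>w\<in>C. \<epsilon> (\<partial> y w))"
    proof (intro sum.cong refl)
      fix y w
      have "(E d ** E d) $ y $ w = E d $ y $ w" by (simp only: E_d_idem)
      then show "(\<Sum>z\<in>UNIV. \<epsilon> (\<partial> y z) * \<epsilon> (\<partial> z w)) = \<epsilon> (\<partial> y w)"
        by (simp add: E_d_eq matrix_matrix_mult_def)
    qed
    also have "\<dots> = (\<Sum>y\<in>C. \<epsilon> 0 + (K - 1) * \<epsilon> 1)"
    proof (rule sum.cong[OF refl])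
      fix y assume y: "y \<in> C"
      have "(\<Sum>w\<in>C. \<epsilon> (\<partial> y w)) = \<epsilon> (\<partial> y y) + (\<Sum>w\<in>C - {y}. \<epsilon> (\<partial> y w))"
        by (rule sum.remove) (use y in auto)
      also have "(\<Sum>w\<in>C - {y}. \<epsilon> (\<partial> y w)) = (\<Sum>w\<in>C - {y}. \<epsilon> 1)"
        by (intro sum.cong refl) (use clique_adj y in \<open>auto simp: dist_eq_1_iff[THEN iffD2]\<close>)
      also have "\<dots> = (K - 1) * \<epsilon> 1"
      proof -
        have "card C \<ge> 1" using y by (metis One_nat_def Suc_leI card_gt_0_iff empty_iff finite)
        then show ?thesis using y by (simp add: of_nat_diff)
      qed
      finally show "(\<Sum>w\<in>C. \<epsilon> (\<partial> y w)) = \<epsilon> 0 + (K - 1) * \<epsilon> 1" by simp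
    qed
    also have "\<dots> = 0"
    proof -
      have "complex_of_real (\<theta> d) * (\<epsilon> 0 + (K - 1) * \<epsilon> 1)
          = complex_of_real (\<theta> d) * \<epsilon> 0 + (K * complex_of_real (\<theta> d) - complex_of_real (\<theta> d)) * \<epsilon> 1"
        by (simp add: algebra_simps)
      also have "\<dots> = 0" unfolding K_eq using \<epsilon>_1 by simp
      finally show ?thesis using \<theta>_d_neq_0 by simp
    qed
    finally show ?thesis .
  qed
  \<comment> \<open>Up to a scalar, the entries of \<open>E\<^sub>d\<close> are real.\<close>
  have cnj_\<epsilon>: "\<epsilon> 0 * cnj (\<epsilon> (\<partial> x z)) = cnj (\<epsilon> 0) * \<epsilon> (\<partial> x z)" for z
  proof -
    let ?u = "E d *v char_vec {x}" and ?u' = "(\<chi> z. cnj ((E d *v char_vec {x}) $ z))"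
    have "?u' \<in> radial" by (rule fibre_constantI) (simp add: E_d_column)
    moreover have "A *v ?u' = complex_of_real (\<theta> d) *s ?u'"
    proof -
      have "(A *v ?u') $ z = cnj ((A *v ?u) $ z)" for z by (simp add: A_mult del: One_nat_def)
      then show ?thesis
        by (simp add: Finite_Cartesian_Product.vec_eq_iff A_E_d_column del: One_nat_def)
    qed
    ultimately have "?u $ x *s ?u' = ?u' $ x *s ?u"
      by (intro radial_eigenvector_unique[OF E_d_column_radial A_E_d_column])
    then have "(?u $ x *s ?u') $ z = (?u' $ x *s ?u) $ z" by (rule arg_cong)
    then show ?thesis by (simp add: E_d_column)
  qed
  have cnj_v: "\<epsilon> 0 * cnj (v z) = cnj (\<epsilon> 0) * v z" for z
    unfolding v_def cnj_sum sum_distrib_left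
  proof (intro sum.cong refl)
    fix y
    obtain w where "\<partial> x w = \<partial> z y" using sphere_nonempty[of "\<partial> z y" x] dist_le_diameter by auto
    then show "\<epsilon> 0 * cnj (\<epsilon> (\<partial> z y)) = cnj (\<epsilon> 0) * \<epsilon> (\<partial> z y)" using cnj_\<epsilon>[of w] by simp
  qed
  have "\<epsilon> 0 * (\<Sum>z\<in>UNIV. v z * cnj (v z)) = (\<Sum>z\<in>UNIV. v z * (\<epsilon> 0 * cnj (v z)))"
    by (simp add: sum_distrib_left mult_ac)
  also have "\<dots> = cnj (\<epsilon> 0) * (\<Sum>z\<in>UNIV. v z * v z)"
    unfolding cnj_v by (simp add: sum_distrib_left mult_ac)
  finally have "(\<Sum>z\<in>UNIV. v z * cnj (v z)) = 0" using square \<epsilon>_0_neq_0 by simp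
  then have "complex_of_real (\<Sum>z\<in>UNIV. (cmod (v z))\<^sup>2) = 0"
    by (simp only: of_real_sum complex_norm_square)
  then have "(\<Sum>z\<in>UNIV. (cmod (v z))\<^sup>2) = 0" by (simp only: of_real_eq_0_iff)
  then have "v z = 0" by (subst (asm) sum_nonneg_eq_0_iff) auto
  then show ?thesis by (simp add: v_def)
qed

text \<open>The distance of a vertex from the clique.\<close>

abbreviation cd :: "'v \<Rightarrow> nat" where "cd \<equiv> clique_dist adj C"

lemma cd_le: "y \<in> C \<Longrightarrow> cd z \<le> \<partial> z y"
  unfolding clique_dist_def by (rule Min_le) auto

lemma cd_attained: obtains y where "y \<in> C" "\<partial> z y = cd z"
proof -
  have "cd z \<in> gdist adj z ` C" unfolding clique_dist_def by (rule Min_in) (use x_in_C in auto)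
  then show ?thesis using that by auto
qed

lemma dist_clique:
  assumes "y \<in> C" shows "\<partial> z y = cd z \<or> \<partial> z y = Suc (cd z)"
proof -
  obtain w where w: "w \<in> C" "\<partial> z w = cd z" by (rule cd_attained)
  have "\<partial> z y \<le> Suc (cd z)"
    using dist_adj_le[of y w z] clique_adj[OF assms w(1)] w(2) by (cases "y = w") auto
  with cd_le[OF assms, of z] show ?thesis by linarith
qed

text \<open>The number of vertices of the clique that are nearest to \<open>z\<close>.\<close>

definition nearest :: "'v \<Rightarrow> complex" where
  "nearest z = of_nat (card {y \<in> C. \<partial> z y = cd z})"

lemma sum_clique: "(\<Sum>y\<in>C. g (\<partial> z y)) = nearest z * g (cd z) + (K - nearest z) * g (Suc (cd z))"
  for g :: "nat \<Rightarrow> complex"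
proof -
  let ?N = "{y \<in> C. \<partial> z y = cd z}"
  have "(\<Sum>y\<in>C. g (\<partial> z y)) = (\<Sum>y\<in>?N. g (\<partial> z y)) + (\<Sum>y\<in>C - ?N. g (\<partial> z y))"
    by (subst sum.subset_diff[of ?N C]) auto
  also have "(\<Sum>y\<in>?N. g (\<partial> z y)) = (\<Sum>y\<in>?N. g (cd z))" by (intro sum.cong) auto
  also have "(\<Sum>y\<in>C - ?N. g (\<partial> z y)) = (\<Sum>y\<in>C - ?N. g (Suc (cd z)))"
    by (intro sum.cong refl) (use dist_clique in fastforce)
  finally have "(\<Sum>y\<in>C. g (\<partial> z y)) = nearest z * g (cd z) + of_nat (card (C - ?N)) * g (Suc (cd z))"
    by (simp add: nearest_def)
  moreover have "of_nat (card (C - ?N)) = K - nearest z"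
  proof -
    have "card ?N \<le> card C" by (intro card_mono) auto
    then show ?thesis by (subst card_Diff_subset) (auto simp: nearest_def of_nat_diff)
  qed
  ultimately show ?thesis by simp
qed

text \<open>A vertex at distance \<open>d\<close> from the clique would have distance \<open>d\<close> from all its members, and then
  the corresponding entry of \<open>E\<^sub>d\<close> times the clique would be \<open>|C| \<epsilon>\<^sub>d\<close>, which is not zero.\<close>

lemma cd_less: "cd z < d"
proof (rule ccontr)
  assume "\<not> cd z < d"
  then have "\<partial> z y = d" if "y \<in> C" for y
    using cd_le[OF that, of z] dist_le_diameter[of z y] d_eq by simp
  then have "(\<Sum>y\<in>C. \<epsilon> (\<partial> z y)) = K * \<epsilon> d" by simp
  then show False using E_d_clique K_neq_0 \<epsilon>_neq_0[of d] by simp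
qed

text \<open>The proportion of the members of the clique that are nearest to a vertex at distance \<open>i\<close> from the
  clique, if there is such a vertex. Since the distances of a vertex from the clique are \<open>i\<close> and \<open>i + 1\<close> only, it follows from
  \<open>\<epsilon>\<^sub>i\<close> and \<open>\<epsilon>\<^sub>i\<^sub>+\<^sub>1\<close> by the vanishing of \<open>E\<^sub>d\<close> on the clique.\<close>

definition \<alpha> :: "nat \<Rightarrow> complex" where
  "\<alpha> i = \<phi> (Suc i) / (\<phi> (Suc i) - \<phi>v (Suc i))"

lemma nearest_mult: "nearest z * (\<phi> (Suc (cd z)) - \<phi>v (Suc (cd z))) = K * \<phi> (Suc (cd z))"
proof -
  define i where "i = cd z"
  have i: "i < d" using cd_less i_def by simp
  have "nearest z * \<epsilon> i + (K - nearest z) * \<epsilon> (Suc i) = 0"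
    using E_d_clique[of z] unfolding sum_clique i_def .
  then have "(nearest z * \<epsilon> i + (K - nearest z) * \<epsilon> (Suc i)) * \<phi>v (Suc i) = 0" by simp
  then have "nearest z * \<epsilon> i * \<phi>v (Suc i) + (K - nearest z) * (\<epsilon> (Suc i) * \<phi>v (Suc i)) = 0"
    by (simp add: algebra_simps)
  then have "\<epsilon> i * (nearest z * (\<phi> (Suc i) - \<phi>v (Suc i))) = \<epsilon> i * (K * \<phi> (Suc i))"
    unfolding \<epsilon>_step[OF i] by (simp add: algebra_simps)
  then show ?thesis using \<epsilon>_neq_0[of i] i by (simp add: i_def)
qed

lemma \<phi>_neq_\<phi>v: "\<phi> (Suc (cd z)) \<noteq> \<phi>v (Suc (cd z))"
  using nearest_mult[of z] K_neq_0 \<phi>_neq_0 cd_less[of z] by auto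

lemma nearest_eq: "nearest z = K * \<alpha> (cd z)"
  using nearest_mult[of z] \<phi>_neq_\<phi>v[of z] by (simp add: \<alpha>_def field_simps)

lemma cd_eq_0_iff: "cd z = 0 \<longleftrightarrow> z \<in> C"
proof
  assume "cd z = 0"
  then show "z \<in> C" using cd_attained[of z] by (metis dist_eq_0_iff)
next
  assume "z \<in> C"
  then show "cd z = 0" using cd_le[of z z] by simp
qed

lemma radial_matrix_clique:
  "(radial_matrix m *v char_vec C) $ z = K * (\<alpha> (cd z) * m (cd z) + (1 - \<alpha> (cd z)) * m (Suc (cd z)))"
proof -
  have "(radial_matrix m *v char_vec C) $ z = (\<Sum>y\<in>C. m (\<partial> z y))"
    by (simp add: matrix_vector_mult_def char_vec_def sum.If_cases if_distrib[of "\<lambda>t. _ * t"] cong: if_cong)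
  then show ?thesis unfolding sum_clique nearest_eq by (simp add: algebra_simps)
qed

abbreviation clique_radial where "clique_radial \<equiv> fibre_constant cd"

text \<open>The module generated by the clique consists of the vectors that depend only on the distance from
  the clique.\<close>

lemma bm_orbit_clique: "bm_orbit adj (char_vec C) = clique_radial"
proof
  show "bm_orbit adj (char_vec C) \<subseteq> clique_radial"
    by (auto simp: bm_orbit_def bose_mesner_eq_radial intro!: fibre_constantI simp: radial_matrix_clique)
  show "clique_radial \<subseteq> bm_orbit adj (char_vec C)"
  proof
    fix v assume "v \<in> clique_radial"
    then obtain g where g: "\<And>z. v $ z = g (cd z)" by (rule fibre_constant_representation) blast
    \<comment> \<open>For a distance that no vertex has from the clique, the coefficient is irrelevant.\<close>
    let ?a = "\<lambda>i. if \<phi> (Suc i) = \<phi>v (Suc i) then 1 else K * \<alpha> i"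
    have "?a i \<noteq> 0" if "i < d" for i
      using that K_neq_0 \<phi>_neq_0 by (auto simp: \<alpha>_def)
    then obtain m where m: "\<forall>i<d. ?a i * m i + K * (1 - \<alpha> i) * m (Suc i) = g i"
      using backward_recursion[of d ?a "\<lambda>i. K * (1 - \<alpha> i)" g] by blast
    have "(radial_matrix m *v char_vec C) $ z = v $ z" for z
      using m[rule_format, OF cd_less[of z]] \<phi>_neq_\<phi>v[of z]
      by (simp add: radial_matrix_clique g algebra_simps)
    then have "v = radial_matrix m *v char_vec C"
      by (simp add: Finite_Cartesian_Product.vec_eq_iff)
    then show "v \<in> bm_orbit adj (char_vec C)"
      by (auto simp: bm_orbit_def bose_mesner_eq_radial)
  qed
qed

text \<open>The orthogonal projections onto the primary module and onto the module of the clique.\<close>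

abbreviation P where "P \<equiv> fibre_avg (\<partial> x)"
abbreviation Q where "Q \<equiv> fibre_avg cd"

lemma Q_vertex: "Q (char_vec {x}) = (1 / K) *s char_vec C"
proof -
  have "Q (char_vec {x}) $ z = ((1 / K) *s char_vec C) $ z" for z
  proof (cases "z \<in> C")
    case True
    then have "cd y = cd z \<longleftrightarrow> y \<in> C" for y using cd_eq_0_iff by metis
    then show ?thesis using True x_in_C by (simp add: fibre_avg_def char_vec_def)
  next
    case False
    then have "cd x \<noteq> cd z" using x_in_C by (metis cd_eq_0_iff)
    then have "(\<Sum>y | cd y = cd z. if y = x then 1 else 0) = (0 :: complex)"
      by (intro sum.neutral) auto
    then show ?thesis using False by (simp add: fibre_avg_def char_vec_def)
  qed
  then show ?thesis by (simp add: Finite_Cartesian_Product.vec_eq_iff)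
qed

lemma P_clique:
  "P (char_vec C) = char_vec {x} - (1 / complex_of_real (\<theta> d)) *s (A *v char_vec {x})"
proof -
  have Ax: "(A *v char_vec {x}) $ z = (if adj x z then 1 else 0)" for z
    using adj_sym by (auto simp: A_mult char_vec_def simp del: One_nat_def)
  have count: "P (char_vec C) $ z = of_nat (card {y \<in> C. \<partial> x y = \<partial> x z}) / of_nat (card {y. \<partial> x y = \<partial> x z})" for z
    by (simp add: fibre_avg_def char_vec_def sum.If_cases Int_def conj_commute)
  have "P (char_vec C) $ z = char_vec {x} $ z - 1 / complex_of_real (\<theta> d) * (A *v char_vec {x}) $ z" for z
  proof -
    consider "z = x" | "adj x z" | "\<partial> x z \<noteq> 0" "\<partial> x z \<noteq> 1"
      using dist_eq_1_iff dist_eq_0_iff by metis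
    then show ?thesis
    proof cases
      case 1
      have "{y \<in> C. \<partial> x y = \<partial> x z} = {x}" "{y. \<partial> x y = \<partial> x z} = {x}"
        using 1 x_in_C by auto
      then show ?thesis using 1 adj_irrefl unfolding count Ax by (simp add: char_vec_def)
    next
      case 2
      then have z: "\<partial> x z = 1" "z \<noteq> x" using dist_eq_1_iff adj_irrefl by auto
      have "{y \<in> C. \<partial> x y = \<partial> x z} = C - {x}"
        unfolding z dist_eq_1_iff using clique_adj x_in_C adj_irrefl by auto
      moreover have "of_nat (card (C - {x})) = K - 1"
      proof -
        have "card C \<ge> 1" using x_in_C by (metis One_nat_def Suc_leI card_gt_0_iff empty_iff finite)
        then show ?thesis using x_in_C by (simp add: of_nat_diff)
      qed
      moreover have "of_nat (card {y. \<partial> x y = \<partial> x z}) = complex_of_real (\<theta> 0)"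
        unfolding z dist_eq_1_iff by (rule degree)
      ultimately have "P (char_vec C) $ z = (K - 1) / complex_of_real (\<theta> 0)"
        unfolding count by simp
      also have "\<dots> = - (1 / complex_of_real (\<theta> d))"
        using K_eq \<theta>_d_neq_0 \<theta>_0_neq_0 by (simp add: divide_simps) (simp add: algebra_simps)
      finally show ?thesis using 2 z unfolding Ax by (simp add: char_vec_def)
    next
      case 3
      have "{y \<in> C. \<partial> x y = \<partial> x z} = {}"
        using 3 dist_clique[of _ x] cd_eq_0_iff[of x] x_in_C by fastforce
      moreover have "\<not> adj x z" "z \<noteq> x" using 3 dist_eq_1_iff by auto
      ultimately show ?thesis unfolding count Ax by (simp add: char_vec_def)
    qed
  qed
  then show ?thesis by (simp add: Finite_Cartesian_Product.vec_eq_iff)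
qed

lemma clique_scalars:
  "(1 / K) *s (w - (1 / complex_of_real (\<theta> d)) *s (A *v w)) =
    (1 / (complex_of_real (\<theta> 0) - complex_of_real (\<theta> d))) *s (A *v w - complex_of_real (\<theta> d) *s w)"
proof -
  have K: "1 / K = - complex_of_real (\<theta> d) / (complex_of_real (\<theta> 0) - complex_of_real (\<theta> d))"
    using K_eq K_neq_0 \<theta>_0_neq_\<theta>_d by (simp add: divide_simps) (simp add: algebra_simps)
  show ?thesis unfolding K
    using \<theta>_d_neq_0 \<theta>_0_neq_\<theta>_d
    by (simp add: Finite_Cartesian_Product.vec_eq_iff field_simps del: One_nat_def)
qed

text \<open>The two projections commute with the Bose-Mesner algebra, so that \<open>P Q\<close> is determined on the
  primary module by its value at \<open>x\<close>, and \<open>Q P\<close> on the module of the clique by its value at \<open>C\<close>.\<close>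

lemma PQ_radial:
  assumes "w \<in> radial"
  shows "P (Q w) = (1 / (complex_of_real (\<theta> 0) - complex_of_real (\<theta> d))) *s
    (A *v w - complex_of_real (\<theta> d) *s w)"
proof -
  obtain m where w: "w = radial_matrix m *v char_vec {x}"
    using assms unfolding bm_orbit_vertex[symmetric] by (auto simp: bm_orbit_def bose_mesner_eq_radial)
  have comm: "radial_matrix m *v (A *v u) = A *v (radial_matrix m *v u)" for u
    unfolding distance_matrix_radial matrix_vector_mul_assoc by (simp only: radial_matrix_commute)
  have "P (Q w) = radial_matrix m *v P (Q (char_vec {x}))"
    unfolding w fibre_avg_radial_commute[OF bm_orbit_clique] fibre_avg_radial_commute[OF bm_orbit_vertex] ..
  also have "\<dots> = (1 / K) *s (w - (1 / complex_of_real (\<theta> d)) *s (A *v w))"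
    unfolding Q_vertex fibre_avg_scale P_clique vec.scale vec.diff comm w ..
  finally show ?thesis unfolding clique_scalars .
qed

lemma QP_clique_radial:
  assumes "w \<in> clique_radial"
  shows "Q (P w) = (1 / (complex_of_real (\<theta> 0) - complex_of_real (\<theta> d))) *s
    (A *v w - complex_of_real (\<theta> d) *s w)"
proof -
  obtain m where w: "w = radial_matrix m *v char_vec C"
    using assms unfolding bm_orbit_clique[symmetric] by (auto simp: bm_orbit_def bose_mesner_eq_radial)
  have comm: "radial_matrix m *v (A *v u) = A *v (radial_matrix m *v u)" for u
    unfolding distance_matrix_radial matrix_vector_mul_assoc by (simp only: radial_matrix_commute)
  have QA: "Q (A *v u) = A *v Q u" for u
    unfolding distance_matrix_radial by (rule fibre_avg_radial_commute[OF bm_orbit_clique])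
  have "Q (P w) = radial_matrix m *v Q (P (char_vec C))"
    unfolding w fibre_avg_radial_commute[OF bm_orbit_clique] fibre_avg_radial_commute[OF bm_orbit_vertex] ..
  also have "\<dots> = (1 / K) *s (w - (1 / complex_of_real (\<theta> d)) *s (A *v w))"
    unfolding P_clique fibre_avg_scale fibre_avg_diff QA Q_vertex vec.scale vec.diff comm w
    by (simp add: Finite_Cartesian_Product.vec_eq_iff algebra_simps del: One_nat_def)
  finally show ?thesis unfolding clique_scalars .
qed

section \<open>The common refinement of the two partitions\<close>

text \<open>The characteristic vectors of \<open>C\<^sub>i\<^sup>-\<close>, \<open>C\<^sub>i\<^sup>+\<close>, \<open>C\<^sub>i\<close> and of the sphere of radius \<open>i\<close> about \<open>x\<close>.\<close>

abbreviation Cm where "Cm i \<equiv> char_vec (C_minus adj C x i)"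
abbreviation Cp where "Cp i \<equiv> char_vec (C_plus adj C x i)"
abbreviation Ci where "Ci i \<equiv> char_vec (clique_part adj C i)"
abbreviation Gi where "Gi i \<equiv> char_vec (gsphere adj i x)"

lemma dist_x: "\<partial> x z = cd z \<or> \<partial> x z = Suc (cd z)"
  using dist_clique[OF x_in_C, of z] dist_sym by metis

lemma Cm_nth: "Cm i $ z = (if cd z = i \<and> \<partial> x z = i then 1 else 0)"
  and Cp_nth: "Cp i $ z = (if cd z = i \<and> \<partial> x z = Suc i then 1 else 0)"
  and Ci_nth: "Ci i $ z = (if cd z = i then 1 else 0)"
  and Gi_nth: "Gi i $ z = (if \<partial> x z = i then 1 else 0)"
  by (simp_all add: char_vec_def C_minus_def C_plus_def clique_part_def gsphere_def)

lemma Ci_eq: "Ci i = Cm i + Cp i"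
  using dist_x by (auto simp: Finite_Cartesian_Product.vec_eq_iff Cm_nth Cp_nth Ci_nth) 

lemma Gi_0: "Gi 0 = Cm 0"
  using x_in_C cd_eq_0_iff[of x] by (auto simp: Finite_Cartesian_Product.vec_eq_iff Cm_nth Gi_nth)

lemma Gi_Suc: "Gi (Suc i) = Cm (Suc i) + Cp i"
proof -
  have "Gi (Suc i) $ z = (Cm (Suc i) + Cp i) $ z" for z
    using dist_x[of z] by (auto simp: Cm_nth Cp_nth Gi_nth)
  then show ?thesis by (simp add: Finite_Cartesian_Product.vec_eq_iff)
qed

lemma Cm_d: "Cm d = 0"
  using cd_less by (auto simp: Finite_Cartesian_Product.vec_eq_iff Cm_nth)

lemma Gi_radial: "Gi i \<in> radial" by (rule fibre_constantI) (simp add: Gi_nth)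
lemma Ci_clique_radial: "Ci i \<in> clique_radial" by (rule fibre_constantI) (simp add: Ci_nth)

text \<open>The sphere is a distance matrix times \<open>x\<close>, and \<open>Q\<close> sends \<open>x\<close> to a multiple of the clique.\<close>

lemma Q_Gi: "Q (Gi i) $ z = \<alpha> (cd z) * (if cd z = i then 1 else 0)
    + (1 - \<alpha> (cd z)) * (if Suc (cd z) = i then 1 else 0)"
proof -
  let ?M = "radial_matrix (\<lambda>t. if t = i then 1 else 0)"
  have "Gi i = ?M *v char_vec {x}"
    by (simp add: Finite_Cartesian_Product.vec_eq_iff Gi_nth radial_matrix_vertex)
  then have "Q (Gi i) $ z = (1 / K) * (?M *v char_vec C) $ z"
    by (simp add: fibre_avg_radial_commute[OF bm_orbit_clique] Q_vertex vec.scale)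
  then show ?thesis using K_neq_0 by (simp add: radial_matrix_clique)
qed

lemma Q_Cm: "Q (Cm i) = \<alpha> i *s Ci i"
proof -
  have "Q (Cm i) $ z = (\<alpha> i *s Ci i) $ z" for z
  proof (cases "cd z = i")
    case True
    then have "Q (Cm i) $ z = Q (Gi i) $ z" by (intro fibre_avg_cong) (simp add: Cm_nth Gi_nth)
    then show ?thesis using True by (simp add: Q_Gi Ci_nth)
  next
    case False
    then have "Q (Cm i) $ z = Q 0 $ z" by (intro fibre_avg_cong) (simp add: Cm_nth)
    then show ?thesis using False by (simp add: Ci_nth fibre_avg_def)
  qed
  then show ?thesis by (simp add: Finite_Cartesian_Product.vec_eq_iff)
qed

lemma Q_Cp: "Q (Cp i) = (1 - \<alpha> i) *s Ci i"
proof -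
  have "Q (Cm i) + Q (Cp i) = Ci i"
    unfolding fibre_avg_add[symmetric] Ci_eq[symmetric] by (rule fibre_avg_id[OF Ci_clique_radial])
  then have "Q (Cp i) = Ci i - \<alpha> i *s Ci i" unfolding Q_Cm by (simp add: algebra_simps)
  then show ?thesis by (simp add: Finite_Cartesian_Product.vec_eq_iff algebra_simps)
qed

text \<open>The proportion of the sphere of radius \<open>i > 0\<close> about \<open>x\<close> that lies in \<open>C\<^sub>i\<^sub>-\<^sub>1\<^sup>+\<close>,
  provided that \<open>\<alpha>\<^sub>i\<^sub>-\<^sub>1\<close> is not zero.\<close>

definition \<beta> :: "nat \<Rightarrow> complex" where
  "\<beta> i = c_num i / ((complex_of_real (\<theta> 0) - complex_of_real (\<theta> d)) * \<alpha> (i - 1))"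

lemma A_Gi: "\<partial> x z = Suc i \<Longrightarrow> (A *v Gi i) $ z = c_num (Suc i)"
  by (simp add: A_mult Gi_nth sum.If_cases Int_def c_num_count[symmetric] del: One_nat_def)

text \<open>The vector \<open>P Q\<close> applied to the sphere of radius \<open>i\<close> is evaluated on the next sphere in two ways.\<close>

lemma P_Cp:
  assumes \<alpha>: "\<alpha> i \<noteq> 0"
  shows "P (Cp i) = \<beta> (Suc i) *s Gi (Suc i)"
proof -
  have "P (Cp i) $ z = (\<beta> (Suc i) *s Gi (Suc i)) $ z" for z
  proof (cases "\<partial> x z = Suc i")
    case True
    have "\<alpha> i * P (Cp i) $ z = P (\<alpha> i *s Cp i) $ z" by (simp add: fibre_avg_scale)
    also have "\<dots> = P (Q (Gi i)) $ z"
    proof (rule fibre_avg_cong)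
      fix y assume "\<partial> x y = \<partial> x z"
      then show "(\<alpha> i *s Cp i) $ y = Q (Gi i) $ y"
        using dist_x[of y] True by (auto simp: Q_Gi Cp_nth)
    qed
    also have "\<dots> = c_num (Suc i) / (complex_of_real (\<theta> 0) - complex_of_real (\<theta> d))"
      by (simp add: PQ_radial[OF Gi_radial] A_Gi[OF True] Gi_nth True del: One_nat_def)
    finally show ?thesis using \<alpha> \<theta>_0_neq_\<theta>_d by (simp add: \<beta>_def Gi_nth True field_simps)
  next
    case False
    then have "P (Cp i) $ z = P 0 $ z" by (intro fibre_avg_cong) (simp add: Cp_nth)
    then show ?thesis using False by (simp add: Gi_nth fibre_avg_def)
  qed
  then show ?thesis by (simp add: Finite_Cartesian_Product.vec_eq_iff)
qed

lemma P_Cm: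
  assumes "\<alpha> i \<noteq> 0"
  shows "P (Cm (Suc i)) = (1 - \<beta> (Suc i)) *s Gi (Suc i)"
proof -
  have "P (Cm (Suc i)) + P (Cp i) = Gi (Suc i)"
    unfolding fibre_avg_add[symmetric] Gi_Suc[symmetric] by (rule fibre_avg_id[OF Gi_radial])
  then have "P (Cm (Suc i)) = Gi (Suc i) - \<beta> (Suc i) *s Gi (Suc i)"
    unfolding P_Cp[OF assms] by (simp add: algebra_simps)
  then show ?thesis by (simp add: Finite_Cartesian_Product.vec_eq_iff algebra_simps)
qed

lemma P_Cm_0: "P (Cm 0) = Cm 0"
  using fibre_avg_id[OF Gi_radial[of 0]] by (simp add: Gi_0)

section \<open>The dual adjacency matrices\<close>

lemma As_Cm: "As *v Cm i = \<theta>s i *s Cm i" and As_Cp: "As *v Cp i = \<theta>s (Suc i) *s Cp i"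
  by (simp_all add: Finite_Cartesian_Product.vec_eq_iff As_mult Cm_nth Cp_nth)

lemma E_1_entry: "of_nat CARD('v) * E 1 $ y $ z = \<theta>s (\<partial> y z)"
proof -
  obtain m where m: "E 1 = radial_matrix m" using E_1_in bose_mesner_eq_radial by blast
  obtain w where w: "\<partial> x w = \<partial> y z" using sphere_nonempty[of "\<partial> y z" x] dist_le_diameter by auto
  let ?u = "(\<chi> z. 1) :: complex^'v"
  have "\<theta>s (\<partial> x w) = (As *v ?u) $ w" by (simp add: As_mult)
  also have "\<dots> = of_nat CARD('v) * E 1 $ x $ w"
    by (simp add: As_dual dual_adjacency_def diag_matrix_def matrix_vector_mult_def)
  finally show ?thesis by (simp add: m w del: One_nat_def)
qed

text \<open>The dual eigenvalues of the clique: an average of two dual eigenvalues of the graph.\<close>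

definition \<theta>c :: "nat \<Rightarrow> complex" where
  "\<theta>c i = \<alpha> i * \<theta>s i + (1 - \<alpha> i) * \<theta>s (Suc i)"

text \<open>A vertex of \<open>C\<^sub>i\<close> has distance \<open>i\<close> from the proportion \<open>\<alpha>\<^sub>i\<close> of the clique and distance \<open>i + 1\<close> from the
  rest. The given eigenvalues \<open>\<theta>t\<close> are determined only at distances that occur, such as \<open>0\<close>.\<close>

lemma clique_dual:
  assumes At: "At = clique_dual_adjacency (E 1) C"
    and At_eq: "At = (\<Sum>i<d. mscale (\<theta>t i) (clique_dual_idempotent adj C i))"
  shows At_Cm: "At *v Cm i = \<theta>c i *s Cm i" and At_Cp: "At *v Cp i = \<theta>c i *s Cp i"
    and \<theta>t_0: "\<theta>t 0 = \<theta>c 0"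
proof -
  have range: "{..<d} = {..d - 1}" using d_pos by auto
  have cd_le': "cd z \<le> d - 1" for z using cd_less[of z] by linarith
  have At_mult: "(At *v u) $ z = \<theta>t (cd z) * u $ z" for u z
    unfolding At_eq clique_dual_idempotent_def clique_part_def mem_Collect_eq range
    by (rule dual_idempotent_combination_mult) (rule cd_le')
  let ?u = "(\<chi> z. 1) :: complex^'v"
  have sum_nth: "(\<Sum>y\<in>C. dual_adjacency (E 1) y) $ z $ w = (if z = w then (\<Sum>y\<in>C. \<theta>s (\<partial> w y)) else 0)" for z w
    by (auto simp: dual_adjacency_def diag_matrix_def E_1_entry dist_sym simp del: One_nat_def)
  have entry: "At $ z $ w = (if z = w then (1 / K) * (\<Sum>y\<in>C. \<theta>s (\<partial> w y)) else 0)" for z w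
    unfolding At clique_dual_adjacency_def mscale_def vec_lambda_beta sum_nth by simp
  have \<theta>t: "\<theta>t (cd z) = \<theta>c (cd z)" for z
  proof -
    have "\<theta>t (cd z) = (At *v ?u) $ z" by (simp add: At_mult)
    also have "\<dots> = (1 / K) * (\<Sum>y\<in>C. \<theta>s (\<partial> z y))"
      unfolding matrix_vector_mult_def vec_lambda_beta entry by simp
    also have "\<dots> = \<theta>c (cd z)"
      unfolding sum_clique nearest_eq \<theta>c_def using K_neq_0 by (simp add: field_simps)
    finally show ?thesis .
  qed
  show "At *v Cm i = \<theta>c i *s Cm i" "At *v Cp i = \<theta>c i *s Cp i"
    by (simp_all add: Finite_Cartesian_Product.vec_eq_iff At_mult \<theta>t Cm_nth Cp_nth)
  show "\<theta>t 0 = \<theta>c 0" using \<theta>t[of x] cd_eq_0_iff[of x] x_in_C by simp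
qed

end

section \<open>The parameters of q-Racah type\<close>

lemma prod_shift_2:
  fixes g :: "nat \<Rightarrow> complex"
  assumes "a \<le> b"
  shows "(\<Prod>m\<in>{a..<b}. g (m + 2)) * (g a * g (a + 1)) = (\<Prod>m\<in>{a..<b}. g m) * (g b * g (b + 1))"
  using assms by (induction b rule: dec_induct) (simp_all add: mult_ac)

lemma power_int_diff_nat: "q \<noteq> 0 \<Longrightarrow> q powi (int m - int n) = q ^ m / q ^ n" for q :: complex
  by (simp add: power_int_diff)

text \<open>The next three identities make the \<open>2 \<times> 2\<close> blocks have determinant one.\<close>

lemma P_minus_R:
  assumes "1 - ss * q ^ (2 * i + 2) \<noteq> 0"
  shows "P_coeff q ss r1 r2 i - ss * R_coeff q ss r1 r2 i = r1 * r2 - ss"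
proof -
  define Y where "Y = q ^ (i + 1)"
  have Y: "q ^ (2 * i + 2) = Y\<^sup>2" unfolding Y_def power_mult[symmetric] by (rule arg_cong[where f = "power q"]) simp
  have "1 - ss * Y\<^sup>2 \<noteq> 0" using assms unfolding Y .
  moreover have "(r1 - ss * Y) * (r2 - ss * Y) - ss * ((1 - r1 * Y) * (1 - r2 * Y)) = (r1 * r2 - ss) * (1 - ss * Y\<^sup>2)"
    by (simp add: algebra_simps power2_eq_square)
  ultimately show ?thesis
    unfolding P_coeff_def R_coeff_def Y Y_def[symmetric] by (simp add: divide_simps)
qed

lemma U_V_relation:
  assumes "q \<noteq> 0" "1 - ss * q ^ (2 * i + 1) \<noteq> 0"
  shows "q ^ d * U_coeff d q ss i = V_coeff d q ss i - (1 - q ^ d)"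
proof -
  have "q ^ d * (1 - q powi (int i - int d)) = q ^ d - q ^ i"
    using assms(1) by (simp add: power_int_diff_nat algebra_simps)
  then have "q ^ d * U_coeff d q ss i = (q ^ d - q ^ i) * (1 - ss * q ^ (i + 1)) / (1 - ss * q ^ (2 * i + 1))"
    unfolding U_coeff_def by (simp add: mult.assoc[symmetric])
  also have "(q ^ d - q ^ i) * (1 - ss * q ^ (i + 1))
      = (1 - q ^ i) * (1 - ss * q ^ (d + i + 1)) - (1 - q ^ d) * (1 - ss * q ^ (2 * i + 1))"
    by (simp add: algebra_simps power_add mult_2 mult_2_right)
  finally show ?thesis
    using assms(2) unfolding V_coeff_def diff_divide_distrib by simp
qed

lemma U_mult_V:
  assumes "q \<noteq> 0" "1 - ss * q ^ (2 * i + 1) \<noteq> 0"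
  shows "U_coeff d q ss i * V_coeff d q ss i
    = Z_coeff d q ss i * (1 - ss * q ^ (d + 1) + ss * q ^ (d + 1) * Z_coeff d q ss i)"
proof -
  define D where "D = 1 - ss * q ^ (2 * i + 1)"
  define x where "x = 1 - q powi (int i - int d)"
  have x: "q ^ d * x = q ^ d - q ^ i"
    using assms(1) by (simp add: x_def power_int_diff_nat algebra_simps)
  have D: "D \<noteq> 0" using assms(2) by (simp add: D_def)
  have "(1 - ss * q ^ (i + 1)) * (1 - ss * q ^ (d + i + 1))
      = (1 - ss * q ^ (d + 1)) * D + ss * q * (1 - q ^ i) * (q ^ d * x)"
    unfolding x by (simp add: D_def algebra_simps power_add mult_2 mult_2_right)
  moreover define M and \<kappa> where "M = (1 - q ^ i) * x" and "\<kappa> = ss * q ^ (d + 1)"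
  ultimately have eq: "(1 - ss * q ^ (i + 1)) * (1 - ss * q ^ (d + i + 1)) = (1 - \<kappa>) * D + \<kappa> * M"
    by (simp add: mult_ac)
  have "U_coeff d q ss i * V_coeff d q ss i
      = M * ((1 - ss * q ^ (i + 1)) * (1 - ss * q ^ (d + i + 1))) / (D * D)"
    unfolding U_coeff_def V_coeff_def D_def[symmetric] x_def[symmetric] M_def by (simp add: mult_ac)
  also have "\<dots> = M / D * (1 - \<kappa> + \<kappa> * (M / D))"
    unfolding eq using D by (simp add: field_simps)
  finally show ?thesis
    unfolding Z_coeff_def D_def[symmetric] x_def[symmetric] M_def \<kappa>_def .
qed

text \<open>The trace of \<open>t\<^sub>1 t\<^sub>2\<close> on a block, in terms of \<open>Y = q\<^sup>i\<close>, \<open>G = q\<^sup>d\<close> and \<open>e\<^sup>2 = s\<^sup>* q\<close>.\<close>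

lemma trace_t1_t2:
  fixes Y G e :: complex
  assumes nz: "Y \<noteq> 0" "G \<noteq> 0" "e \<noteq> 0" "D \<noteq> 0" and D: "D = 1 - e\<^sup>2 * Y\<^sup>2"
    and U: "U = (1 - Y / G) * (1 - e\<^sup>2 * Y) / D" and V: "V = (1 - Y) * (1 - e\<^sup>2 * G * Y) / D"
    and Z: "Z = (1 - Y) * (1 - Y / G) / D"
  shows "(V + G) * (G * e\<^sup>2 * Z + 1) / (G * e) + U * V * (1 / (Y * e) + Y * e) + (1 - V) * (1 - Z) * e
    = 1 / (Y * e) + Y * e"
proof -
  have U': "U * (D * G) = (G - Y) * (1 - e\<^sup>2 * Y)" and V': "V * D = (1 - Y) * (1 - e\<^sup>2 * G * Y)"
    and Z': "Z * (D * G) = (1 - Y) * (G - Y)"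
    using nz unfolding U V Z by (simp_all add: field_simps)
  have VG: "(V + G) * D = D * G + (1 - Y) * (1 - e\<^sup>2 * G * Y)" 
    and V1: "(1 - V) * D = D - (1 - Y) * (1 - e\<^sup>2 * G * Y)"
    and Z1: "(1 - Z) * (D * G) = D * G - (1 - Y) * (G - Y)"
    using U' V' Z' by (simp_all add: algebra_simps)
  have "(G * e\<^sup>2 * Z + 1) * D = D + e\<^sup>2 * (Z * (D * G))" by (simp add: algebra_simps)
  then have GZ: "(G * e\<^sup>2 * Z + 1) * D = D + e\<^sup>2 * ((1 - Y) * (G - Y))" unfolding Z' .
  have "((V + G) * D) * ((G * e\<^sup>2 * Z + 1) * D) * Y + (U * (D * G)) * (V * D) * (1 + Y\<^sup>2 * e\<^sup>2)
      + ((1 - V) * D) * ((1 - Z) * (D * G)) * (e\<^sup>2 * Y) = (1 + Y\<^sup>2 * e\<^sup>2) * (D\<^sup>2 * G)"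
    unfolding VG V1 GZ Z1 U' V' unfolding D by (simp add: algebra_simps power2_eq_square)
  then have "D\<^sup>2 * ((V + G) * (G * e\<^sup>2 * Z + 1) * Y + G * (U * V) * (1 + Y\<^sup>2 * e\<^sup>2)
      + G * ((1 - V) * (1 - Z)) * (e\<^sup>2 * Y)) = D\<^sup>2 * (G * (1 + Y\<^sup>2 * e\<^sup>2))"
    by (simp add: algebra_simps power2_eq_square)
  then have "(V + G) * (G * e\<^sup>2 * Z + 1) * Y + G * (U * V) * (1 + Y\<^sup>2 * e\<^sup>2)
      + G * ((1 - V) * (1 - Z)) * (e\<^sup>2 * Y) = G * (1 + Y\<^sup>2 * e\<^sup>2)"
    using nz by simp
  then show ?thesis
    using nz by (simp add: divide_simps) (simp add: algebra_simps power2_eq_square)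
qed

text \<open>A Delsarte clique in a graph of \<open>q\<close>-Racah type.\<close>

locale q_racah_clique = delsarte_clique_graph adj d E \<theta> C x As \<theta>s \<phi>v \<phi>
  for adj :: "'v::finite \<Rightarrow> 'v \<Rightarrow> bool" and d E \<theta> C x As \<theta>s \<phi>v \<phi> +
  fixes q h hs s ss r1 r2 :: complex
  assumes q_racah: "q_racah_type d q h hs s ss r1 r2 (\<lambda>i. complex_of_real (\<theta> i)) \<theta>s \<phi>v \<phi>"
begin

lemma nonzero: "q \<noteq> 0" "h \<noteq> 0" "hs \<noteq> 0" "s \<noteq> 0" "ss \<noteq> 0" "r1 \<noteq> 0" "r2 \<noteq> 0"
  and r1_r2: "r1 * r2 = s * ss * q ^ (d + 1)"
  and q_power_neq_1: "i \<in> {1..d} \<Longrightarrow> q ^ i \<noteq> 1"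
  and s_q_neq_1: "i \<in> {2..2 * d} \<Longrightarrow> s * q ^ i \<noteq> 1"
  and ss_q_neq_1: "i \<in> {2..2 * d} \<Longrightarrow> ss * q ^ i \<noteq> 1"
  using q_racah unfolding q_racah_type_def by blast+

lemma ss_neq: "i \<in> {2..2 * d} \<Longrightarrow> 1 - ss * q ^ i \<noteq> 0"
  using ss_q_neq_1[of i] by auto

lemma \<theta>s_eq:
  assumes "i \<le> d"
  shows "\<theta>s i = \<theta>s 0 + hs * (1 - q ^ i) * (1 - ss * q ^ (i + 1)) / q ^ i"
proof -
  have "\<theta>s i = \<theta>s 0 + hs * (1 - q ^ i) * (1 - ss * q ^ (i + 1)) * q powi (- int i)"
    using q_racah assms unfolding q_racah_type_def by blast
  then show ?thesis by (simp only: power_int_minus power_int_of_nat divide_inverse)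
qed

lemma \<theta>_d_eq: "complex_of_real (\<theta> d) = complex_of_real (\<theta> 0) + h * (1 - q ^ d) * (1 - s * q ^ (d + 1)) / q ^ d"
proof -
  have "complex_of_real (\<theta> d) = complex_of_real (\<theta> 0) + h * (1 - q ^ d) * (1 - s * q ^ (d + 1)) * q powi (- int d)"
    using q_racah unfolding q_racah_type_def by blast
  then show ?thesis by (simp only: power_int_minus power_int_of_nat divide_inverse)
qed

text \<open>The common factor of the entries of the two split sequences.\<close>

definition common :: "nat \<Rightarrow> complex" where
  "common i = h * hs / q ^ (2 * i + 1) * (1 - q ^ (i + 1)) * (1 - q ^ i / q ^ d)"

lemma powers: "q powi (1 - 2 * int (Suc i)) = 1 / q ^ (2 * i + 1)"
  "q powi (int (Suc i) - int d - 1) = q ^ i / q ^ d"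
proof -
  have "1 - 2 * int (Suc i) = - int (2 * i + 1)" by simp
  then show "q powi (1 - 2 * int (Suc i)) = 1 / q ^ (2 * i + 1)"
    by (simp only: power_int_minus power_int_of_nat inverse_eq_divide)
  have "int (Suc i) - int d - 1 = int i - int d" by simp
  then show "q powi (int (Suc i) - int d - 1) = q ^ i / q ^ d"
    by (simp only: power_int_diff_nat[OF nonzero(1)])
qed

lemma \<phi>v_eq: "i < d \<Longrightarrow> \<phi>v (Suc i) = common i * ((1 - r1 * q ^ (i + 1)) * (1 - r2 * q ^ (i + 1)))"
  and \<phi>_eq: "i < d \<Longrightarrow> \<phi> (Suc i) = common i * ((r1 - ss * q ^ (i + 1)) * (r2 - ss * q ^ (i + 1))) / ss"
proof -
  assume i: "i < d"
  then have "Suc i \<in> {1..d}" by simp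
  then have "\<phi>v (Suc i) = h * hs * q powi (1 - 2 * int (Suc i)) * (1 - q ^ Suc i) *
        (1 - q powi (int (Suc i) - int d - 1)) * (1 - r1 * q ^ Suc i) * (1 - r2 * q ^ Suc i)"
    "\<phi> (Suc i) = h * hs * q powi (1 - 2 * int (Suc i)) * (1 - q ^ Suc i) *
        (1 - q powi (int (Suc i) - int d - 1)) * (r1 - ss * q ^ Suc i) * (r2 - ss * q ^ Suc i) / ss"
    using q_racah unfolding q_racah_type_def by blast+
  then show "\<phi>v (Suc i) = common i * ((1 - r1 * q ^ (i + 1)) * (1 - r2 * q ^ (i + 1)))"
    "\<phi> (Suc i) = common i * ((r1 - ss * q ^ (i + 1)) * (r2 - ss * q ^ (i + 1))) / ss"
    unfolding powers common_def by (simp_all add: mult.assoc)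
qed

abbreviation Pc where "Pc \<equiv> P_coeff q ss r1 r2"
abbreviation Rc where "Rc \<equiv> R_coeff q ss r1 r2"

lemma even_denominator: "i < d \<Longrightarrow> 1 - ss * q ^ (2 * i + 2) \<noteq> 0"
  by (rule ss_neq) auto

lemma odd_denominator: "i \<in> {1..<d} \<Longrightarrow> 1 - ss * q ^ (2 * i + 1) \<noteq> 0"
  by (rule ss_neq) auto

lemma \<phi>_P: "i < d \<Longrightarrow> \<phi> (Suc i) = common i * (1 - ss * q ^ (2 * i + 2)) / ss * Pc i"
  and \<phi>v_R: "i < d \<Longrightarrow> \<phi>v (Suc i) = common i * (1 - ss * q ^ (2 * i + 2)) / ss * (ss * Rc i)"
  using even_denominator[of i] nonzero unfolding \<phi>_eq \<phi>v_eq P_coeff_def R_coeff_def by simp_all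

lemma \<phi>_diff:
  assumes "i < d"
  shows "\<phi> (Suc i) - \<phi>v (Suc i) = common i * (1 - ss * q ^ (2 * i + 2)) / ss * (r1 * r2 - ss)"
  unfolding \<phi>_P[OF assms] \<phi>v_R[OF assms] P_minus_R[OF even_denominator[OF assms], of r1 r2, symmetric]
  by (simp only: right_diff_distrib)

lemma r_neq: "r1 * r2 - ss \<noteq> 0"
proof -
  have "s * q ^ (d + 1) \<noteq> 1" by (rule s_q_neq_1) (use d_pos in auto)
  moreover have "r1 * r2 - ss = ss * (s * q ^ (d + 1) - 1)" unfolding r1_r2 by (simp add: algebra_simps)
  ultimately show ?thesis using nonzero(5) by simp
qed

lemma common_neq_0: "i < d \<Longrightarrow> common i \<noteq> 0"
  using \<phi>_eq[of i] \<phi>_neq_0 by auto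

lemma \<alpha>_eq: "i < d \<Longrightarrow> \<alpha> i = Pc i / (r1 * r2 - ss)"
  unfolding \<alpha>_def \<phi>_diff unfolding \<phi>_P
  using common_neq_0[of i] even_denominator[of i] nonzero by simp

lemma one_minus_\<alpha>: "i < d \<Longrightarrow> 1 - \<alpha> i = - ss * Rc i / (r1 * r2 - ss)"
  using \<alpha>_eq[of i] P_minus_R[OF even_denominator, of i r1 r2] r_neq by (simp add: field_simps)

lemma \<alpha>_neq_0: "i < d \<Longrightarrow> \<alpha> i \<noteq> 0"
  using \<alpha>_eq[of i] \<phi>_P[of i] \<phi>_neq_0 r_neq by auto

text \<open>The coefficient \<open>V\<^sub>i\<close> for \<open>1 \<le> i \<le> d\<close>. At \<open>i = d\<close> the factor \<open>1 - s\<^sup>* q\<^bsup>2d+1\<^esup>\<close> of numerator and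
  denominator, which may vanish, is cancelled.\<close>

definition Vc :: "nat \<Rightarrow> complex" where
  "Vc i = (if i = d then 1 - q ^ d else V_coeff d q ss i)"

lemma \<theta>s_diff:
  assumes "i \<le> d" "j \<le> d"
  shows "\<theta>s i - \<theta>s j = hs / q ^ i * (1 - q ^ i / q ^ j) * (1 - ss * q ^ (i + j + 1))"
  unfolding \<theta>s_eq[OF assms(1)] \<theta>s_eq[OF assms(2)] using nonzero
  by (simp add: field_simps power_add)

text \<open>The products that occur in the formula for \<open>c\<^sub>j\<^sub>+\<^sub>1\<close>. By the factorization of
  \<open>\<theta>\<^sup>*\<^sub>i - \<theta>\<^sup>*\<^sub>j\<close>, a shift of both indices changes a factor only by a power of \<open>q\<close> and by the exponent of
  \<open>q\<close> in its last term, so the quotient telescopes.\<close>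

lemma \<theta>s_product_ratio:
  assumes j: "j < d"
  shows "q ^ (d - Suc j) * (\<Prod>l\<in>{Suc j<..d}. \<theta>s (Suc j) - \<theta>s l) *
      (hs / q ^ j * (1 - q ^ j / q ^ d) * (1 - ss * q ^ (2 * j + 2)) * (1 - q ^ (j + 1)))
    = (\<Prod>l\<in>{j<..d}. \<theta>s j - \<theta>s l) * Vc (Suc j)"
proof (cases "Suc j = d")
  case True
  then have d: "{j<..d} = {d}" "j + d + 1 = 2 * j + 2" by auto
  show ?thesis unfolding d(1) using True \<theta>s_diff[of j d] j unfolding d(2) by (simp add: Vc_def)
next
  case False
  let ?I = "{Suc j..<d}" and ?g = "\<lambda>m. 1 - ss * q ^ (j + m + 1)"
  let ?F' = "\<Prod>m\<in>?I. \<theta>s (Suc j) - \<theta>s (Suc m)" and ?F = "\<Prod>m\<in>?I. \<theta>s j - \<theta>s m"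
  have I: "{j<..d} = insert d ?I" "{Suc j<..d} = Suc ` ?I" using j by (auto simp: image_iff Bex_def)
  have F: "(\<Prod>l\<in>{j<..d}. \<theta>s j - \<theta>s l) = (\<theta>s j - \<theta>s d) * ?F" unfolding I by simp
  have F': "(\<Prod>l\<in>{Suc j<..d}. \<theta>s (Suc j) - \<theta>s l) = ?F'" unfolding I by (subst prod.reindex) auto
  have step: "q * ?g m * (\<theta>s (Suc j) - \<theta>s (Suc m)) = ?g (m + 2) * (\<theta>s j - \<theta>s m)" if "m \<in> ?I" for m
  proof -
    have "\<theta>s (Suc j) - \<theta>s (Suc m) = hs / (q * q ^ j) * (1 - q ^ j / q ^ m) * ?g (m + 2)"
      using \<theta>s_diff[of "Suc j" "Suc m"] that j nonzero by (simp add: power_add)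
    moreover have "\<theta>s j - \<theta>s m = hs / q ^ j * (1 - q ^ j / q ^ m) * ?g m"
      using \<theta>s_diff[of j m] that j by simp
    ultimately show ?thesis using nonzero by simp
  qed
  have "(\<Prod>m\<in>?I. q * ?g m * (\<theta>s (Suc j) - \<theta>s (Suc m))) = (\<Prod>m\<in>?I. ?g (m + 2) * (\<theta>s j - \<theta>s m))"
    by (intro prod.cong refl step)
  then have prods: "q ^ (d - Suc j) * (\<Prod>m\<in>?I. ?g m) * ?F' = (\<Prod>m\<in>?I. ?g (m + 2)) * ?F"
    by (simp add: prod.distrib)
  have tele: "(\<Prod>m\<in>?I. ?g (m + 2)) * (?g (Suc j) * ?g (Suc j + 1)) = (\<Prod>m\<in>?I. ?g m) * (?g d * ?g (d + 1))"
    by (rule prod_shift_2) (use j in simp)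
  have g: "?g (Suc j) = 1 - ss * q ^ (2 * j + 2)" "?g (Suc j + 1) = 1 - ss * q ^ (2 * Suc j + 1)"
    "?g (d + 1) = 1 - ss * q ^ (d + Suc j + 1)"
    by (simp_all add: mult_2 add_ac)
  have "(\<Prod>m\<in>?I. ?g m) * (q ^ (d - Suc j) * ?F' * (?g (Suc j) * ?g (Suc j + 1)))
      = (q ^ (d - Suc j) * (\<Prod>m\<in>?I. ?g m) * ?F') * (?g (Suc j) * ?g (Suc j + 1))"
    by (simp only: mult_ac)
  also have "\<dots> = ?F * ((\<Prod>m\<in>?I. ?g (m + 2)) * (?g (Suc j) * ?g (Suc j + 1)))"
    unfolding prods by (simp only: mult_ac)
  also have "\<dots> = (\<Prod>m\<in>?I. ?g m) * (?F * (?g d * ?g (d + 1)))"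
    unfolding tele by (simp only: mult_ac)
  finally have "q ^ (d - Suc j) * ?F' * (?g (Suc j) * ?g (Suc j + 1)) = ?F * (?g d * ?g (d + 1))"
  proof (subst (asm) mult_cancel_left, elim disjE)
    assume "(\<Prod>m\<in>?I. ?g m) = 0"
    moreover have "?g m \<noteq> 0" if "m \<in> ?I" for m by (rule ss_neq) (use that j in auto)
    ultimately show ?thesis by simp
  qed
  then have "q ^ (d - Suc j) * ?F' * ?g (Suc j) = ?F * (?g d * ?g (d + 1)) / ?g (Suc j + 1)"
    using odd_denominator[of "Suc j"] j False unfolding g by (simp add: field_simps)
  then have "q ^ (d - Suc j) * ?F' * ?g (Suc j) * (hs / q ^ j * (1 - q ^ j / q ^ d) * (1 - q ^ (j + 1)))
      = ?F * (?g d * ?g (d + 1)) / ?g (Suc j + 1) * (hs / q ^ j * (1 - q ^ j / q ^ d) * (1 - q ^ (j + 1)))"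
    by (rule arg_cong)
  moreover have "Vc (Suc j) = (1 - q ^ (j + 1)) * ?g (d + 1) / ?g (Suc j + 1)"
    unfolding Vc_def V_coeff_def g using False by simp
  ultimately show ?thesis
    unfolding F F' \<theta>s_diff[OF less_imp_le[OF j] order_refl] g by (simp add: mult_ac)
qed

lemma c_num_value:
  assumes j: "j < d"
  shows "c_num (Suc j) = h * Pc j * Vc (Suc j) / (ss * q ^ d)"
proof -
  let ?F = "\<lambda>j. \<Prod>l\<in>{j<..d}. \<theta>s j - \<theta>s l"
  have F: "?F j \<noteq> 0"
  proof -
    have "\<theta>s j - \<theta>s l \<noteq> 0" if "l \<in> {j<..d}" for l using inj_onD[OF \<theta>s_inj, of j l] that by auto
    then show ?thesis by simp
  qed
  have "d = (d - Suc j) + (j + 1)" using j by simp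
  then have qd: "q ^ d = q ^ (d - Suc j) * q ^ (j + 1)" by (metis power_add)
  have "c_num (Suc j) * ?F j = common j * (1 - ss * q ^ (2 * j + 2)) / ss * Pc j * ?F (Suc j)"
    using c_num_eq[OF j] unfolding \<phi>_P[OF j] .
  also have "\<dots> = h * Pc j / (ss * q ^ d) * (q ^ (d - Suc j) * ?F (Suc j) *
      (hs / q ^ j * (1 - q ^ j / q ^ d) * (1 - ss * q ^ (2 * j + 2)) * (1 - q ^ (j + 1))))"
  proof -
    have *: "common j = h / q ^ d * (q ^ (d - Suc j) * (hs / q ^ j * (1 - q ^ j / q ^ d) * (1 - q ^ (j + 1))))"
    proof -
      have "h * hs / q ^ (2 * j + 1) = h / q ^ d * (q ^ (d - Suc j) * (hs / q ^ j))"
        unfolding qd using nonzero by (simp add: power_add mult_2)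
      then show ?thesis unfolding common_def by (simp add: mult_ac)
    qed
    show ?thesis unfolding * by (simp add: mult_ac)
  qed
  also have "\<dots> = h * Pc j * Vc (Suc j) / (ss * q ^ d) * ?F j"
    unfolding \<theta>s_product_ratio[OF j] by (simp add: mult_ac)
  finally show ?thesis by (rule mult_right_cancel[OF F, THEN iffD1])
qed

lemma \<beta>_eq:
  assumes j: "j < d"
  shows "\<beta> (Suc j) = Vc (Suc j) / (1 - q ^ d)"
proof -
  have qd: "1 - q ^ d \<noteq> 0" using q_power_neq_1[of d] d_pos by simp
  have "complex_of_real (\<theta> 0) - complex_of_real (\<theta> d) = - h * (1 - q ^ d) * (1 - s * q ^ (d + 1)) / q ^ d"
    unfolding \<theta>_d_eq by simp
  also have "\<dots> = h * (1 - q ^ d) * (r1 * r2 - ss) / (ss * q ^ d)"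
    unfolding r1_r2 using nonzero by (simp add: field_simps)
  finally have \<theta>: "complex_of_real (\<theta> 0) - complex_of_real (\<theta> d) = h * (1 - q ^ d) * (r1 * r2 - ss) / (ss * q ^ d)" .
  have "Pc j \<noteq> 0" using \<alpha>_neq_0[OF j] \<alpha>_eq[OF j] by auto
  then show ?thesis
    unfolding \<beta>_def c_num_value[OF j] \<theta> using r_neq nonzero qd \<alpha>_eq[OF j] by simp
qed

text \<open>The dual eigenvalues of the clique are again of \<open>q\<close>-Racah form.\<close>

lemma \<theta>c_diff:
  assumes hts: "hts = (ss / q - r1 * r2) / (ss - r1 * r2) * hs" and i: "i < d"
  shows "\<theta>c i - \<theta>c 0 = hts * (1 / q ^ i + ss * q ^ (i + 2) - 1 - ss * q ^ 2)"
proof -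
  \<comment> \<open>Once the denominator of \<open>\<alpha>\<^sub>i\<close> has been cleared, everything is a Laurent polynomial in \<open>q\<^sup>i\<close>.\<close>
  have \<theta>c: "(r1 * r2 - ss) * \<theta>c i = (r1 * r2 - ss) * (\<theta>s 0 - hs - hs * ss * q) +
      hs * (r1 * r2 - ss) * (1 / q ^ (i + 1) + ss * q ^ (i + 2)) +
      (r1 - ss * q ^ (i + 1)) * (r2 - ss * q ^ (i + 1)) * hs * (1 - 1 / q) / q ^ i" if i: "i < d" for i
  proof -
    have "\<theta>s i - \<theta>s (Suc i) = hs / q ^ i * (1 - 1 / q) * (1 - ss * q ^ (2 * i + 2))"
      using \<theta>s_diff[of i "Suc i"] i nonzero by (simp add: mult_2)
    then have e1: "Pc i * (\<theta>s i - \<theta>s (Suc i)) = (r1 - ss * q ^ (i + 1)) * (r2 - ss * q ^ (i + 1)) * hs * (1 - 1 / q) / q ^ i"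
      unfolding P_coeff_def using even_denominator[OF i] by simp
    have e2: "(r1 * r2 - ss) * \<theta>c i = (r1 * r2 - ss) * \<theta>s (Suc i) + Pc i * (\<theta>s i - \<theta>s (Suc i))"
    proof -
      have "r * (p / r * a + (1 - p / r) * b) = r * b + p * (a - b)" if "r \<noteq> 0" for r p a b :: complex
        using that by (simp add: field_simps)
      from this[OF r_neq] show ?thesis unfolding \<theta>c_def \<alpha>_eq[OF i] .
    qed
    have e3: "\<theta>s (Suc i) = \<theta>s 0 - hs - hs * ss * q + hs * (1 / q ^ (i + 1) + ss * q ^ (i + 2))"
      using \<theta>s_eq[of "Suc i"] i nonzero by (simp add: field_simps power_add)
    show ?thesis unfolding e2 e1 unfolding e3 by (simp only: distrib_left mult_ac add_ac)
  qed
  have d0: "0 < d" using i by simp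
  have "(r1 * r2 - ss) * (\<theta>c i - \<theta>c 0) = (r1 * r2 - ss / q) * hs * (1 / q ^ i + ss * q ^ (i + 2) - 1 - ss * q ^ 2)"
    unfolding right_diff_distrib \<theta>c[OF i] \<theta>c[OF d0]
    using nonzero by (simp add: field_simps power_add power2_eq_square)
  then have "\<theta>c i - \<theta>c 0 = (r1 * r2 - ss / q) * hs * (1 / q ^ i + ss * q ^ (i + 2) - 1 - ss * q ^ 2) / (r1 * r2 - ss)"
    by (intro nonzero_eq_divide_eq[OF r_neq, THEN iffD2]) (simp only: mult.commute)
  moreover have "hts = (r1 * r2 - ss / q) * hs / (r1 * r2 - ss)"
    unfolding hts using r_neq by (simp add: divide_simps) (simp add: algebra_simps)
  ultimately show ?thesis by (simp only: times_divide_eq_left)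
qed

end

section \<open>Modules for the universal double affine Hecke algebra\<close>

lemma ring_daha_free_ring: "ring daha_free_ring"
proof (intro ringI abelian_groupI monoidI)
  fix x :: daha_free
  show "\<exists>y\<in>carrier daha_free_ring. y \<oplus>\<^bsub>daha_free_ring\<^esub> x = \<zero>\<^bsub>daha_free_ring\<^esub>"
    by (rule bexI[of _ "- x"]) (simp_all add: daha_free_ring_def)
qed (simp_all add: daha_free_ring_def algebra_simps)

lemma daha_relators_subset: "daha_relators qh \<subseteq> carrier daha_free_ring"
  by (simp add: daha_free_ring_def)

lemma ideal_daha_ideal: "ideal (daha_ideal qh) daha_free_ring"
  unfolding daha_ideal_def by (rule ring.genideal_ideal[OF ring_daha_free_ring daha_relators_subset])

lemma ring_daha: "ring (daha qh)"
  unfolding daha_def by (rule ideal.quotient_is_ring[OF ideal_daha_ideal])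

lemma daha_class_hom: "daha_class qh \<in> Ring.ring_hom daha_free_ring (daha qh)"
  using ideal.rcos_ring_hom[OF ideal_daha_ideal, of qh]
  by (simp add: daha_def daha_class_def[abs_def])

lemma daha_class_closed: "daha_class qh f \<in> carrier (daha qh)"
  and daha_class_mult: "daha_class qh (f * g) = daha_class qh f \<otimes>\<^bsub>daha qh\<^esub> daha_class qh g"
  and daha_class_add: "daha_class qh (f + g) = daha_class qh f \<oplus>\<^bsub>daha qh\<^esub> daha_class qh g"
  and daha_class_one: "daha_class qh 1 = \<one>\<^bsub>daha qh\<^esub>"
  using Ring.ring_hom_closed[OF daha_class_hom, of f qh] Ring.ring_hom_mult[OF daha_class_hom, of f g qh]
    Ring.ring_hom_add[OF daha_class_hom, of f g qh] Ring.ring_hom_one[OF daha_class_hom, of qh]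
  by (simp_all add: daha_free_ring_def)

text \<open>The relators vanish in the quotient, so that the generators are invertible there.\<close>

lemma daha_class_relator:
  assumes "f \<in> daha_relators qh" shows "daha_class qh f = \<zero>\<^bsub>daha qh\<^esub>"
proof -
  interpret ideal "daha_ideal qh" daha_free_ring by (rule ideal_daha_ideal)
  have "f \<in> daha_ideal qh"
    unfolding daha_ideal_def
    using ring.genideal_self[OF ring_daha_free_ring daha_relators_subset] assms by blast
  then show ?thesis
    unfolding daha_class_def daha_def by (simp add: FactRing_def a_rcos_const)
qed

lemma daha_class_eq_one:
  assumes "f - 1 \<in> daha_relators qh" shows "daha_class qh f = \<one>\<^bsub>daha qh\<^esub>"
proof -
  interpret ring "daha qh" by (rule ring_daha)
  have "daha_class qh f = daha_class qh ((f - 1) + 1)" by simp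
  also have "\<dots> = \<one>\<^bsub>daha qh\<^esub>"
    unfolding daha_class_add daha_class_relator[OF assms] daha_class_one by simp
  finally show ?thesis .
qed

lemma daha_t_Units: "daha_t qh n \<in> Units (daha qh)"
proof -
  have "daha_class qh (letter (Pos n)) \<otimes>\<^bsub>daha qh\<^esub> daha_class qh (letter (Neg n)) = \<one>\<^bsub>daha qh\<^esub>"
    "daha_class qh (letter (Neg n)) \<otimes>\<^bsub>daha qh\<^esub> daha_class qh (letter (Pos n)) = \<one>\<^bsub>daha qh\<^esub>"
    unfolding daha_class_mult[symmetric]
    by (rule daha_class_eq_one; auto simp: daha_relators_def)+
  then show ?thesis
    unfolding Units_def daha_t_def using daha_class_closed by blast
qed

text \<open>A module for the algebra on a subspace \<open>W\<close>.\<close>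

locale daha_module_action =
  fixes qh :: complex and W :: "(complex^'v) set" and act :: "daha_free set \<Rightarrow> complex^'v \<Rightarrow> complex^'v"
  assumes module: "daha_module qh W act"
begin

lemma subspace_W: "vec.subspace W"
  using module by (simp add: daha_module_def)

lemmas W_add = vec.subspace_add[OF subspace_W]
  and W_diff = vec.subspace_diff[OF subspace_W]
  and W_scale = vec.subspace_scale[OF subspace_W]

lemma act_closed: "a \<in> carrier (daha qh) \<Longrightarrow> w \<in> W \<Longrightarrow> act a w \<in> W"
  and act_add: "a \<in> carrier (daha qh) \<Longrightarrow> u \<in> W \<Longrightarrow> w \<in> W \<Longrightarrow> act a (u + w) = act a u + act a w"
  and act_scale: "a \<in> carrier (daha qh) \<Longrightarrow> w \<in> W \<Longrightarrow> act a (k *s w) = k *s act a w"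
  using module by (simp_all add: daha_module_def endo_on_def)

lemma act_ring_add: "a \<in> carrier (daha qh) \<Longrightarrow> b \<in> carrier (daha qh) \<Longrightarrow> w \<in> W \<Longrightarrow>
    act (a \<oplus>\<^bsub>daha qh\<^esub> b) w = act a w + act b w"
  and act_ring_mult: "a \<in> carrier (daha qh) \<Longrightarrow> b \<in> carrier (daha qh) \<Longrightarrow> w \<in> W \<Longrightarrow>
    act (a \<otimes>\<^bsub>daha qh\<^esub> b) w = act a (act b w)"
  using module by (simp_all add: daha_module_def)

lemma act_one: "w \<in> W \<Longrightarrow> act \<one>\<^bsub>daha qh\<^esub> w = w"
proof -
  assume w: "w \<in> W"
  have "free_const 1 = 1" by (simp add: free_const_def)
  then have "\<one>\<^bsub>daha qh\<^esub> = daha_class qh (free_const 1)" by (simp add: daha_class_one)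
  then show ?thesis using module w by (simp add: daha_module_def)
qed

lemma Units_carrier: "a \<in> Units (daha qh) \<Longrightarrow> a \<in> carrier (daha qh)"
  by (simp add: Units_def)

lemma Units_mult: "a \<in> Units (daha qh) \<Longrightarrow> b \<in> Units (daha qh) \<Longrightarrow> a \<otimes>\<^bsub>daha qh\<^esub> b \<in> Units (daha qh)"
  using monoid.Units_m_closed[OF ring.is_monoid[OF ring_daha]] by blast

text \<open>The inverse of \<open>a\<close> sends \<open>w\<close> to the preimage of \<open>w\<close>.\<close>

lemma act_plus_inverse:
  assumes a: "a \<in> Units (daha qh)" and w: "w \<in> W" and w': "w' \<in> W" "act a w' = w"
  shows "act (plus_inverse qh a) w = act a w + w'"
proof -
  interpret ring "daha qh" by (rule ring_daha)
  have "act (inv\<^bsub>daha qh\<^esub> a) w = act (inv\<^bsub>daha qh\<^esub> a \<otimes>\<^bsub>daha qh\<^esub> a) w'"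
    using a w' by (simp add: act_ring_mult Units_carrier del: Units_l_inv)
  also have "\<dots> = w'" using a w' by (simp add: act_one)
  finally show ?thesis using a w by (simp add: plus_inverse_def act_ring_add Units_carrier)
qed

lemma plus_inverse_closed: "a \<in> Units (daha qh) \<Longrightarrow> plus_inverse qh a \<in> carrier (daha qh)"
proof -
  interpret ring "daha qh" by (rule ring_daha)
  show "a \<in> Units (daha qh) \<Longrightarrow> plus_inverse qh a \<in> carrier (daha qh)" by (simp add: plus_inverse_def Units_carrier)
qed

lemma plus_inverse_eigenvector:
  assumes "a \<in> Units (daha qh)" "b \<in> Units (daha qh)" "u \<in> W"
    and "act a u = k *s u" "act b u = l *s u" "k * l \<noteq> 0"
  shows "act (plus_inverse qh (a \<otimes>\<^bsub>daha qh\<^esub> b)) u = (k * l + 1 / (k * l)) *s u"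
proof -
  have ab: "act (a \<otimes>\<^bsub>daha qh\<^esub> b) (m *s u) = (m * (k * l)) *s u" for m
    using assms by (simp add: act_ring_mult act_scale Units_carrier W_scale vector_smult_assoc mult_ac)
  have "act (plus_inverse qh (a \<otimes>\<^bsub>daha qh\<^esub> b)) u = act (a \<otimes>\<^bsub>daha qh\<^esub> b) u + (1 / (k * l)) *s u"
    using assms by (intro act_plus_inverse Units_mult W_scale) (simp_all add: ab)
  then show ?thesis using ab[of 1] by (simp add: Finite_Cartesian_Product.vec_eq_iff algebra_simps)
qed

text \<open>A product of two matrices of determinant one with respect to a pair of vectors has determinant
  one, so adding the inverse gives the trace.\<close>

lemma plus_inverse_pair:
  assumes U: "a \<in> Units (daha qh)" "b \<in> Units (daha qh)" and uv: "u \<in> W" "v \<in> W"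
    and a: "act a u = a11 *s u + a21 *s v" "act a v = a12 *s u + a22 *s v" "a11 * a22 - a12 * a21 = 1"
    and b: "act b u = b11 *s u + b21 *s v" "act b v = b12 *s u + b22 *s v" "b11 * b22 - b12 * b21 = 1"
    and t: "t = a11 * b11 + a12 * b21 + a21 * b12 + a22 * b22"
  shows "act (plus_inverse qh (a \<otimes>\<^bsub>daha qh\<^esub> b)) u = t *s u"
    and "act (plus_inverse qh (a \<otimes>\<^bsub>daha qh\<^esub> b)) v = t *s v"
proof -
  define c11 c12 c21 c22 where c: "c11 = a11 * b11 + a12 * b21" "c12 = a11 * b12 + a12 * b22"
    "c21 = a21 * b11 + a22 * b21" "c22 = a21 * b12 + a22 * b22"
  have "c11 * c22 - c12 * c21 = (a11 * a22 - a12 * a21) * (b11 * b22 - b12 * b21)"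
    by (simp add: c algebra_simps)
  then have det: "c11 * c22 - c12 * c21 = 1" using a b by simp
  have ab: "act (a \<otimes>\<^bsub>daha qh\<^esub> b) (m *s u + n *s v)
      = (m * c11 + n * c12) *s u + (m * c21 + n * c22) *s v" for m n
    using U uv a(1,2) b(1,2)
    by (simp add: act_ring_mult act_add act_scale Units_carrier W_scale W_add)
      (simp add: Finite_Cartesian_Product.vec_eq_iff c algebra_simps)
  have "act (plus_inverse qh (a \<otimes>\<^bsub>daha qh\<^esub> b)) u
      = act (a \<otimes>\<^bsub>daha qh\<^esub> b) u + (c22 *s u + (- c21) *s v)"
    using U uv
  proof (intro act_plus_inverse Units_mult W_add W_scale)
    have "c22 * c11 + - c21 * c12 = 1" using det by (simp add: algebra_simps)
    then show "act (a \<otimes>\<^bsub>daha qh\<^esub> b) (c22 *s u + (- c21) *s v) = u"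
      unfolding ab by (simp add: Finite_Cartesian_Product.vec_eq_iff algebra_simps)
  qed
  then show "act (plus_inverse qh (a \<otimes>\<^bsub>daha qh\<^esub> b)) u = t *s u"
    using ab[of 1 0] by (simp add: Finite_Cartesian_Product.vec_eq_iff algebra_simps c t)
  have "act (plus_inverse qh (a \<otimes>\<^bsub>daha qh\<^esub> b)) v
      = act (a \<otimes>\<^bsub>daha qh\<^esub> b) v + ((- c12) *s u + c11 *s v)"
    using U uv
  proof (intro act_plus_inverse Units_mult W_add W_scale)
    have "- c12 * c21 + c11 * c22 = 1" using det by (simp add: algebra_simps)
    then show "act (a \<otimes>\<^bsub>daha qh\<^esub> b) ((- c12) *s u + c11 *s v) = v"
      unfolding ab by (simp add: Finite_Cartesian_Product.vec_eq_iff algebra_simps)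
  qed
  then show "act (plus_inverse qh (a \<otimes>\<^bsub>daha qh\<^esub> b)) v = t *s v"
    using ab[of 0 1] by (simp add: Finite_Cartesian_Product.vec_eq_iff algebra_simps c t)
qed

end

lemma scale_divide_cancel: "c \<noteq> 0 \<Longrightarrow> (1 / c) *s ((a + c *s v) - a) = v" for c :: complex
  by (simp add: vector_smult_assoc)

lemma equal_on_span:
  assumes f: "\<And>u v. u \<in> vec.span S \<Longrightarrow> v \<in> vec.span S \<Longrightarrow> f (u + v) = f u + f v"
      "\<And>k u. u \<in> vec.span S \<Longrightarrow> f (k *s u) = k *s f u"
    and g: "\<And>u v. u \<in> vec.span S \<Longrightarrow> v \<in> vec.span S \<Longrightarrow> g (u + v) = g u + g v"
      "\<And>k u. u \<in> vec.span S \<Longrightarrow> g (k *s u) = k *s g u"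
    and eq: "\<And>u. u \<in> S \<Longrightarrow> f u = g u"
    and w: "w \<in> vec.span S"
  shows "f w = (g w :: complex^'v)"
proof -
  have "vec.subspace {u \<in> vec.span S. f u = g u}"
    unfolding vec.subspace_def
    using f(1) g(1) f(2)[OF vec.span_zero, of 0] g(2)[OF vec.span_zero, of 0]
    by (auto simp: f(2) g(2) vec.span_zero intro: vec.span_add vec.span_scale)
  then have "vec.span S \<subseteq> {u \<in> vec.span S. f u = g u}"
    by (intro vec.span_minimal) (auto simp: eq vec.span_base)
  then show ?thesis using w by blast
qed

section \<open>Block diagonal matrices\<close>

lemma sum_lessThan_add: "(\<Sum>i<m + n. g i) = (\<Sum>i<m. g i) + (\<Sum>i<n. g (m + i))"
  for g :: "nat \<Rightarrow> 'a :: comm_monoid_add"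
  by (induction n) (simp_all add: add.assoc)

lemma represents_four_block:
  assumes B: "B \<in> carrier_mat (length ws) (length ws)" and D: "D \<in> carrier_mat (length vs) (length vs)"
    and rep: "represents (four_block_mat B (0\<^sub>m (length ws) (length vs)) (0\<^sub>m (length vs) (length ws)) D) f (ws @ vs)"
  shows "represents B f ws" "represents D f vs"
proof -
  let ?N = "four_block_mat B (0\<^sub>m (length ws) (length vs)) (0\<^sub>m (length vs) (length ws)) D"
  have f: "f ((ws @ vs) ! j) = (\<Sum>i<length ws. (?N $$ (i, j)) *s (ws ! i))
      + (\<Sum>i<length vs. (?N $$ (length ws + i, j)) *s (vs ! i))" if "j < length ws + length vs" for j
    using rep that by (simp add: represents_def sum_lessThan_add nth_append)
  have "f (ws ! j) = (\<Sum>i<length ws. (B $$ (i, j)) *s (ws ! i))" if "j < length ws" for j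
    using f[of j] that B D by (simp add: nth_append)
  then show "represents B f ws" using B by (simp add: represents_def)
  have "f (vs ! j) = (\<Sum>i<length vs. (D $$ (i, j)) *s (vs ! i))" if "j < length vs" for j
    using f[of "length ws + j"] that B D by (simp add: nth_append)
  then show "represents D f vs" using D by (simp add: represents_def)
qed

lemma represents_diag_block:
  assumes "list_all2 (\<lambda>B ws. B \<in> carrier_mat (length ws) (length ws)) Bs wss"
    and "represents (diag_block_mat Bs) f (concat wss)"
  shows "list_all2 (\<lambda>B ws. represents B f ws) Bs wss"
  using assms
proof (induction rule: list_all2_induct)
  case (Cons B Bs ws wss)
  have dims: "dim_row (diag_block_mat Bs) = length (concat wss)" "dim_col (diag_block_mat Bs) = length (concat wss)"
    using Cons.hyps(2)
    by (induction rule: list_all2_induct) (auto simp: Let_def)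
  have "represents (four_block_mat B (0\<^sub>m (length ws) (length (concat wss)))
      (0\<^sub>m (length (concat wss)) (length ws)) (diag_block_mat Bs)) f (ws @ concat wss)"
    using Cons.prems Cons.hyps(1) dims by (simp add: Let_def)
  from represents_four_block[OF Cons.hyps(1) _ this] dims Cons.IH
  show ?case by auto
qed simp

lemma represents_diag_block_map:
  assumes "represents (diag_block_mat (map B [0..<n])) f (concat (map ws [0..<n]))"
    and "\<And>i. i < n \<Longrightarrow> B i \<in> carrier_mat (length (ws i)) (length (ws i))"
    and "i < n"
  shows "represents (B i) f (ws i)"
proof -
  have "list_all2 (\<lambda>B ws. represents B f ws) (map B [0..<n]) (map ws [0..<n])"
    using assms(1,2) by (intro represents_diag_block) (auto simp: list_all2_conv_all_nth)
  then show ?thesis using assms(3) by (auto simp: list_all2_conv_all_nth)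
qed

lemma represents_1:
  "represents (mat_of_rows_list 1 [[a]]) f [u] \<Longrightarrow> f u = a *s u"
  by (simp add: represents_def mat_of_rows_list_def)

lemma represents_2:
  assumes "represents (mat_of_rows_list 2 [[a, b], [c, e]]) f [u, v]"
  shows "f u = a *s u + c *s v" "f v = b *s u + e *s v"
proof -
  have *: "f ([u, v] ! j) = (\<Sum>i<2. (mat_of_rows_list 2 [[a, b], [c, e]] $$ (i, j)) *s ([u, v] ! i))" if "j < 2" for j
    using assms that by (simp add: represents_def numeral_2_eq_2)
  show "f u = a *s u + c *s v" "f v = b *s u + e *s v"
    using *[of 0] *[of 1] by (simp_all add: mat_of_rows_list_def numeral_2_eq_2)
qed

text \<open>The basis is cut into pairs in two ways, the second one shifted by one position.\<close>

lemma concat_regroup: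
  assumes "d \<ge> 1"
  shows "concat (map (\<lambda>i. [m i, p i]) [0..<d]) =
    concat (map (\<lambda>i. if i = 0 then [m 0] else if i = d then [p (d - 1)] else [p (i - 1), m i]) [0..<d + 1])"
proof -
  have "concat (map (\<lambda>i. [m i, p i]) [0..<n]) @ [m n] =
      concat (map (\<lambda>i. if i = 0 then [m 0] else [p (i - 1), m i]) [0..<Suc n])" for n
    by (induction n) simp_all
  from this[of "d - 1"] have "concat (map (\<lambda>i. [m i, p i]) [0..<d - 1]) @ [m (d - 1)] =
      concat (map (\<lambda>i. if i = 0 then [m 0] else [p (i - 1), m i]) [0..<d])"
    using assms by simp
  also have "\<dots> = concat (map (\<lambda>i. if i = 0 then [m 0] else if i = d then [p (d - 1)] else [p (i - 1), m i]) [0..<d])"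
    by (intro arg_cong[where f = concat] map_cong refl) auto
  finally have *: "concat (map (\<lambda>i. [m i, p i]) [0..<d - 1]) @ [m (d - 1)] = \<dots>" .
  have "[0..<d] = [0..<d - 1] @ [d - 1]" using assms upt_Suc_append[of 0 "d - 1"] by simp
  then have "concat (map (\<lambda>i. [m i, p i]) [0..<d]) =
      (concat (map (\<lambda>i. [m i, p i]) [0..<d - 1]) @ [m (d - 1)]) @ [p (d - 1)]" by simp
  then show ?thesis unfolding * using assms by simp
qed

section \<open>The action on the blocks\<close>

text \<open>The module on the span of the vectors of \<open>C\<^sub>i\<^sup>-\<close> and \<open>C\<^sub>i\<^sup>+\<close> in which the generators act by the given
  block diagonal matrices.\<close>

locale clique_daha_module =
  q_racah_clique adj d E \<theta> C x As \<theta>s \<phi>v \<phi> q h hs s ss r1 r2 +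
  daha_module_action qh "W_space adj C x" act
  for adj :: "'v::finite \<Rightarrow> 'v \<Rightarrow> bool" and d E \<theta> C x As \<theta>s \<phi>v \<phi> q h hs s ss r1 r2
    and qh :: complex and act :: "daha_free set \<Rightarrow> complex^'v \<Rightarrow> complex^'v" +
  fixes sh ssh r1h r2h :: complex
  assumes roots: "qh\<^sup>2 = q" "sh\<^sup>2 = s" "ssh\<^sup>2 = ss" "r1h\<^sup>2 = r1" "r2h\<^sup>2 = r2"
    "r1h * r2h = sh * ssh * qh ^ (d + 1)"
    and rep: "represents (daha_matrix d qh ssh r1h r2h n) (act (daha_t qh n)) (W_basis adj C x)"
begin

abbreviation W where "W \<equiv> W_space adj C x"
abbreviation t where "t n \<equiv> act (daha_t qh n)"

text \<open>The scalars \<open>\<rho>\<close>, \<open>k\<^sub>0\<close> and \<open>k\<^sub>1\<close>; the two latter will turn out to be the eigenvalues of \<open>t\<^sub>0\<close> and \<open>t\<^sub>1\<close> on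
  the images of \<open>Q\<close> and \<open>P\<close>.\<close>

definition \<rho> where "\<rho> = r1h * r2h"
definition k0 where "k0 = \<rho> / ssh"
definition k1 where "k1 = 1 / qh ^ d"

lemma roots_neq_0: "qh \<noteq> 0" "sh \<noteq> 0" "ssh \<noteq> 0" "\<rho> \<noteq> 0"
  using nonzero roots unfolding \<rho>_def by auto

lemma \<rho>_square: "\<rho>\<^sup>2 = r1 * r2"
  unfolding \<rho>_def power_mult_distrib roots(4,5) ..

lemma set_W_basis: "set (W_basis adj C x) = (\<Union>i<d. {Cm i, Cp i})"
  by (simp add: W_basis_def d_eq atLeast0LessThan)

lemma Cm_W: "i < d \<Longrightarrow> Cm i \<in> W" and Cp_W: "i < d \<Longrightarrow> Cp i \<in> W"
  unfolding W_space_def set_W_basis by (auto intro!: vec.span_base)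

lemma W_eqI:
  assumes "\<And>u v. u \<in> W \<Longrightarrow> v \<in> W \<Longrightarrow> f (u + v) = f u + f v" "\<And>k u. u \<in> W \<Longrightarrow> f (k *s u) = k *s f u"
    and "\<And>u v. u \<in> W \<Longrightarrow> v \<in> W \<Longrightarrow> g (u + v) = g u + g v" "\<And>k u. u \<in> W \<Longrightarrow> g (k *s u) = k *s g u"
    and "\<And>i. i < d \<Longrightarrow> f (Cm i) = g (Cm i)" "\<And>i. i < d \<Longrightarrow> f (Cp i) = g (Cp i)"
    and "w \<in> W"
  shows "f w = g w"
  using assms(7) unfolding W_space_def
proof (rule equal_on_span[rotated -1])
  show "f u = g u" if "u \<in> set (W_basis adj C x)" for u
    using that assms(5,6) unfolding set_W_basis by auto
qed (use assms(1-4) in \<open>simp_all add: W_space_def\<close>)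

lemma affine_add: "a *s (M *v (u + v) - b *s (u + v)) = a *s (M *v u - b *s u) + a *s (M *v v - b *s v)"
  and affine_scale: "a *s (M *v (k *s u) - b *s (k *s u)) = k *s (a *s (M *v u - b *s u))"
  for M :: "complex^'v^'v"
  by (simp_all add: vec.add vec.scale Finite_Cartesian_Product.vec_eq_iff algebra_simps)

lemma t_closed: "w \<in> W \<Longrightarrow> t n w \<in> W"
  and t_add: "u \<in> W \<Longrightarrow> w \<in> W \<Longrightarrow> t n (u + w) = t n u + t n w"
  and t_scale: "w \<in> W \<Longrightarrow> t n (k *s w) = k *s t n w"
  using act_closed act_add act_scale Units_carrier[OF daha_t_Units] by auto

lemma W_basis_pairs: "W_basis adj C x = concat (map (\<lambda>i. [Cm i, Cp i]) [0..<d])"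
  by (simp add: W_basis_def d_eq)

abbreviation regrouped where "regrouped i \<equiv> (if i = 0 then [Cm 0]
    else if i = d then [Cp (d - 1)] else [Cp (i - 1), Cm i])"

lemma W_basis_regroup: "W_basis adj C x = concat (map regrouped [0..<d + 1])"
  unfolding W_basis_pairs by (rule concat_regroup[OF d_pos])

lemma block_carriers:
  "t0_block q ssh \<rho> r1 r2 i \<in> carrier_mat 2 2" "t3_block q ssh \<rho> r1 r2 i \<in> carrier_mat 2 2"
  "t1_block d qh ssh i \<in> (if i = 0 \<or> i = d then carrier_mat 1 1 else carrier_mat 2 2)"
  "t2_block d qh ssh i \<in> (if i = 0 \<or> i = d then carrier_mat 1 1 else carrier_mat 2 2)"
  by (simp_all add: t0_block_def t1_block_def t2_block_def t3_block_def Let_def mat_of_rows_list_def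
      numeral_2_eq_2)

lemma t0_represents: "i < d \<Longrightarrow> represents (t0_block q ssh \<rho> r1 r2 i) (t T0) [Cm i, Cp i]"
  and t3_represents: "i < d \<Longrightarrow> represents (t3_block q ssh \<rho> r1 r2 i) (t T3) [Cm i, Cp i]"
  using rep[of T0] rep[of T3] block_carriers(1,2)
  unfolding daha_matrix.simps roots(1,4,5) \<rho>_def[symmetric] W_basis_pairs
  by (simp_all add: represents_diag_block_map[where ws = "\<lambda>i. [Cm i, Cp i]"] numeral_2_eq_2)

lemma t1_represents: "i \<le> d \<Longrightarrow> represents (t1_block d qh ssh i) (t T1) (regrouped i)"
  and t2_represents: "i \<le> d \<Longrightarrow> represents (t2_block d qh ssh i) (t T2) (regrouped i)"
proof -
  have carrier: "t1_block d qh ssh i \<in> carrier_mat (length (regrouped i)) (length (regrouped i))"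
    "t2_block d qh ssh i \<in> carrier_mat (length (regrouped i)) (length (regrouped i))" for i
    using block_carriers(3,4)[of i] by (auto simp: numeral_2_eq_2 split: if_splits)
  assume "i \<le> d"
  then have i: "i < d + 1" by simp
  show "represents (t1_block d qh ssh i) (t T1) (regrouped i)"
    by (rule represents_diag_block_map[OF _ carrier(1) i])
      (use rep[of T1] in \<open>simp only: daha_matrix.simps W_basis_regroup\<close>)
  show "represents (t2_block d qh ssh i) (t T2) (regrouped i)"
    by (rule represents_diag_block_map[OF _ carrier(2) i])
      (use rep[of T2] in \<open>simp only: daha_matrix.simps W_basis_regroup\<close>)
qed

lemma t0_pair:
  assumes "i < d"
  shows "t T0 (Cm i) = ((Pc i + ss) / (ssh * \<rho>)) *s Cm i + (Pc i / (ssh * \<rho>)) *s Cp i"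
    and "t T0 (Cp i) = (- (ssh / \<rho>) * Rc i) *s Cm i + (ssh / \<rho> * (1 - Rc i)) *s Cp i"
  using represents_2[OF t0_represents[OF assms, unfolded t0_block_def Let_def roots]] by blast+

lemma t3_pair:
  assumes "i < d"
  shows "t T3 (Cm i) = ((1 - Rc i) / (q ^ (i + 1) * \<rho>)) *s Cm i + (- (q ^ (i + 1) / \<rho>) * Pc i) *s Cp i"
    and "t T3 (Cp i) = (Rc i / (q ^ (i + 1) * \<rho>)) *s Cm i + (q ^ (i + 1) / \<rho> * (Pc i + ss)) *s Cp i"
  using represents_2[OF t3_represents[OF assms, unfolded t3_block_def Let_def roots]] by blast+

abbreviation Uc where "Uc \<equiv> U_coeff d q ss"
abbreviation Vi where "Vi \<equiv> V_coeff d q ss"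
abbreviation Zc where "Zc \<equiv> Z_coeff d q ss"
abbreviation \<kappa> where "\<kappa> \<equiv> ssh * qh ^ (d + 1)"

lemma t1_pair:
  assumes "i \<in> {1..<d}"
  shows "t T1 (Cp (i - 1)) = (qh ^ d * Uc i + 1 / qh ^ d) *s Cp (i - 1) + (1 / qh ^ d * Vi i) *s Cm i"
    and "t T1 (Cm i) = (- (qh ^ d) * Uc i) *s Cp (i - 1) + (1 / qh ^ d * (1 - Vi i)) *s Cm i"
proof -
  have "represents (mat_of_rows_list 2 [[qh ^ d * Uc i + 1 / qh ^ d, - (qh ^ d) * Uc i],
           [1 / qh ^ d * Vi i, 1 / qh ^ d * (1 - Vi i)]]) (t T1) [Cp (i - 1), Cm i]"
    using t1_represents[of i] assms unfolding t1_block_def Let_def roots by simp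
  from represents_2[OF this]
  show "t T1 (Cp (i - 1)) = (qh ^ d * Uc i + 1 / qh ^ d) *s Cp (i - 1) + (1 / qh ^ d * Vi i) *s Cm i"
    "t T1 (Cm i) = (- (qh ^ d) * Uc i) *s Cp (i - 1) + (1 / qh ^ d * (1 - Vi i)) *s Cm i" by blast+
qed

lemma t2_pair:
  assumes "i \<in> {1..<d}"
  shows "t T2 (Cp (i - 1)) = ((\<kappa>\<^sup>2 * Zc i + 1) / \<kappa>) *s Cp (i - 1) + (- (Vi i / (q ^ i * \<kappa>))) *s Cm i"
    and "t T2 (Cm i) = (q ^ i * \<kappa> * Uc i) *s Cp (i - 1) + (\<kappa> * (1 - Zc i)) *s Cm i"
proof -
  have "represents (mat_of_rows_list 2 [[(\<kappa>\<^sup>2 * Zc i + 1) / \<kappa>, q ^ i * \<kappa> * Uc i],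
           [- (Vi i / (q ^ i * \<kappa>)), \<kappa> * (1 - Zc i)]]) (t T2) [Cp (i - 1), Cm i]"
    using t2_represents[of i] assms unfolding t2_block_def Let_def roots by simp
  from represents_2[OF this]
  show "t T2 (Cp (i - 1)) = ((\<kappa>\<^sup>2 * Zc i + 1) / \<kappa>) *s Cp (i - 1) + (- (Vi i / (q ^ i * \<kappa>))) *s Cm i"
    "t T2 (Cm i) = (q ^ i * \<kappa> * Uc i) *s Cp (i - 1) + (\<kappa> * (1 - Zc i)) *s Cm i" by blast+
qed

lemma t1_ends: "t T1 (Cm 0) = k1 *s Cm 0" "t T1 (Cp (d - 1)) = k1 *s Cp (d - 1)"
  and t2_ends: "t T2 (Cm 0) = \<kappa> *s Cm 0" "t T2 (Cp (d - 1)) = (1 / \<kappa>) *s Cp (d - 1)"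
  using t1_represents[of 0] t1_represents[of d] t2_represents[of 0] t2_represents[of d] d_pos
  unfolding t1_block_def t2_block_def Let_def k1_def by (auto intro!: represents_1)

section \<open>The generators and the two projections\<close>

lemma k0_diff: "k0 - 1 / k0 = (r1 * r2 - ss) / (ssh * \<rho>)"
  unfolding k0_def \<rho>_square[symmetric] roots(3)[symmetric] using roots_neq_0
  by (simp add: field_simps power2_eq_square)

lemma k0_diff_neq_0: "k0 - 1 / k0 \<noteq> 0"
  unfolding k0_diff using r_neq roots_neq_0 by simp

lemma qh_power: "qh ^ d * qh ^ d = q ^ d"
  by (simp add: roots(1)[symmetric] power_mult_distrib[symmetric] power2_eq_square)

lemma k1_diff: "k1 - 1 / k1 = (1 - q ^ d) / qh ^ d"
  unfolding k1_def qh_power[symmetric] using roots_neq_0 by (simp add: field_simps)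

lemma k1_diff_neq_0: "k1 - 1 / k1 \<noteq> 0"
  unfolding k1_diff using q_power_neq_1[of d] d_pos roots_neq_0 by simp

text \<open>The eigenvalues of \<open>t\<^sub>0\<close> are \<open>k\<^sub>0\<close> on the module of the clique and \<open>1 / k\<^sub>0\<close> on its complement.\<close>

lemma t0_Q: "w \<in> W \<Longrightarrow> t T0 w = (1 / k0) *s w + (k0 - 1 / k0) *s Q w"
proof (rule W_eqI[of "t T0" "\<lambda>w. (1 / k0) *s w + (k0 - 1 / k0) *s Q w"])
  fix i assume i: "i < d"
  have k0: "1 / k0 = ssh / \<rho>" by (simp add: k0_def)
  have a: "(k0 - 1 / k0) * \<alpha> i = Pc i / (ssh * \<rho>)"
    unfolding k0_diff \<alpha>_eq[OF i] using r_neq by simp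
  have b: "(k0 - 1 / k0) * (1 - \<alpha> i) = - (ssh / \<rho>) * Rc i"
    unfolding k0_diff one_minus_\<alpha>[OF i] using r_neq roots_neq_0
    by (simp add: roots(3)[symmetric] power2_eq_square)
  have c: "(Pc i + ss) / (ssh * \<rho>) = ssh / \<rho> + Pc i / (ssh * \<rho>)"
    using roots_neq_0 by (simp add: roots(3)[symmetric] field_simps power2_eq_square)
  have "t T0 (Cm i) = (1 / k0) *s Cm i + ((k0 - 1 / k0) * \<alpha> i) *s (Cm i + Cp i)"
    unfolding a unfolding k0 t0_pair(1)[OF i] c
    by (simp add: Finite_Cartesian_Product.vec_eq_iff algebra_simps)
  then show "t T0 (Cm i) = (1 / k0) *s Cm i + (k0 - 1 / k0) *s Q (Cm i)"
    unfolding Q_Cm Ci_eq vector_smult_assoc .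
  have "t T0 (Cp i) = (1 / k0) *s Cp i + ((k0 - 1 / k0) * (1 - \<alpha> i)) *s (Cm i + Cp i)"
    unfolding b unfolding k0 t0_pair(2)[OF i]
    by (simp add: Finite_Cartesian_Product.vec_eq_iff algebra_simps)
  then show "t T0 (Cp i) = (1 / k0) *s Cp i + (k0 - 1 / k0) *s Q (Cp i)"
    unfolding Q_Cp Ci_eq vector_smult_assoc .
qed (simp_all add: t_add t_scale fibre_avg_add fibre_avg_scale Finite_Cartesian_Product.vec_eq_iff algebra_simps)

lemma t1_P: "w \<in> W \<Longrightarrow> t T1 w = (1 / k1) *s w + (k1 - 1 / k1) *s P w"
proof (rule W_eqI[of "t T1" "\<lambda>w. (1 / k1) *s w + (k1 - 1 / k1) *s P w"])
  have k1: "1 / k1 = qh ^ d" by (simp add: k1_def)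
  have qd: "1 - q ^ d \<noteq> 0" using q_power_neq_1[of d] d_pos by simp
  have pair: "t T1 (Cp (i - 1)) = (1 / k1) *s Cp (i - 1) + (k1 - 1 / k1) *s P (Cp (i - 1)) \<and>
    t T1 (Cm i) = (1 / k1) *s Cm i + (k1 - 1 / k1) *s P (Cm i)" if i: "i \<in> {1..<d}" for i
  proof -
    obtain j where j: "i = Suc j" "j < d" using i by (cases i) auto
    have beta: "\<beta> i = Vi i / (1 - q ^ d)" using \<beta>_eq[OF j(2)] i j by (simp add: Vc_def)
    have a: "(k1 - 1 / k1) * \<beta> i = 1 / qh ^ d * Vi i" unfolding k1_diff beta using qd by simp
    have b: "(k1 - 1 / k1) * (1 - \<beta> i) = (1 - q ^ d - Vi i) / qh ^ d"
    proof -
      have "c / g * (1 - v / c) = (c - v) / g" if "c \<noteq> 0" for c g v :: complex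
        using that by (simp add: right_diff_distrib diff_divide_distrib)
      from this[OF qd] show ?thesis unfolding k1_diff beta .
    qed
    have UV: "qh ^ d * qh ^ d * Uc i = Vi i - (1 - qh ^ d * qh ^ d)"
      unfolding qh_power by (rule U_V_relation[OF nonzero(1) odd_denominator[OF i]])
    have c: "qh ^ d * Uc i + 1 / qh ^ d = qh ^ d + 1 / qh ^ d * Vi i"
      "- (qh ^ d) * Uc i = (1 - q ^ d - Vi i) / qh ^ d"
      "1 / qh ^ d * (1 - Vi i) = qh ^ d + (1 - q ^ d - Vi i) / qh ^ d"
      using UV roots_neq_0 unfolding qh_power[symmetric] by (simp_all add: field_simps)
    have "t T1 (Cp (i - 1)) = (1 / k1) *s Cp (i - 1) + ((k1 - 1 / k1) * \<beta> i) *s (Cm i + Cp (i - 1))"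
      unfolding a unfolding k1 t1_pair(1)[OF i] c(1)
      by (simp add: Finite_Cartesian_Product.vec_eq_iff algebra_simps)
    moreover have "t T1 (Cm i) = (1 / k1) *s Cm i + ((k1 - 1 / k1) * (1 - \<beta> i)) *s (Cm i + Cp (i - 1))"
      unfolding b unfolding k1 t1_pair(2)[OF i] c(2,3)
      by (simp add: Finite_Cartesian_Product.vec_eq_iff algebra_simps)
    moreover have "i - 1 = j" using j by simp
    ultimately show ?thesis
      unfolding j(1) P_Cm[OF \<alpha>_neq_0[OF j(2)]] diff_Suc_1 P_Cp[OF \<alpha>_neq_0[OF j(2)]] Gi_Suc vector_smult_assoc
      by simp
  qed
  fix i assume i: "i < d"
  show "t T1 (Cm i) = (1 / k1) *s Cm i + (k1 - 1 / k1) *s P (Cm i)"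
  proof (cases "i = 0")
    case True
    then show ?thesis
      by (simp add: t1_ends P_Cm_0 Finite_Cartesian_Product.vec_eq_iff algebra_simps)
  next
    case False
    then show ?thesis using pair[of i] i by simp
  qed
  show "t T1 (Cp i) = (1 / k1) *s Cp i + (k1 - 1 / k1) *s P (Cp i)"
  proof (cases "Suc i = d")
    case True
    have "Cp i = Gi d" unfolding True[symmetric] Gi_Suc using Cm_d True by simp
    then have "P (Cp i) = Cp i" using fibre_avg_id[OF Gi_radial[of d]] by simp
    moreover have "i = d - 1" using True by simp
    ultimately show ?thesis
      using t1_ends(2) by (simp add: Finite_Cartesian_Product.vec_eq_iff algebra_simps)
  next
    case False
    then show ?thesis using pair[of "Suc i"] i by simp
  qed
qed (simp_all add: t_add t_scale fibre_avg_add fibre_avg_scale Finite_Cartesian_Product.vec_eq_iff algebra_simps)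

lemma Q_closed: "w \<in> W \<Longrightarrow> Q w \<in> W"
proof -
  assume w: "w \<in> W"
  have "Q w = (1 / (k0 - 1 / k0)) *s (t T0 w - (1 / k0) *s w)"
    unfolding t0_Q[OF w] by (rule scale_divide_cancel[OF k0_diff_neq_0, symmetric])
  then show ?thesis using w by (simp add: W_scale W_diff t_closed)
qed

lemma P_closed: "w \<in> W \<Longrightarrow> P w \<in> W"
proof -
  assume w: "w \<in> W"
  have "P w = (1 / (k1 - 1 / k1)) *s (t T1 w - (1 / k1) *s w)"
    unfolding t1_P[OF w] by (rule scale_divide_cancel[OF k1_diff_neq_0, symmetric])
  then show ?thesis using w by (simp add: W_scale W_diff t_closed)
qed

lemma Q_Q: "Q (Q w) = Q w" and P_P: "P (P w) = P w"
  by (rule fibre_avg_id[OF fibre_avg_in])+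

lemma k_neq_0: "k0 \<noteq> 0" "k1 \<noteq> 0"
  unfolding k0_def k1_def using roots_neq_0 by auto

lemma t0_inverse:
  assumes "w \<in> W"
  shows "k0 *s w - (k0 - 1 / k0) *s Q w \<in> W" "t T0 (k0 *s w - (k0 - 1 / k0) *s Q w) = w"
proof -
  show *: "k0 *s w - (k0 - 1 / k0) *s Q w \<in> W" using assms by (intro W_diff W_scale Q_closed)
  show "t T0 (k0 *s w - (k0 - 1 / k0) *s Q w) = w"
    unfolding t0_Q[OF *] fibre_avg_diff fibre_avg_scale Q_Q
    using k_neq_0 by (simp add: Finite_Cartesian_Product.vec_eq_iff field_simps)
qed

lemma t1_inverse:
  assumes "w \<in> W"
  shows "k1 *s w - (k1 - 1 / k1) *s P w \<in> W" "t T1 (k1 *s w - (k1 - 1 / k1) *s P w) = w"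
proof -
  show *: "k1 *s w - (k1 - 1 / k1) *s P w \<in> W" using assms by (intro W_diff W_scale P_closed)
  show "t T1 (k1 *s w - (k1 - 1 / k1) *s P w) = w"
    unfolding t1_P[OF *] fibre_avg_diff fibre_avg_scale P_P
    using k_neq_0 by (simp add: Finite_Cartesian_Product.vec_eq_iff field_simps)
qed

section \<open>The adjacency matrix\<close>

lemma daha_A_closed: "daha_A qh \<in> carrier (daha qh)"
  unfolding daha_A_def by (intro plus_inverse_closed Units_mult daha_t_Units)

text \<open>Interchanging \<open>k\<^sub>0\<close> with \<open>1 / k\<^sub>0\<close> and \<open>k\<^sub>1\<close> with \<open>1 / k\<^sub>1\<close> inverts \<open>t\<^sub>0\<close> and \<open>t\<^sub>1\<close>.\<close>

lemma daha_A_act: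
  assumes w: "w \<in> W"
  shows "act (daha_A qh) w = t T0 (t T1 w) +
    (k1 *s (k0 *s w - (k0 - 1 / k0) *s Q w) - (k1 - 1 / k1) *s P (k0 *s w - (k0 - 1 / k0) *s Q w))"
proof -
  note u = t0_inverse[OF w] and v = t1_inverse[OF t0_inverse(1)[OF w]]
  have "act (daha_A qh) w = act (daha_t qh T0 \<otimes>\<^bsub>daha qh\<^esub> daha_t qh T1) w +
    (k1 *s (k0 *s w - (k0 - 1 / k0) *s Q w) - (k1 - 1 / k1) *s P (k0 *s w - (k0 - 1 / k0) *s Q w))"
    unfolding daha_A_def
  proof (rule act_plus_inverse[OF Units_mult[OF daha_t_Units daha_t_Units] w v(1)])
    show "act (daha_t qh T0 \<otimes>\<^bsub>daha qh\<^esub> daha_t qh T1)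
      (k1 *s (k0 *s w - (k0 - 1 / k0) *s Q w) - (k1 - 1 / k1) *s P (k0 *s w - (k0 - 1 / k0) *s Q w)) = w"
      unfolding act_ring_mult[OF Units_carrier[OF daha_t_Units] Units_carrier[OF daha_t_Units] v(1)] v(2) u(2) ..
  qed
  then show ?thesis using w by (simp add: act_ring_mult Units_carrier daha_t_Units)
qed

abbreviation k_const where "k_const \<equiv> k1 / k0 + k0 / k1"
abbreviation k_coeff where "k_coeff \<equiv> (k0 - 1 / k0) * (k1 - 1 / k1)"

text \<open>On the primary module \<open>P\<close> is the identity, and all terms except the scalars and \<open>P Q\<close> cancel; on
  the module of the clique the same happens with \<open>Q P\<close>.\<close>

lemma daha_A_radial:
  assumes w: "w \<in> W" "w \<in> radial"
  shows "act (daha_A qh) w = k_const *s w + k_coeff *s P (Q w)"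
proof -
  have Pw: "P w = w" by (rule fibre_avg_id[OF w(2)])
  have "t T1 w = k1 *s w"
    unfolding t1_P[OF w(1)] Pw by (simp add: Finite_Cartesian_Product.vec_eq_iff algebra_simps)
  then have "t T0 (t T1 w) = k1 *s ((1 / k0) *s w + (k0 - 1 / k0) *s Q w)"
    by (simp add: t_scale[OF w(1)] t0_Q[OF w(1)])
  then show ?thesis
    unfolding daha_A_act[OF w(1)] fibre_avg_diff fibre_avg_scale Pw
    using k_neq_0 by (simp add: Finite_Cartesian_Product.vec_eq_iff) (simp add: field_simps)
qed

lemma daha_A_clique_radial:
  assumes w: "w \<in> W" "w \<in> clique_radial"
  shows "act (daha_A qh) w = k_const *s w + k_coeff *s Q (P w)"
proof -
  have Qw: "Q w = w" by (rule fibre_avg_id[OF w(2)])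
  have t1w: "t T1 w \<in> W" by (rule t_closed[OF w(1)])
  have "t T0 (t T1 w) = (1 / k0) *s ((1 / k1) *s w + (k1 - 1 / k1) *s P w)
      + (k0 - 1 / k0) *s ((1 / k1) *s w + (k1 - 1 / k1) *s Q (P w))"
    unfolding t0_Q[OF t1w] unfolding t1_P[OF w(1)] fibre_avg_add fibre_avg_scale Qw ..
  then show ?thesis
    unfolding daha_A_act[OF w(1)] fibre_avg_diff fibre_avg_scale Qw
    using k_neq_0 by (simp add: Finite_Cartesian_Product.vec_eq_iff) (simp add: field_simps)
qed

lemma adjacency_scalars:
  assumes PQ: "v = (1 / (complex_of_real (\<theta> 0) - complex_of_real (\<theta> d))) *s (A *v w - complex_of_real (\<theta> d) *s w)"
  shows "k_const *s w + k_coeff *s v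
    = (1 / (h * (sh * qh))) *s (A *v w - (complex_of_real (\<theta> 0) - h - h * s * q) *s w)"
proof -
  define g where "g = qh ^ d"
  have g: "g \<noteq> 0" "q ^ d = g\<^sup>2" "q ^ (d + 1) = g\<^sup>2 * qh\<^sup>2"
    unfolding g_def using roots_neq_0 by (simp_all add: roots(1)[symmetric] power_mult[symmetric] power_add[symmetric] mult.commute flip: power_Suc)
  have k0: "k0 = sh * (g * qh)" unfolding k0_def \<rho>_def roots(6) g_def using roots_neq_0 by simp
  have k1: "k1 = 1 / g" by (simp add: k1_def g_def)
  have \<theta>d: "complex_of_real (\<theta> 0) - complex_of_real (\<theta> d) = - (h * (1 - g\<^sup>2) * (1 - sh\<^sup>2 * (g\<^sup>2 * qh\<^sup>2)) / g\<^sup>2)"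
    unfolding \<theta>_d_eq g(2,3) roots(2) by simp
  have coeff: "k_coeff = (complex_of_real (\<theta> 0) - complex_of_real (\<theta> d)) / (h * (sh * qh))"
    unfolding \<theta>d k0 k1 using g(1) roots_neq_0 nonzero by (simp add: divide_simps) (simp add: algebra_simps power2_eq_square)
  have const: "k_const = (complex_of_real (\<theta> d) - (complex_of_real (\<theta> 0) - h - h * s * q)) / (h * (sh * qh))"
  proof -
    have "complex_of_real (\<theta> d) - (complex_of_real (\<theta> 0) - h - h * s * q)
        = h + h * sh\<^sup>2 * qh\<^sup>2 - (complex_of_real (\<theta> 0) - complex_of_real (\<theta> d))"
      by (simp add: roots)
    then show ?thesis
      unfolding \<theta>d k0 k1 using g(1) roots_neq_0 nonzero by (simp add: divide_simps) (simp add: algebra_simps power2_eq_square)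
  qed
  have v: "k_coeff *s v = (1 / (h * (sh * qh))) *s (A *v w - complex_of_real (\<theta> d) *s w)"
    unfolding PQ coeff vector_smult_assoc using \<theta>_0_neq_\<theta>_d by simp
  have combine: "((a - b) / c) *s u + (1 / c) *s (u' - a *s u) = (1 / c) *s (u' - b *s u)"
    for a b c :: complex and u u' :: "complex^'v"
    by (simp add: Finite_Cartesian_Product.vec_eq_iff diff_divide_distrib add_divide_distrib algebra_simps)
  show ?thesis unfolding v unfolding const by (rule combine)
qed

text \<open>Each basis vector of the space is an alternating sum of vectors of the two modules, because
  consecutive basis vectors add up to a sphere about \<open>x\<close> or to some \<open>C\<^sub>i\<close>.\<close>

lemma daha_A_eq:
  assumes "w \<in> W"
  shows "act (daha_A qh) w = (1 / (h * (sh * qh))) *s (A *v w - (complex_of_real (\<theta> 0) - h - h * s * q) *s w)"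
    (is "_ = ?R w")
proof -
  have R_diff: "?R (u - v) = ?R u - ?R v" for u v
    by (simp add: vec.diff Finite_Cartesian_Product.vec_eq_iff algebra_simps del: One_nat_def)
  have act_diff: "act (daha_A qh) (u - v) = act (daha_A qh) u - act (daha_A qh) v" if "u \<in> W" "v \<in> W" for u v
    using act_add[OF daha_A_closed that(1) W_scale[OF that(2)], of "-1"] act_scale[OF daha_A_closed that(2), of "-1"]
    by (simp add: vector_sneg_minus1[symmetric])
  have G: "act (daha_A qh) (Gi i) = ?R (Gi i)" if "Gi i \<in> W" for i
    using daha_A_radial[OF that Gi_radial] adjacency_scalars[OF PQ_radial[OF Gi_radial]] by simp
  have C: "act (daha_A qh) (Ci i) = ?R (Ci i)" if "Ci i \<in> W" for i
    using daha_A_clique_radial[OF that Ci_clique_radial] adjacency_scalars[OF QP_clique_radial[OF Ci_clique_radial]] by simp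
  have Ci_W: "Ci i \<in> W" if "i < d" for i unfolding Ci_eq by (intro W_add Cm_W Cp_W that)
  have step: "act (daha_A qh) (Cp i) = ?R (Cp i)" if "i < d" "act (daha_A qh) (Cm i) = ?R (Cm i)" for i
  proof -
    have "Cp i = Ci i - Cm i" by (simp add: Ci_eq)
    then show ?thesis
      using that C[OF Ci_W] act_diff[OF Ci_W Cm_W] R_diff[of "Ci i" "Cm i"] by simp
  qed
  have Cm: "act (daha_A qh) (Cm i) = ?R (Cm i)" if "i < d" for i
    using that
  proof (induction i)
    case 0
    then show ?case using G[of 0] Cm_W[of 0] by (simp add: Gi_0)
  next
    case (Suc i)
    then have "Gi (Suc i) \<in> W" unfolding Gi_Suc by (intro W_add Cm_W Cp_W) auto
    moreover have "Cm (Suc i) = Gi (Suc i) - Cp i" by (simp add: Gi_Suc)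
    moreover have "act (daha_A qh) (Cp i) = ?R (Cp i)" using Suc by (intro step) auto
    moreover have "Cp i \<in> W" using Suc by (intro Cp_W) auto
    ultimately show ?case
      using G[of "Suc i"] act_diff[of "Gi (Suc i)" "Cp i"] R_diff[of "Gi (Suc i)" "Cp i"] by simp
  qed
  show ?thesis
    by (rule W_eqI[of "act (daha_A qh)" ?R])
      (auto simp only: act_add[OF daha_A_closed] act_scale[OF daha_A_closed] affine_add affine_scale
        Cm step assms)
qed

section \<open>The dual adjacency matrices as elements of the algebra\<close>

lemma daha_B_pair:
  assumes i: "i < d"
  shows "act (daha_B qh) (Cm i) = (1 / (q ^ (i + 1) * ssh) + q ^ (i + 1) * ssh) *s Cm i"
    and "act (daha_B qh) (Cp i) = (1 / (q ^ (i + 1) * ssh) + q ^ (i + 1) * ssh) *s Cp i"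
proof -
  define Y where "Y = q ^ (i + 1)"
  have Y: "Y \<noteq> 0" using nonzero by (simp add: Y_def)
  have "(1 - Rc i) * (Pc i + ss) + Rc i * Pc i = (Pc i - ss * Rc i) + ss" by (simp add: algebra_simps)
  then have PR: "(1 - Rc i) * (Pc i + ss) + Rc i * Pc i = \<rho>\<^sup>2"
    unfolding P_minus_R[OF even_denominator[OF i]] \<rho>_square by simp
  have "(Pc i + ss) / (ssh * \<rho>) * (ssh / \<rho> * (1 - Rc i)) - - (ssh / \<rho>) * Rc i * (Pc i / (ssh * \<rho>))
      = ((1 - Rc i) * (Pc i + ss) + Rc i * Pc i) / \<rho>\<^sup>2"
    using roots_neq_0 by (simp add: field_simps power2_eq_square)
  then have det0: "(Pc i + ss) / (ssh * \<rho>) * (ssh / \<rho> * (1 - Rc i)) - - (ssh / \<rho>) * Rc i * (Pc i / (ssh * \<rho>)) = 1"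
    unfolding PR using roots_neq_0 by simp
  have "(1 - Rc i) / (Y * \<rho>) * (Y / \<rho> * (Pc i + ss)) - Rc i / (Y * \<rho>) * (- (Y / \<rho>) * Pc i)
      = ((1 - Rc i) * (Pc i + ss) + Rc i * Pc i) / \<rho>\<^sup>2"
    using roots_neq_0 Y by (simp add: field_simps power2_eq_square)
  then have det3: "(1 - Rc i) / (Y * \<rho>) * (Y / \<rho> * (Pc i + ss)) - Rc i / (Y * \<rho>) * (- (Y / \<rho>) * Pc i) = 1"
    unfolding PR using roots_neq_0 by simp
  have "(1 - Rc i) / (Y * \<rho>) * ((Pc i + ss) / (ssh * \<rho>)) + Rc i / (Y * \<rho>) * (Pc i / (ssh * \<rho>))
      + (- (Y / \<rho>) * Pc i) * (- (ssh / \<rho>) * Rc i) + (Y / \<rho> * (Pc i + ss)) * (ssh / \<rho> * (1 - Rc i))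
      = ((1 - Rc i) * (Pc i + ss) + Rc i * Pc i) / \<rho>\<^sup>2 * (1 / (Y * ssh) + Y * ssh)"
    using roots_neq_0 Y by (simp add: field_simps power2_eq_square)
  then have trace: "1 / (Y * ssh) + Y * ssh =
      (1 - Rc i) / (Y * \<rho>) * ((Pc i + ss) / (ssh * \<rho>)) + Rc i / (Y * \<rho>) * (Pc i / (ssh * \<rho>))
      + (- (Y / \<rho>) * Pc i) * (- (ssh / \<rho>) * Rc i) + (Y / \<rho> * (Pc i + ss)) * (ssh / \<rho> * (1 - Rc i))"
    unfolding PR using roots_neq_0 by simp
  note pair = plus_inverse_pair[OF daha_t_Units daha_t_Units Cm_W[OF i] Cp_W[OF i]
      t3_pair[OF i, folded Y_def] det3 t0_pair[OF i] det0 trace]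
  show "act (daha_B qh) (Cm i) = (1 / (q ^ (i + 1) * ssh) + q ^ (i + 1) * ssh) *s Cm i"
    "act (daha_B qh) (Cp i) = (1 / (q ^ (i + 1) * ssh) + q ^ (i + 1) * ssh) *s Cp i"
    unfolding daha_B_def Y_def[symmetric] by (rule pair)+
qed

lemma daha_B_dagger_pair:
  assumes i: "i \<in> {1..<d}"
  shows "act (daha_B_dagger qh) (Cp (i - 1)) = (1 / (q ^ i * (ssh * qh)) + q ^ i * (ssh * qh)) *s Cp (i - 1)"
    and "act (daha_B_dagger qh) (Cm i) = (1 / (q ^ i * (ssh * qh)) + q ^ i * (ssh * qh)) *s Cm i"
proof -
  define Y g e where "Y = q ^ i" and "g = qh ^ d" and "e = ssh * qh"
  have nz: "Y \<noteq> 0" "g \<noteq> 0" "e \<noteq> 0" "g\<^sup>2 \<noteq> 0" using nonzero roots_neq_0 by (simp_all add: Y_def g_def e_def)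
  have kap: "\<kappa> = g * e" by (simp add: g_def e_def)
  have g2: "q ^ d = g\<^sup>2" using qh_power by (simp add: g_def power2_eq_square)
  have e2: "ss * q = e\<^sup>2" by (simp add: e_def power_mult_distrib roots)
  have kap2: "(g * e)\<^sup>2 = ss * q ^ (d + 1)"
    unfolding power_mult_distrib g2[symmetric] e2[symmetric] by simp
  define D where "D = 1 - e\<^sup>2 * Y\<^sup>2"
  have Deq: "1 - ss * q ^ (2 * i + 1) = D"
    unfolding D_def e2[symmetric] Y_def by (simp add: power2_eq_square mult_2_right power_add mult_ac)
  have D: "D \<noteq> 0" using odd_denominator[OF i] unfolding Deq .
  have powi: "q powi (int i - int d) = Y / g\<^sup>2"
    unfolding Y_def g2[symmetric] by (rule power_int_diff_nat[OF nonzero(1)])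
  have U: "Uc i = (1 - Y / g\<^sup>2) * (1 - e\<^sup>2 * Y) / D"
    unfolding U_coeff_def Deq powi e2[symmetric] by (simp add: Y_def)
  have V: "Vi i = (1 - Y) * (1 - e\<^sup>2 * g\<^sup>2 * Y) / D"
    unfolding V_coeff_def Deq e2[symmetric] g2[symmetric] by (simp add: Y_def power_add mult_ac)
  have Z: "Zc i = (1 - Y) * (1 - Y / g\<^sup>2) / D"
    unfolding Z_coeff_def Deq powi by (simp add: Y_def)
  have rel: "g\<^sup>2 * Uc i = Vi i - (1 - g\<^sup>2)"
    unfolding g2[symmetric] by (rule U_V_relation[OF nonzero(1) odd_denominator[OF i]])
  have UV: "Uc i * Vi i = Zc i * (1 - (g * e)\<^sup>2 + (g * e)\<^sup>2 * Zc i)"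
    unfolding kap2 by (rule U_mult_V[OF nonzero(1) odd_denominator[OF i]])
  have "(g * Uc i + 1 / g) * (1 / g * (1 - Vi i)) - - g * Uc i * (1 / g * Vi i)
      = (g\<^sup>2 * Uc i + (1 - Vi i)) / g\<^sup>2"
    using nz by (simp add: field_simps power2_eq_square)
  then have det1: "(g * Uc i + 1 / g) * (1 / g * (1 - Vi i)) - - g * Uc i * (1 / g * Vi i) = 1"
    unfolding rel using nz by simp
  have "((g * e)\<^sup>2 * Zc i + 1) / (g * e) * (g * e * (1 - Zc i)) - Y * (g * e) * Uc i * (- (Vi i / (Y * (g * e))))
      = ((g * e)\<^sup>2 * Zc i + 1) * (1 - Zc i) + Uc i * Vi i"
    using nz by simp
  also have "\<dots> = 1" unfolding UV by (simp add: algebra_simps)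
  finally have det2: "((g * e)\<^sup>2 * Zc i + 1) / (g * e) * (g * e * (1 - Zc i))
      - Y * (g * e) * Uc i * (- (Vi i / (Y * (g * e)))) = 1" .
  have "(g * Uc i + 1 / g) * (((g * e)\<^sup>2 * Zc i + 1) / (g * e)) + - g * Uc i * (- (Vi i / (Y * (g * e))))
      + 1 / g * Vi i * (Y * (g * e) * Uc i) + 1 / g * (1 - Vi i) * (g * e * (1 - Zc i))
      = (g\<^sup>2 * Uc i + 1) * (g\<^sup>2 * e\<^sup>2 * Zc i + 1) / (g\<^sup>2 * e) + Uc i * Vi i * (1 / (Y * e) + Y * e)
        + (1 - Vi i) * (1 - Zc i) * e"
    using nz by (simp add: divide_simps) (simp add: algebra_simps power2_eq_square)
  also have "g\<^sup>2 * Uc i + 1 = Vi i + g\<^sup>2" using rel by simp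
  also note trace_t1_t2[OF nz(1) nz(4) nz(3) D D_def U V Z]
  finally have trace: "1 / (Y * e) + Y * e = (g * Uc i + 1 / g) * (((g * e)\<^sup>2 * Zc i + 1) / (g * e))
      + - g * Uc i * (- (Vi i / (Y * (g * e))))
      + 1 / g * Vi i * (Y * (g * e) * Uc i) + 1 / g * (1 - Vi i) * (g * e * (1 - Zc i))" by (rule sym)
  have W: "Cp (i - 1) \<in> W" "Cm i \<in> W" using i by (auto intro: Cp_W Cm_W)
  note pair = plus_inverse_pair[OF daha_t_Units daha_t_Units W
      t1_pair[OF i, folded g_def] det1 t2_pair[OF i, unfolded kap, folded Y_def] det2 trace]
  show "act (daha_B_dagger qh) (Cp (i - 1)) = (1 / (q ^ i * (ssh * qh)) + q ^ i * (ssh * qh)) *s Cp (i - 1)"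
    "act (daha_B_dagger qh) (Cm i) = (1 / (q ^ i * (ssh * qh)) + q ^ i * (ssh * qh)) *s Cm i"
    unfolding daha_B_dagger_def Y_def[symmetric] e_def[symmetric] by (rule pair)+
qed

lemma daha_B_dagger_ends:
  shows "act (daha_B_dagger qh) (Cm 0) = (1 / (ssh * qh) + ssh * qh) *s Cm 0"
    and "act (daha_B_dagger qh) (Cp (d - 1)) = (1 / (q ^ d * (ssh * qh)) + q ^ d * (ssh * qh)) *s Cp (d - 1)"
proof -
  have W: "Cm 0 \<in> W" "Cp (d - 1) \<in> W" using d_pos by (auto intro: Cp_W Cm_W)
  have k: "k1 * \<kappa> = ssh * qh" "k1 * (1 / \<kappa>) = 1 / (q ^ d * (ssh * qh))"
    unfolding k1_def qh_power[symmetric] using roots_neq_0 by simp_all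
  have nz: "k1 * \<kappa> \<noteq> 0" "k1 * (1 / \<kappa>) \<noteq> 0" using k_neq_0 roots_neq_0 by simp_all
  show "act (daha_B_dagger qh) (Cm 0) = (1 / (ssh * qh) + ssh * qh) *s Cm 0"
    unfolding daha_B_dagger_def
    using plus_inverse_eigenvector[OF daha_t_Units daha_t_Units W(1) t1_ends(1) t2_ends(1) nz(1)]
    unfolding k by (simp only: add.commute)
  show "act (daha_B_dagger qh) (Cp (d - 1)) = (1 / (q ^ d * (ssh * qh)) + q ^ d * (ssh * qh)) *s Cp (d - 1)"
    unfolding daha_B_dagger_def
    using plus_inverse_eigenvector[OF daha_t_Units daha_t_Units W(2) t1_ends(2) t2_ends(2) nz(2)]
    unfolding k by simp
qed

lemma daha_B_dagger_eigen:
  assumes "i \<le> d"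
  shows "i < d \<Longrightarrow> act (daha_B_dagger qh) (Cm i) = (1 / (q ^ i * (ssh * qh)) + q ^ i * (ssh * qh)) *s Cm i"
    and "0 < i \<Longrightarrow> act (daha_B_dagger qh) (Cp (i - 1)) = (1 / (q ^ i * (ssh * qh)) + q ^ i * (ssh * qh)) *s Cp (i - 1)"
proof -
  show "i < d \<Longrightarrow> act (daha_B_dagger qh) (Cm i) = (1 / (q ^ i * (ssh * qh)) + q ^ i * (ssh * qh)) *s Cm i"
    using daha_B_dagger_pair(2)[of i] daha_B_dagger_ends(1) by (cases "i = 0") simp_all
  show "0 < i \<Longrightarrow> act (daha_B_dagger qh) (Cp (i - 1)) = (1 / (q ^ i * (ssh * qh)) + q ^ i * (ssh * qh)) *s Cp (i - 1)"
    using daha_B_dagger_pair(1)[of i] daha_B_dagger_ends(2) assms by (cases "i = d") simp_all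
qed

lemma daha_B_dagger_eq:
  assumes "w \<in> W"
  shows "act (daha_B_dagger qh) w = (1 / (hs * (ssh * qh))) *s (As *v w - (\<theta>s 0 - hs - hs * ss * q) *s w)"
proof -
  have closed: "daha_B_dagger qh \<in> carrier (daha qh)"
    unfolding daha_B_dagger_def by (intro plus_inverse_closed Units_mult daha_t_Units)
  have scalar: "(1 / (hs * (ssh * qh))) * (\<theta>s i - (\<theta>s 0 - hs - hs * ss * q)) = 1 / (q ^ i * (ssh * qh)) + q ^ i * (ssh * qh)"
    if "i \<le> d" for i
  proof -
    have "\<theta>s i - (\<theta>s 0 - hs - hs * ss * q) = hs * (1 / q ^ i + q ^ i * (ss * q))"
      unfolding \<theta>s_eq[OF that] using nonzero by (simp add: field_simps)
    also have "ss * q = (ssh * qh)\<^sup>2" by (simp add: power_mult_distrib roots)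
    finally have \<theta>s: "\<theta>s i - (\<theta>s 0 - hs - hs * ss * q) = hs * (1 / q ^ i + q ^ i * (ssh * qh)\<^sup>2)" .
    show ?thesis unfolding \<theta>s using nonzero roots_neq_0
      by (simp add: field_simps power2_eq_square)
  qed
  have eig: "(1 / (hs * (ssh * qh))) *s (As *v u - (\<theta>s 0 - hs - hs * ss * q) *s u)
      = (1 / (q ^ i * (ssh * qh)) + q ^ i * (ssh * qh)) *s u" if "i \<le> d" "As *v u = \<theta>s i *s u" for i u
    unfolding that(2) scalar[OF that(1), symmetric]
    by (simp add: Finite_Cartesian_Product.vec_eq_iff algebra_simps)
  show ?thesis
  proof (rule W_eqI[of "act (daha_B_dagger qh)" "\<lambda>w. (1 / (hs * (ssh * qh))) *s (As *v w - (\<theta>s 0 - hs - hs * ss * q) *s w)"])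
    fix i assume i: "i < d"
    show "act (daha_B_dagger qh) (Cm i) = (1 / (hs * (ssh * qh))) *s (As *v Cm i - (\<theta>s 0 - hs - hs * ss * q) *s Cm i)"
      using daha_B_dagger_eigen(1)[of i] eig[OF _ As_Cm, of i] i by simp
    show "act (daha_B_dagger qh) (Cp i) = (1 / (hs * (ssh * qh))) *s (As *v Cp i - (\<theta>s 0 - hs - hs * ss * q) *s Cp i)"
      using daha_B_dagger_eigen(2)[of "Suc i"] eig[OF _ As_Cp, of i] i by simp
  qed (auto simp only: act_add[OF closed] act_scale[OF closed] affine_add affine_scale assms)
qed

lemma daha_B_eq:
  assumes d2: "d \<ge> 2"
    and At: "At = clique_dual_adjacency (E 1) C"
      "At = (\<Sum>i<d. mscale (\<theta>t i) (clique_dual_idempotent adj C i))"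
    and hts: "hts = (ss / q - r1 * r2) / (ss - r1 * r2) * hs"
    and w: "w \<in> W"
  shows "act (daha_B qh) w = (1 / (hts * (ssh * q))) *s (At *v w - (\<theta>t 0 - hts - hts * (ss * q) * q) *s w)"
proof -
  have closed: "daha_B qh \<in> carrier (daha qh)"
    unfolding daha_B_def by (intro plus_inverse_closed Units_mult daha_t_Units)
  \<comment> \<open>Since \<open>r\<^sub>1 r\<^sub>2 = s s\<^sup>* q\<^bsup>d+1\<^esup>\<close>, the numerator is not zero: this amounts to \<open>s q\<^bsup>d+2\<^esup> \<noteq> 1\<close>.\<close>
  have "hts \<noteq> 0"
  proof -
    have "s * q ^ (d + 2) \<noteq> 1" by (rule s_q_neq_1) (use d2 in simp)
    moreover have "r1 * r2 * q = ss * (s * q ^ (d + 2))" unfolding r1_r2 by simp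
    ultimately have "r1 * r2 * q \<noteq> ss" using nonzero(5) by (metis mult.right_neutral mult_cancel_left)
    then show ?thesis using r_neq nonzero unfolding hts by (auto simp: field_simps)
  qed
  have scalar: "(1 / (hts * (ssh * q))) * (\<theta>c i - (\<theta>t 0 - hts - hts * (ss * q) * q))
      = 1 / (q ^ (i + 1) * ssh) + q ^ (i + 1) * ssh" if "i < d" for i
  proof -
    have "\<theta>c i - (\<theta>t 0 - hts - hts * (ss * q) * q) = hts * (1 / q ^ i + ssh\<^sup>2 * q ^ (i + 2))"
      using \<theta>c_diff[OF hts that] unfolding \<theta>t_0[OF At] roots(3)
      by (simp add: algebra_simps power2_eq_square)
    then show ?thesis using nonzero roots_neq_0 \<open>hts \<noteq> 0\<close>
      by (simp add: field_simps power2_eq_square)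
  qed
  have eig: "(1 / (hts * (ssh * q))) *s (At *v u - (\<theta>t 0 - hts - hts * (ss * q) * q) *s u)
      = (1 / (q ^ (i + 1) * ssh) + q ^ (i + 1) * ssh) *s u" if "i < d" "At *v u = \<theta>c i *s u" for i u
    unfolding that(2) scalar[OF that(1), symmetric]
    by (simp add: Finite_Cartesian_Product.vec_eq_iff algebra_simps)
  show ?thesis
  proof (rule W_eqI[of "act (daha_B qh)" "\<lambda>w. (1 / (hts * (ssh * q))) *s (At *v w - (\<theta>t 0 - hts - hts * (ss * q) * q) *s w)"])
    fix i assume i: "i < d"
    show "act (daha_B qh) (Cm i) = (1 / (hts * (ssh * q))) *s (At *v Cm i - (\<theta>t 0 - hts - hts * (ss * q) * q) *s Cm i)"
      unfolding daha_B_pair(1)[OF i] eig[OF i At_Cm[OF At]] ..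
    show "act (daha_B qh) (Cp i) = (1 / (hts * (ssh * q))) *s (At *v Cp i - (\<theta>t 0 - hts - hts * (ss * q) * q) *s Cp i)"
      unfolding daha_B_pair(2)[OF i] eig[OF i At_Cp[OF At]] ..
  qed (auto simp only: act_add[OF closed] act_scale[OF closed] affine_add affine_scale w)
qed

lemma Q_eq:
  assumes "w \<in> W"
  shows "(1 / (k0 - 1 / k0)) *s (t T0 w - (1 / k0) *s w) = orth_proj (bm_orbit adj (char_vec C)) w"
  unfolding bm_orbit_clique orth_proj_fibre_constant t0_Q[OF assms]
  by (rule scale_divide_cancel[OF k0_diff_neq_0])

lemma P_eq:
  assumes "w \<in> W"
  shows "(1 / (k1 - 1 / k1)) *s (t T1 w - (1 / k1) *s w) = orth_proj (bm_orbit adj (char_vec {x})) w"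
  unfolding bm_orbit_vertex orth_proj_fibre_constant t1_P[OF assms]
  by (rule scale_divide_cancel[OF k1_diff_neq_0])

end

section \<open>The equalities of linear maps\<close>

theorem theorem12p1:
  fixes adj :: "'v::finite \<Rightarrow> 'v \<Rightarrow> bool"
    and d :: nat
    and E :: "nat \<Rightarrow> complex^'v^'v"
    and \<theta> :: "nat \<Rightarrow> real"
    and C :: "'v set" and x :: 'v
    and A As At :: "complex^'v^'v"
    and \<theta>s \<theta>t \<phi>v \<phi> :: "nat \<Rightarrow> complex"
    and q h hs s ss r1 r2 :: complex
    and qh sh ssh r1h r2h :: complex
    and sts hts k0 k1 :: complex
    and act :: "daha_free set \<Rightarrow> complex^'v \<Rightarrow> complex^'v"
  \<comment> \<open>the graph\<close>
  assumes "distance_regular adj"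
    and "d = diameter adj" and "d \<ge> 3"
    and "Q_polynomial adj E"
    and "A = distance_matrix adj 1"
    and "A = (\<Sum>i\<le>d. mscale (complex_of_real (\<theta> i)) (E i))"
    and "\<forall>i<d. \<theta> (i + 1) < \<theta> i"
  \<comment> \<open>the Delsarte clique\<close>
    and "delsarte_clique adj (\<theta> d) C" and "x \<in> C"
    and "As = dual_adjacency (E 1) x"
    and "As = (\<Sum>i\<le>d. mscale (\<theta>s i) (dual_idempotent adj x i))"
    and "At = clique_dual_adjacency (E 1) C"
    and "At = (\<Sum>i<d. mscale (\<theta>t i) (clique_dual_idempotent adj C i))"
  \<comment> \<open>the \<open>q\<close>-Racah assumption\<close>
    and "parameter_array (bm_orbit adj (char_vec {x})) d ((*v) A) ((*v) As)
           (\<lambda>i. (*v) (E i)) (\<lambda>i. (*v) (dual_idempotent adj x i))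
           (\<lambda>i. complex_of_real (\<theta> i)) \<theta>s \<phi>v \<phi>"
    and "q_racah_type d q h hs s ss r1 r2 (\<lambda>i. complex_of_real (\<theta> i)) \<theta>s \<phi>v \<phi>"
    and "sts = ss * q"
    and "hts = (ss / q - r1 * r2) / (ss - r1 * r2) * hs"
  \<comment> \<open>the square roots\<close>
    and "qh\<^sup>2 = q" and "sh\<^sup>2 = s" and "ssh\<^sup>2 = ss" and "r1h\<^sup>2 = r1" and "r2h\<^sup>2 = r2"
    and "r1h * r2h = sh * ssh * qh ^ (d + 1)"
    and "k0 = r1h * r2h / ssh" and "k1 = 1 / qh ^ d"
  \<comment> \<open>the module\<close>
    and "daha_module qh (W_space adj C x) act"
    and "\<forall>n. represents (daha_matrix d qh ssh r1h r2h n) (act (daha_t qh n)) (W_basis adj C x)"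
  shows "(\<forall>w \<in> W_space adj C x. act (daha_A qh) w =
           (1 / (h * (sh * qh))) *s (A *v w - (complex_of_real (\<theta> 0) - h - h * s * q) *s w)) \<and>
    (\<forall>w \<in> W_space adj C x. act (daha_B qh) w =
           (1 / (hts * (ssh * q))) *s (At *v w - (\<theta>t 0 - hts - hts * sts * q) *s w)) \<and>
    (\<forall>w \<in> W_space adj C x. act (daha_B_dagger qh) w =
           (1 / (hs * (ssh * qh))) *s (As *v w - (\<theta>s 0 - hs - hs * ss * q) *s w)) \<and>
    (\<forall>w \<in> W_space adj C x.
           (1 / (k0 - 1 / k0)) *s (act (daha_t qh T0) w - (1 / k0) *s w) =
           orth_proj (bm_orbit adj (char_vec C)) w) \<and>
    (\<forall>w \<in> W_space adj C x.
           (1 / (k1 - 1 / k1)) *s (act (daha_t qh T1) w - (1 / k1) *s w) =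
           orth_proj (bm_orbit adj (char_vec {x})) w)"
proof -
  have idem: "E i \<in> bose_mesner adj" "E i ** E i = E i" if "i \<le> d" for i
  proof -
    have "primitive_idempotent (bose_mesner adj) (E i)"
      using assms(4) that unfolding Q_polynomial_def primitive_idempotent_ordering_def bij_betw_def
        assms(2)[symmetric] by blast
    then show "E i \<in> bose_mesner adj" "E i ** E i = E i" by (simp_all add: primitive_idempotent_def)
  qed
  interpret m: clique_daha_module adj d E \<theta> C x As \<theta>s \<phi>v \<phi> q h hs s ss r1 r2 qh act sh ssh r1h r2h
  proof unfold_locales
    show "distance_regular adj" "d = diameter adj" by (fact assms(1) assms(2))+
    show "1 \<le> d" using assms(3) by simp
    show "E 0 = mscale (1 / of_nat CARD('v)) all_ones"
      using assms(4) by (simp add: Q_polynomial_def primitive_idempotent_ordering_def)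
    show "E 1 \<in> bose_mesner adj" using idem(1)[of 1] assms(3) by simp
    show "E d \<in> bose_mesner adj" "E d ** E d = E d" using idem[of d] by simp_all
    show "delsarte_clique adj (\<theta> d) C" "x \<in> C" by (fact assms(8) assms(9))+
    show "As = dual_adjacency (E 1) x"
      "As = (\<Sum>i\<le>d. mscale (\<theta>s i) (dual_idempotent adj x i))" by (fact assms(10) assms(11))+
    show "parameter_array (bm_orbit adj (char_vec {x})) d ((*v) (distance_matrix adj 1)) ((*v) As)
           (\<lambda>i. (*v) (E i)) (\<lambda>i. (*v) (dual_idempotent adj x i))
           (\<lambda>i. complex_of_real (\<theta> i)) \<theta>s \<phi>v \<phi>"
      using assms(14) unfolding assms(5) .
    show "q_racah_type d q h hs s ss r1 r2 (\<lambda>i. complex_of_real (\<theta> i)) \<theta>s \<phi>v \<phi>" by (fact assms(15))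
    show "daha_module qh (W_space adj C x) act" by (fact assms(26))
    show "qh\<^sup>2 = q" "sh\<^sup>2 = s" "ssh\<^sup>2 = ss" "r1h\<^sup>2 = r1" "r2h\<^sup>2 = r2"
      "r1h * r2h = sh * ssh * qh ^ (d + 1)"
      by (fact assms(18) assms(19) assms(20) assms(21) assms(22) assms(23))+
    show "represents (daha_matrix d qh ssh r1h r2h n) (act (daha_t qh n)) (W_basis adj C x)" for n
      using assms(27) by blast
  qed
  have k: "k0 = m.k0" "k1 = m.k1"
    by (simp_all add: assms(24,25) m.k0_def m.k1_def m.\<rho>_def)
  have "d \<ge> 2" using assms(3) by simp
  then show ?thesis
    unfolding k assms(5) assms(16)
    using m.daha_A_eq m.daha_B_eq[OF _ assms(12,13,17)] m.daha_B_dagger_eq m.Q_eq m.P_eq by blast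
qed

end
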